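(* Let $(W,S)$ be an irreducible, right-angled Coxeter system with $S$ finite and $|S|\ge 3$, let $\mathbf q=(q_s)_{s\in S}\in(0,1]^S$ and let $r\in(1,\infty)$. For $\boldsymbol\varepsilon=(\varepsilon_s)_{s\in S}\in\{-1,1\}^S$ write $q_{s,\boldsymbol\varepsilon}=\varepsilon_s q_s^{\varepsilon_s}$ for $s\in S$, and $q_{w,\boldsymbol\varepsilon}=q_{s_1,\boldsymbol\varepsilon}\cdots q_{s_n,\boldsymbol\varepsilon}$ for a reduced expression $w=s_1\cdots s_n\in W$. Let $r'$ be the conjugate exponent of $r$, set $\tilde r=\min\{r,r'\}$, and let $$\tilde C=\Bigl\{\boldsymbol\varepsilon\in\{-1,1\}^S \;\Big|\; \sum_{w\in W} q_{w,\boldsymbol\varepsilon}^{\tilde r/2}\text{ converges absolutely}\Bigr\}.$$ Then $$\mathcal N_{\mathbf q}^r(W)=M\oplus\bigoplus_{\boldsymbol\varepsilon\in\tilde C}\mathbb C\,p_{\boldsymbol\varepsilon},$$ where $M$ is a factor (i.e. has trivial centre) and $p_{\boldsymbol\varepsilon}$ is the natural projection onto the one-dimensional space of Hecke eigenvectors with weight $(q_{s,\boldsymbol\varepsilon}^{1/2})_{s\in S}$. In particular, $\mathcal N_{\mathbf q}^r(W)$ is a factor if and only if $\sum_{w\in W}q_{w,\mathbf 1}^{\tilde r/2}=\infty$, where $\mathbf 1=(1)_{s\in S}$.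
   Context: A right-angled Coxeter system $(W,S)$ is given by $W=\langle S\mid (st)^{m_{st}}=e\rangle$ with $m_{ss}=1$ and $m_{st}=m_{ts}\in\{2,\infty\}$ for $s\ne t$ (no relation when $m_{st}=\infty$). It is irreducible if there is no partition $S=S_1\sqcup S_2$ into non-empty sets with $W=\langle S_1\rangle\oplus\langle S_2\rangle$. Let $|w|$ denote the word length of $w$ with respect to $S$. For real $x$ and an exponent $t>0$ of the form $r/2$, the convention $x^{t}:=\operatorname{sgn}(x)|x|^{t}$ is used; thus $q_{s,\boldsymbol\varepsilon}^{1/2}=\varepsilon_s q_s^{\varepsilon_s/2}$. Put $p_s=(q_s-1)/\sqrt{q_s}$. The generic Hecke algebra $\mathbb C_{\mathbf q}[W]$ is the $*$-algebra generated by self-adjoint elements $T_s^{(\mathbf q)}$, $s\in S$, subject to $T_s^{(\mathbf q)}T_t^{(\mathbf q)}=T_t^{(\mathbf q)}T_s^{(\mathbf q)}$ whenever $m_{st}=2$, and $(T_s^{(\mathbf q)}-q_s^{1/2})(T_s^{(\mathbf q)}+q_s^{-1/2})=0$. It is represented by bounded operators on $\ell^r(W)$ via $$\pi_{\mathbf q}^r(T_s^{(\mathbf q)})\delta_w=\begin{cases}\delta_{sw}&\text{if }|sw|>|w|,\\ \delta_{sw}+p_s\delta_w&\text{if }|sw|<|w|.\end{cases}$$ Define $\mathcal N_{\mathbf q}^r(W)=\pi_{\mathbf q}^r(\mathbb C_{\mathbf q}[W])''$ (double commutant in the bounded operators on $\ell^r(W)$). A Hecke eigenvector is a non-zero $\eta\in\ell^r(W)$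 with $T_s^{(\mathbf q)}\eta=c_s\eta$ for scalars $c_s$, for all $s\in S$; $(c_s)_{s\in S}$ is its weight. For $\boldsymbol\varepsilon\in\tilde C$ the vector $\eta_{\boldsymbol\varepsilon}=\sum_{w\in W}q_{w,\boldsymbol\varepsilon}^{1/2}\delta_w$ lies in $\ell^r(W)\cap\ell^{r'}(W)$ and spans the Hecke eigenvectors with weight $(q_{s,\boldsymbol\varepsilon}^{1/2})_s$; the natural projection $p_{\boldsymbol\varepsilon}$ is the rank-one idempotent that is a scalar multiple of $\theta\mapsto\langle\eta_{\boldsymbol\varepsilon},\theta\rangle\eta_{\boldsymbol\varepsilon}$, where $\langle\cdot,\cdot\rangle$ is the canonical duality between $\ell^{r'}(W)$ and $\ell^r(W)$. A factor here means a unital algebra whose centre consists of the scalars. The direct sum is a direct sum of algebras inside $\mathcal N^r_{\mathbf q}(W)$. *)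

theory Defs
  imports "HOL-Analysis.Analysis" "HOL-Algebra.Generated_Groups"
begin

section \<open>Group presentations and right-angled Coxeter systems\<close>

text \<open>A letter \<open>(x, True)\<close> stands for the generator \<open>x\<close> and \<open>(x, False)\<close> for its formal inverse.\<close>

definition eval_word :: "('a, 'b) monoid_scheme \<Rightarrow> ('a \<times> bool) list \<Rightarrow> 'a" where
  "eval_word G w =
     foldr (\<lambda>(x, b) g. (if b then x else inv\<^bsub>G\<^esub> x) \<otimes>\<^bsub>G\<^esub> g) w \<one>\<^bsub>G\<^esub>"

inductive word_step :: "'a set \<Rightarrow> ('a \<times> bool) list set \<Rightarrow>
    ('a \<times> bool) list \<Rightarrow> ('a \<times> bool) list \<Rightarrow> bool" for S R where
  cancel: "x \<in> S \<Longrightarrow> word_step S R (u @ [(x, b), (x, \<not> b)] @ v) (u @ v)"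
| relator: "\<rho> \<in> R \<Longrightarrow> word_step S R (u @ \<rho> @ v) (u @ v)"

text \<open>\<open>G = \<langle>S | R\<rangle>\<close>: the set \<open>S\<close> generates \<open>G\<close>, and a word is trivial in \<open>G\<close> exactly if it is
  turned into the empty word by insertion and deletion of relators and of pairs of mutually
  inverse letters, i.e. if it lies in the normal closure of \<open>R\<close> in the free group on \<open>S\<close>.\<close>

definition group_presentation ::
    "('a, 'b) monoid_scheme \<Rightarrow> 'a set \<Rightarrow> ('a \<times> bool) list set \<Rightarrow> bool" where
  "group_presentation G S R \<longleftrightarrow>
     group G \<and> S \<subseteq> carrier G \<and> generate G S = carrier G \<and>
     (\<forall>w. fst ` set w \<subseteq> S \<longrightarrow>
        (eval_word G w = \<one>\<^bsub>G\<^esub> \<longleftrightarrow> equivclp (word_step S R) w []))"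

definition coxeter_relators :: "'a set \<Rightarrow> ('a \<Rightarrow> 'a \<Rightarrow> enat) \<Rightarrow> ('a \<times> bool) list set" where
  "coxeter_relators S m =
     {concat (replicate n [(s, True), (t, True)]) | s t n. s \<in> S \<and> t \<in> S \<and> m s t = enat n}"

definition right_angled_coxeter_system ::
    "('a, 'b) monoid_scheme \<Rightarrow> 'a set \<Rightarrow> ('a \<Rightarrow> 'a \<Rightarrow> enat) \<Rightarrow> bool" where
  "right_angled_coxeter_system G S m \<longleftrightarrow>
     (\<forall>s\<in>S. m s s = 1) \<and>
     (\<forall>s\<in>S. \<forall>t\<in>S. s \<noteq> t \<longrightarrow> m s t = m t s \<and> m s t \<in> {2, \<infinity>}) \<and>
     group_presentation G S (coxeter_relators S m)"

definition irreducible_system :: "('a, 'b) monoid_scheme \<Rightarrow> 'a set \<Rightarrow> bool" where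
  "irreducible_system G S \<longleftrightarrow>
     \<not> (\<exists>S1 S2. S1 \<noteq> {} \<and> S2 \<noteq> {} \<and> S1 \<inter> S2 = {} \<and> S1 \<union> S2 = S \<and>
          (\<lambda>(x, y). x \<otimes>\<^bsub>G\<^esub> y) \<in>
            iso (G\<lparr>carrier := generate G S1\<rparr> \<times>\<times> G\<lparr>carrier := generate G S2\<rparr>) G)"

definition is_expression :: "('a, 'b) monoid_scheme \<Rightarrow> 'a set \<Rightarrow> 'a \<Rightarrow> 'a list \<Rightarrow> bool" where
  "is_expression G S w xs \<longleftrightarrow> set xs \<subseteq> S \<and> foldr (\<lambda>s g. s \<otimes>\<^bsub>G\<^esub> g) xs \<one>\<^bsub>G\<^esub> = w"

definition word_length :: "('a, 'b) monoid_scheme \<Rightarrow> 'a set \<Rightarrow> 'a \<Rightarrow> nat" where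
  "word_length G S w = (LEAST n. \<exists>xs. is_expression G S w xs \<and> length xs = n)"

definition reduced_expression :: "('a, 'b) monoid_scheme \<Rightarrow> 'a set \<Rightarrow> 'a \<Rightarrow> 'a list \<Rightarrow> bool" where
  "reduced_expression G S w xs \<longleftrightarrow> is_expression G S w xs \<and> length xs = word_length G S w"


section \<open>Signed parameters\<close>

definition signed_powr :: "real \<Rightarrow> real \<Rightarrow> real" where
  "signed_powr x t = sgn x * \<bar>x\<bar> powr t"

definition q_gen :: "('a \<Rightarrow> real) \<Rightarrow> ('a \<Rightarrow> int) \<Rightarrow> 'a \<Rightarrow> real" where
  "q_gen q \<epsilon> s = of_int (\<epsilon> s) * q s powi \<epsilon> s"

text \<open>The value does not depend on the chosen reduced expression.\<close>

definition q_elem :: "('a, 'b) monoid_scheme \<Rightarrow> 'a set \<Rightarrow> ('a \<Rightarrow> real) \<Rightarrow> ('a \<Rightarrow> int) \<Rightarrow> 'a \<Rightarrow> real" where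
  "q_elem G S q \<epsilon> w = prod_list (map (q_gen q \<epsilon>) (SOME xs. reduced_expression G S w xs))"

definition convergent_signs ::
    "('a, 'b) monoid_scheme \<Rightarrow> 'a set \<Rightarrow> ('a \<Rightarrow> real) \<Rightarrow> real \<Rightarrow> ('a \<Rightarrow> int) set" where
  "convergent_signs G S q t =
     {\<epsilon> \<in> S \<rightarrow>\<^sub>E {-1, 1}. (\<lambda>w. \<bar>signed_powr (q_elem G S q \<epsilon> w) (t / 2)\<bar>) summable_on carrier G}"


section \<open>Bounded operators on sequence spaces\<close>

type_synonym 'a operator = "('a \<Rightarrow> complex) \<Rightarrow> ('a \<Rightarrow> complex)"

definition lspace :: "real \<Rightarrow> 'a set \<Rightarrow> ('a \<Rightarrow> complex) set" where
  "lspace r X = {f. (\<forall>x. x \<notin> X \<longrightarrow> f x = 0) \<and> (\<lambda>x. cmod (f x) powr r) summable_on X}"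

definition lnorm :: "real \<Rightarrow> 'a set \<Rightarrow> ('a \<Rightarrow> complex) \<Rightarrow> real" where
  "lnorm r X f = (\<Sum>\<^sub>\<infinity>x\<in>X. cmod (f x) powr r) powr (1 / r)"

definition pairing :: "'a set \<Rightarrow> ('a \<Rightarrow> complex) \<Rightarrow> ('a \<Rightarrow> complex) \<Rightarrow> complex" where
  "pairing X f g = (\<Sum>\<^sub>\<infinity>x\<in>X. f x * g x)"

text \<open>Operators on \<open>lspace r X\<close> are represented by total functions vanishing outside of
  \<open>lspace r X\<close>, so that equality of operators is equality of functions.\<close>

definition on_lspace :: "real \<Rightarrow> 'a set \<Rightarrow> 'a operator \<Rightarrow> 'a operator" where
  "on_lspace r X T = (\<lambda>f. if f \<in> lspace r X then T f else (\<lambda>x. 0))"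

definition bounded_ops :: "real \<Rightarrow> 'a set \<Rightarrow> 'a operator set" where
  "bounded_ops r X =
     {T. (\<forall>f\<in>lspace r X. T f \<in> lspace r X) \<and>
         (\<forall>f. f \<notin> lspace r X \<longrightarrow> T f = (\<lambda>x. 0)) \<and>
         (\<forall>f\<in>lspace r X. \<forall>g\<in>lspace r X. T (\<lambda>x. f x + g x) = (\<lambda>x. T f x + T g x)) \<and>
         (\<forall>c. \<forall>f\<in>lspace r X. T (\<lambda>x. c * f x) = (\<lambda>x. c * T f x)) \<and>
         (\<exists>K. \<forall>f\<in>lspace r X. lnorm r X (T f) \<le> K * lnorm r X f)}"

definition op_zero :: "'a operator" where
  "op_zero = (\<lambda>f x. 0)"

definition op_one :: "real \<Rightarrow> 'a set \<Rightarrow> 'a operator" where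
  "op_one r X = on_lspace r X (\<lambda>f. f)"

definition op_add :: "'a operator \<Rightarrow> 'a operator \<Rightarrow> 'a operator" where
  "op_add A B = (\<lambda>f x. A f x + B f x)"

definition op_scale :: "complex \<Rightarrow> 'a operator \<Rightarrow> 'a operator" where
  "op_scale c A = (\<lambda>f x. c * A f x)"

definition commutant :: "real \<Rightarrow> 'a set \<Rightarrow> 'a operator set \<Rightarrow> 'a operator set" where
  "commutant r X A = {T \<in> bounded_ops r X. \<forall>R\<in>A. T \<circ> R = R \<circ> T}"

text \<open>Subalgebras need not contain the identity operator; a factor is unital with respect to
  its own unit.\<close>

definition operator_algebra :: "real \<Rightarrow> 'a set \<Rightarrow> 'a operator set \<Rightarrow> bool" where
  "operator_algebra r X M \<longleftrightarrow>
     M \<subseteq> bounded_ops r X \<and> op_zero \<in> M \<and>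
     (\<forall>A\<in>M. \<forall>B\<in>M. op_add A B \<in> M \<and> A \<circ> B \<in> M) \<and>
     (\<forall>c. \<forall>A\<in>M. op_scale c A \<in> M)"

definition centre :: "'a operator set \<Rightarrow> 'a operator set" where
  "centre M = {Z \<in> M. \<forall>T\<in>M. Z \<circ> T = T \<circ> Z}"

definition is_factor :: "real \<Rightarrow> 'a set \<Rightarrow> 'a operator set \<Rightarrow> bool" where
  "is_factor r X M \<longleftrightarrow>
     operator_algebra r X M \<and>
     (\<exists>e\<in>M. e \<noteq> op_zero \<and> (\<forall>T\<in>M. e \<circ> T = T \<and> T \<circ> e = T) \<and>
        centre M = range (\<lambda>c. op_scale c e))"

text \<open>Internal direct sum of algebras: each element of \<open>N\<close> is a unique sum of components,
  and products of elements of different summands vanish.\<close>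

definition algebra_direct_sum ::
    "real \<Rightarrow> 'a set \<Rightarrow> 'a operator set \<Rightarrow> 'i set \<Rightarrow> ('i \<Rightarrow> 'a operator set) \<Rightarrow> bool" where
  "algebra_direct_sum r X N I B \<longleftrightarrow>
     finite I \<and>
     (\<forall>i\<in>I. operator_algebra r X (B i)) \<and>
     (\<forall>i\<in>I. \<forall>j\<in>I. i \<noteq> j \<longrightarrow> (\<forall>A\<in>B i. \<forall>A'\<in>B j. A \<circ> A' = op_zero)) \<and>
     bij_betw (\<lambda>b f x. \<Sum>i\<in>I. b i f x) (\<Pi>\<^sub>E i\<in>I. B i) N"


section \<open>Hecke algebras and Hecke eigenvectors\<close>

definition delta :: "'a \<Rightarrow> 'a \<Rightarrow> complex" where
  "delta w = (\<lambda>v. if v = w then 1 else 0)"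

definition hecke_basis ::
    "('a, 'b) monoid_scheme \<Rightarrow> 'a set \<Rightarrow> ('a \<Rightarrow> real) \<Rightarrow> 'a \<Rightarrow> 'a \<Rightarrow> 'a \<Rightarrow> complex" where
  "hecke_basis G S q s w =
     (if word_length G S (s \<otimes>\<^bsub>G\<^esub> w) > word_length G S w
      then delta (s \<otimes>\<^bsub>G\<^esub> w)
      else (\<lambda>v. delta (s \<otimes>\<^bsub>G\<^esub> w) v
                + complex_of_real ((q s - 1) / sqrt (q s)) * delta w v))"

text \<open>The continuous linear extension of \<open>delta w \<mapsto> hecke_basis G S q s w\<close>; at each point
  at most two terms of the sum are non-zero.\<close>

definition hecke_op ::
    "('a, 'b) monoid_scheme \<Rightarrow> 'a set \<Rightarrow> ('a \<Rightarrow> real) \<Rightarrow> real \<Rightarrow> 'a \<Rightarrow> 'a operator" where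
  "hecke_op G S q r s =
     on_lspace r (carrier G) (\<lambda>f v. \<Sum>\<^sub>\<infinity>w\<in>carrier G. f w * hecke_basis G S q s w v)"

lemma hecke_op_delta:
  assumes "w \<in> carrier G"
  shows "hecke_op G S q r s (delta w) = hecke_basis G S q s w"
proof -
  have "(\<lambda>x. cmod (delta w x) powr r) summable_on carrier G \<longleftrightarrow>
      (\<lambda>x. cmod (delta w x) powr r) summable_on {w}"
    by (rule summable_on_cong_neutral) (use assms in \<open>auto simp: delta_def\<close>)
  then have mem: "delta w \<in> lspace r (carrier G)"
    using assms by (auto simp: lspace_def delta_def)
  have "(\<Sum>\<^sub>\<infinity>u\<in>carrier G. delta w u * hecke_basis G S q s u v) =
      (\<Sum>\<^sub>\<infinity>u\<in>{w}. delta w u * hecke_basis G S q s u v)" for v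
    by (rule infsum_cong_neutral) (use assms in \<open>auto simp: delta_def\<close>)
  with mem show ?thesis
    by (simp add: hecke_op_def on_lspace_def delta_def)
qed

text \<open>The image of the generic Hecke algebra under its representation, i.e. the unital algebra
  generated by the operators \<open>hecke_op G S q r s\<close> with \<open>s \<in> S\<close>.\<close>

inductive_set hecke_image ::
    "('a, 'b) monoid_scheme \<Rightarrow> 'a set \<Rightarrow> ('a \<Rightarrow> real) \<Rightarrow> real \<Rightarrow> 'a operator set" for G S q r where
  one: "op_one r (carrier G) \<in> hecke_image G S q r"
| gen: "s \<in> S \<Longrightarrow> hecke_op G S q r s \<in> hecke_image G S q r"
| add: "A \<in> hecke_image G S q r \<Longrightarrow> B \<in> hecke_image G S q r \<Longrightarrow> op_add A B \<in> hecke_image G S q r"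
| scale: "A \<in> hecke_image G S q r \<Longrightarrow> op_scale c A \<in> hecke_image G S q r"
| mult: "A \<in> hecke_image G S q r \<Longrightarrow> B \<in> hecke_image G S q r \<Longrightarrow> A \<circ> B \<in> hecke_image G S q r"

definition hecke_double_commutant ::
    "('a, 'b) monoid_scheme \<Rightarrow> 'a set \<Rightarrow> ('a \<Rightarrow> real) \<Rightarrow> real \<Rightarrow> 'a operator set" where
  "hecke_double_commutant G S q r =
     commutant r (carrier G) (commutant r (carrier G) (hecke_image G S q r))"

definition hecke_eigenvector ::
    "('a, 'b) monoid_scheme \<Rightarrow> 'a set \<Rightarrow> ('a \<Rightarrow> real) \<Rightarrow> real \<Rightarrow> ('a \<Rightarrow> complex) \<Rightarrow> ('a \<Rightarrow> complex) \<Rightarrow> bool"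
  where
  "hecke_eigenvector G S q r c \<eta> \<longleftrightarrow>
     \<eta> \<in> lspace r (carrier G) \<and> \<eta> \<noteq> (\<lambda>w. 0) \<and>
     (\<forall>s\<in>S. hecke_op G S q r s \<eta> = (\<lambda>w. c s * \<eta> w))"

definition weight :: "('a \<Rightarrow> real) \<Rightarrow> ('a \<Rightarrow> int) \<Rightarrow> 'a \<Rightarrow> complex" where
  "weight q \<epsilon> s = complex_of_real (signed_powr (q_gen q \<epsilon> s) (1 / 2))"

definition eta ::
    "('a, 'b) monoid_scheme \<Rightarrow> 'a set \<Rightarrow> ('a \<Rightarrow> real) \<Rightarrow> ('a \<Rightarrow> int) \<Rightarrow> 'a \<Rightarrow> complex" where
  "eta G S q \<epsilon> w =
     (if w \<in> carrier G then complex_of_real (signed_powr (q_elem G S q \<epsilon> w) (1 / 2)) else 0)"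

text \<open>The scalar \<open>1 / \<langle>\<eta>, \<eta>\<rangle>\<close> is the one that makes \<open>\<theta> \<mapsto> \<langle>\<eta>, \<theta>\<rangle> \<eta>\<close> idempotent.\<close>

definition natural_projection ::
    "('a, 'b) monoid_scheme \<Rightarrow> 'a set \<Rightarrow> ('a \<Rightarrow> real) \<Rightarrow> real \<Rightarrow> ('a \<Rightarrow> int) \<Rightarrow> 'a operator" where
  "natural_projection G S q r \<epsilon> =
     on_lspace r (carrier G) (\<lambda>\<theta> w.
       pairing (carrier G) (eta G S q \<epsilon>) \<theta> / pairing (carrier G) (eta G S q \<epsilon>) (eta G S q \<epsilon>)
       * eta G S q \<epsilon> w)"

end

theory Submission
  imports Defs
begin

text \<open>A central element \<open>Z\<close> is determined by \<open>\<zeta> = Z \<delta>\<^sub>e\<close>, which lies in \<open>\<ell>\<^sup>r \<inter> \<ell>\<^sup>r\<^sup>'\<close> and whose left and right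
  Hecke translates agree: \<open>\<zeta>\<close> is a trace on the Hecke algebra that vanishes at infinity. For
  non-commuting \<open>s, t\<close> the values \<open>\<kappa>(w) = \<zeta>([T\<^sub>s, T\<^sub>t] T\<^sub>w)\<close> satisfy \<open>L\<^sub>l \<kappa> + R\<^sub>l \<kappa> = p\<^sub>l \<kappa>\<close> for
  \<open>l = s, t\<close>, hence \<open>\<kappa>(l w l) = - \<kappa>(w)\<close> if \<open>l w l\<close> is longer than \<open>w\<close>. Conjugating alternately by
  \<open>s\<close> and \<open>t\<close> carries \<open>w\<close> to infinity, so that \<open>\<kappa>\<close> vanishes off the parabolic subgroup generated
  by \<open>s\<close>, \<open>t\<close> and the generators commuting with both. The Jacobi identity for a third generator
  reduces this support to \<open>{s t, t s}\<close> and, by irreducibility, yields a constant \<open>c\<close> independent of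
  \<open>s, t\<close> such that \<open>\<zeta> - c \<delta>\<^sub>e\<close> kills all commutators. Such a trace factors through the commutative
  quotient \<open>\<complex>\<^bsup>{-1, 1}^S\<^esup>\<close> of the Hecke algebra, i.e. it is a combination of the \<open>\<eta>\<^sub>\<epsilon>\<close>, and spectral
  projections show that only \<open>\<epsilon> \<in> C\<close> occur.\<close>

text \<open>The relation for \<kappa> is the quadratic relation in disguise: \<open>T_s [T_s, T_t] +
  [T_s, T_t] T_s = [T_s^2, T_t] = p_s [T_s, T_t]\<close>, and the trace property moves the left
  factor to the right. The exceptional support {s t, t s} cannot be avoided:
  \<open>delta \<one>\<close> is itself a trace and produces exactly these two values, so c is the
  multiple of it that has to be removed. The third generator of the Jacobi identity is where
  \<open>card S \<ge> 3\<close> enters.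

  The obstacle in the conjugation argument is that an element commuting with the conjugating letter
  is fixed by it, so that no chain to infinity starts there. This forces the passage to shortest
  elements of double cosets of the dihedral group, and those that commute with both s and t are what
  remains.

  No topology is put on the double commutant. Its elements commute with right multiplications, hence
  are determined by their value at \<open>delta \<one>\<close>, and with the projections. That
  \<zeta> lies in the dual space comes from the row of the matrix of Z at the identity, whose
  entries are the values of \<zeta> at inverses.\<close>

locale racg = group G for G :: "('a, 'b) monoid_scheme" (structure) +
  fixes S :: "'a set" and m :: "'a \<Rightarrow> 'a \<Rightarrow> enat"
  assumes racs: "right_angled_coxeter_system G S m"
begin

section \<open>Words in involutive generators\<close>

definition ev :: "'a list \<Rightarrow> 'a" where
  "ev xs = foldr (\<lambda>s g. s \<otimes> g) xs \<one>"

lemma ev_Nil [simp]: "ev [] = \<one>" and ev_Cons [simp]: "ev (x # xs) = x \<otimes> ev xs"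
  by (simp_all add: ev_def)

lemma pres: "group_presentation G S (coxeter_relators S m)"
  using racs by (simp add: right_angled_coxeter_system_def)

lemma gens_subset: "S \<subseteq> carrier G"
  using pres by (simp add: group_presentation_def)

lemma gen_closed [simp, intro]: "s \<in> S \<Longrightarrow> s \<in> carrier G"
  using gens_subset by auto

lemma ev_closed [simp, intro]: "set xs \<subseteq> S \<Longrightarrow> ev xs \<in> carrier G"
  by (induction xs) auto

lemma ev_append: "set xs \<subseteq> S \<Longrightarrow> set ys \<subseteq> S \<Longrightarrow> ev (xs @ ys) = ev xs \<otimes> ev ys"
  by (induction xs) (auto simp: m_assoc)

lemma eval_word_positive: "eval_word G (map (\<lambda>x. (x, True)) xs) = ev xs"
  by (induction xs) (auto simp: eval_word_def)

lemma eval_word_trivial_iff: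
  "fst ` set w \<subseteq> S \<Longrightarrow>
     eval_word G w = \<one> \<longleftrightarrow> equivclp (word_step S (coxeter_relators S m)) w []"
  using pres by (simp add: group_presentation_def)

lemma m_diag: "s \<in> S \<Longrightarrow> m s s = 1"
  using racs by (simp add: right_angled_coxeter_system_def)

lemma m_cases: "s \<in> S \<Longrightarrow> t \<in> S \<Longrightarrow> s \<noteq> t \<Longrightarrow> m s t = 2 \<or> m s t = \<infinity>"
  using racs by (auto simp: right_angled_coxeter_system_def)

lemma relator_trivial:
  assumes "\<rho> \<in> coxeter_relators S m"
  shows "eval_word G \<rho> = \<one>"
proof -
  have "word_step S (coxeter_relators S m) \<rho> []"
    using word_step.relator[OF assms, of S "[]" "[]"] by simp
  moreover have "fst ` set \<rho> \<subseteq> S"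
    using assms by (auto simp: coxeter_relators_def split: if_splits)
  ultimately show ?thesis
    by (simp add: eval_word_trivial_iff r_into_equivclp)
qed

lemma gen_square [simp]:
  assumes "s \<in> S"
  shows "s \<otimes> s = \<one>"
proof -
  have "[(s, True), (s, True)] \<in> coxeter_relators S m"
    unfolding coxeter_relators_def
    by (rule CollectI, rule exI[of _ s], rule exI[of _ s], rule exI[of _ 1])
      (use assms in \<open>auto simp: m_diag one_enat_def\<close>)
  from relator_trivial[OF this] show ?thesis
    using assms by (simp add: eval_word_def)
qed

lemma gen_square_left [simp]: "s \<in> S \<Longrightarrow> w \<in> carrier G \<Longrightarrow> s \<otimes> (s \<otimes> w) = w"
  by (metis gen_square gen_closed l_one m_assoc)

lemma gen_square_right [simp]: "s \<in> S \<Longrightarrow> w \<in> carrier G \<Longrightarrow> w \<otimes> s \<otimes> s = w"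
  by (simp add: m_assoc)

lemma inv_gen [simp]: "s \<in> S \<Longrightarrow> inv s = s"
  by (rule inv_equality) auto

lemma commute_of_m_2:
  assumes "s \<in> S" "t \<in> S" "m s t = 2"
  shows "s \<otimes> t = t \<otimes> s"
proof -
  have "[(s, True), (t, True), (s, True), (t, True)] \<in> coxeter_relators S m"
    unfolding coxeter_relators_def
    by (rule CollectI, rule exI[of _ s], rule exI[of _ t], rule exI[of _ 2])
      (use assms in \<open>auto simp: numeral_eq_enat numeral_2_eq_2\<close>)
  from relator_trivial[OF this] have "s \<otimes> (t \<otimes> (s \<otimes> t)) = \<one>"
    using assms by (simp add: eval_word_def)
  then have "s \<otimes> (s \<otimes> (t \<otimes> (s \<otimes> t))) = s"
    using assms by simp
  then have "t \<otimes> (t \<otimes> (s \<otimes> t)) = t \<otimes> s"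
    using assms by simp
  then show ?thesis
    using assms by simp
qed

lemma exists_expression:
  assumes "w \<in> carrier G"
  shows "\<exists>xs. set xs \<subseteq> S \<and> ev xs = w"
proof -
  have "w \<in> generate G S"
    using assms pres by (simp add: group_presentation_def)
  then show ?thesis
  proof (induction rule: generate.induct)
    case one
    show ?case by (rule exI[of _ "[]"]) simp
  next
    case (incl h)
    then show ?case by (intro exI[of _ "[h]"]) simp
  next
    case (inv h)
    then show ?case by (intro exI[of _ "[h]"]) simp
  next
    case (eng h1 h2)
    then obtain xs ys where "set xs \<subseteq> S" "ev xs = h1" "set ys \<subseteq> S" "ev ys = h2" by auto
    then show ?case by (intro exI[of _ "xs @ ys"]) (simp add: ev_append)
  qed
qed

lemma inv_ev: "set xs \<subseteq> S \<Longrightarrow> inv (ev xs) = ev (rev xs)"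
  by (induction xs) (auto simp: inv_mult_group ev_append)

lemma word_induct [consumes 1, case_names one step]:
  assumes "w \<in> carrier G" and "P \<one>"
    and "\<And>s w. s \<in> S \<Longrightarrow> w \<in> carrier G \<Longrightarrow> P w \<Longrightarrow> P (s \<otimes> w)"
  shows "P w"
proof -
  obtain xs where xs: "set xs \<subseteq> S" "ev xs = w"
    using exists_expression assms(1) by blast
  have "P (ev xs)"
    using xs(1) by (induction xs) (use assms in auto)
  then show ?thesis using xs by simp
qed

text \<open>Universal property of the presentation: involutions that satisfy the relators of length
  four define an action of the group. A pair with \<open>m s t = \<infinity>\<close> contributes no
  relator, so it imposes no condition. All invariants below (dihedral action, parity, reflections)
  are obtained in this way.\<close>

lemma foldr_action_eq:
  assumes sq: "\<And>s. s \<in> S \<Longrightarrow> act s \<circ> act s = id"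
    and comm: "\<And>s t. s \<in> S \<Longrightarrow> t \<in> S \<Longrightarrow> s \<noteq> t \<Longrightarrow> m s t = 2 \<Longrightarrow> act s \<circ> act t \<circ> act s \<circ> act t = id"
    and xs: "set xs \<subseteq> S" and ys: "set ys \<subseteq> S" and eq: "ev xs = ev ys"
  shows "foldr act xs = foldr act ys"
proof -
  \<comment> \<open>The sign of a letter is ignored: \<open>act x\<close> is its own inverse, so a
    generator and its formal inverse act alike.\<close>
  define A where "A = (\<lambda>w :: ('a \<times> bool) list. foldr (act \<circ> fst) w)"
  have A_app: "A (u @ v) = A u \<circ> A v" for u v
    by (auto simp: A_def)
  have A_rel: "A \<rho> = id" if rel: "\<rho> \<in> coxeter_relators S m" for \<rho>
  proof -
    obtain s t n where \<rho>: "\<rho> = concat (replicate n [(s, True), (t, True)])" "s \<in> S" "t \<in> S" "m s t = enat n"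
      using rel by (auto simp: coxeter_relators_def)
    show ?thesis
    proof (cases "s = t")
      case True
      then have "n = 1" using \<rho> m_diag[of s] by (simp add: one_enat_def)
      then show ?thesis using \<rho> True sq[of s] by (auto simp: A_def fun_eq_iff)
    next
      case False
      then have "n = 2" "m s t = 2" using \<rho> m_cases[of s t] by (auto simp: numeral_eq_enat)
      then show ?thesis using \<rho> False comm[of s t] by (auto simp: A_def fun_eq_iff numeral_2_eq_2)
    qed
  qed
  have A_step: "A u = A v" if "word_step S (coxeter_relators S m) u v" for u v
    using that
  proof cases
    case (cancel x u' b v')
    have "A [(x, b), (x, \<not> b)] = id"
      using sq[OF cancel(3)] by (auto simp: A_def fun_eq_iff)
    then show ?thesis
      unfolding cancel(1,2) A_app by simp
  next
    case (relator \<rho> u' v')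
    then show ?thesis
      unfolding relator(1,2) A_app by (simp add: A_rel)
  qed
  have A_eq: "A u = A v" if "equivclp (word_step S (coxeter_relators S m)) u v" for u v
    using that by (induction rule: equivclp_induct) (auto dest: A_step)
  have pos: "A (map (\<lambda>x. (x, True)) zs) = foldr act zs" for zs
    by (induction zs) (auto simp: A_def)
  \<comment> \<open>Reversal spells the inverse, so equality of two elements becomes triviality of
    one positive word.\<close>
  have "ev (xs @ rev ys) = \<one>"
    using xs ys eq by (simp add: ev_append inv_ev[OF ys, symmetric])
  then have "equivclp (word_step S (coxeter_relators S m)) (map (\<lambda>x. (x, True)) (xs @ rev ys)) []"
    by (subst eval_word_trivial_iff[symmetric], use xs ys in force) (simp only: eval_word_positive)
  from A_eq[OF this] have 1: "foldr act xs \<circ> foldr act (rev ys) = id"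
    using pos[of xs] pos[of "rev ys"] A_app by (simp add: A_def)
  have 2: "foldr act (rev zs) \<circ> foldr act zs = id" if "set zs \<subseteq> S" for zs
    using that
  proof (induction zs)
    case (Cons z zs)
    then have "act z (act z v) = v" for v using sq[of z] by (auto simp: fun_eq_iff)
    with Cons show ?case by (auto simp: fun_eq_iff)
  qed (auto simp: fun_eq_iff)
  have "foldr act xs = foldr act xs \<circ> (foldr act (rev ys) \<circ> foldr act ys)"
    using 2[OF ys] by simp
  also have "\<dots> = foldr act ys"
    using 1 by (simp add: comp_assoc[symmetric])
  finally show ?thesis .
qed

text \<open>The version for right actions; equality of the reversed words follows by taking
  inverses.\<close>

lemma fold_action_eq:
  assumes sq: "\<And>s. s \<in> S \<Longrightarrow> act s \<circ> act s = id"
    and comm: "\<And>s t. s \<in> S \<Longrightarrow> t \<in> S \<Longrightarrow> s \<noteq> t \<Longrightarrow> m s t = 2 \<Longrightarrow> act s \<circ> act t \<circ> act s \<circ> act t = id"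
    and xs: "set xs \<subseteq> S" and ys: "set ys \<subseteq> S" and eq: "ev xs = ev ys"
  shows "fold act xs = fold act ys"
proof -
  have "ev (rev xs) = ev (rev ys)"
    using xs ys eq by (metis inv_ev)
  then have "foldr act (rev xs) = foldr act (rev ys)"
    using xs ys by (intro foldr_action_eq[OF sq comm]) auto
  then show ?thesis by (simp add: foldr_conv_fold)
qed


lemma gen_mult_eq_one_iff:
  assumes "s \<in> S" "g \<in> carrier G"
  shows "s \<otimes> g = \<one> \<longleftrightarrow> g = s"
  using assms by (metis gen_closed gen_square gen_square_left r_one)

lemma gen_conj_eq_iff:
  assumes "s \<in> S" "g \<in> carrier G" "h \<in> carrier G"
  shows "s \<otimes> g \<otimes> s = h \<longleftrightarrow> g = s \<otimes> h \<otimes> s"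
  using assms by (metis gen_closed gen_square_left gen_square_right m_assoc m_closed)

subsection \<open>Quotients detecting generators\<close>

text \<open>The action of the infinite dihedral group \<open>\<langle>s, t\<rangle>\<close> on the integers; the other
  generators act trivially.\<close>

definition dihedral_act :: "'a \<Rightarrow> 'a \<Rightarrow> 'a \<Rightarrow> int \<Rightarrow> int" where
  "dihedral_act s t x n = (if x = s then - n else if x = t then 1 - n else n)"

lemma dihedral_act_eq:
  assumes "m s t = \<infinity>" "m t s = \<infinity>" "set xs \<subseteq> S" "set ys \<subseteq> S" "ev xs = ev ys"
  shows "foldr (dihedral_act s t) xs = foldr (dihedral_act s t) ys"
  using assms(3-5)
  by (intro foldr_action_eq) (use assms(1,2) in \<open>auto simp: dihedral_act_def fun_eq_iff\<close>)

lemma m_sym: "s \<in> S \<Longrightarrow> t \<in> S \<Longrightarrow> m s t = m t s"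
  using racs by (cases "s = t") (auto simp: right_angled_coxeter_system_def)

text \<open>In the dihedral action \<open>s t\<close> and \<open>t s\<close> send 0 to -1 and to
  1.\<close>

lemma not_commute_of_m_infinity:
  assumes "s \<in> S" "t \<in> S" "m s t = \<infinity>"
  shows "s \<otimes> t \<noteq> t \<otimes> s"
proof
  assume "s \<otimes> t = t \<otimes> s"
  then have "ev [s, t] = ev [t, s]"
    using assms by simp
  then have *: "foldr (dihedral_act s t) [s, t] = foldr (dihedral_act s t) [t, s]"
    using assms m_sym[of s t] by (intro dihedral_act_eq) auto
  have "s \<noteq> t" using assms m_diag[of s] by (auto simp: one_enat_def)
  with fun_cong[OF *, of 0] show False
    by (simp add: dihedral_act_def)
qed

lemma commute_iff_m:
  assumes "s \<in> S" "t \<in> S" "s \<noteq> t"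
  shows "s \<otimes> t = t \<otimes> s \<longleftrightarrow> m s t = 2"
  using assms m_cases commute_of_m_2 not_commute_of_m_infinity by blast

lemma m_infinity_of_not_commute:
  assumes "s \<in> S" "t \<in> S" "s \<otimes> t \<noteq> t \<otimes> s"
  shows "m s t = \<infinity>" "m t s = \<infinity>"
  using assms m_cases[of s t] commute_iff_m[of s t] m_sym[of s t] by auto

text \<open>The character of the group that is -1 on \<open>s\<close> and 1 on the other generators.
  It exists because every relator contains each letter an even number of times.\<close>

definition parity_act :: "'a \<Rightarrow> 'a \<Rightarrow> bool \<Rightarrow> bool" where
  "parity_act s x b = (b \<noteq> (x = s))"

lemma parity_act_eq:
  assumes "set xs \<subseteq> S" "set ys \<subseteq> S" "ev xs = ev ys"
  shows "foldr (parity_act s) xs = foldr (parity_act s) ys"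
  using assms by (intro foldr_action_eq) (auto simp: parity_act_def fun_eq_iff)

text \<open>Conjugate elements have the same parities, and the parity of \<open>s\<close> separates
  \<open>s\<close> from every other generator.\<close>

lemma conjugate_gens_eq:
  assumes "s \<in> S" "t \<in> S" "w \<in> carrier G" "s \<otimes> w = w \<otimes> t"
  shows "s = t"
proof (rule ccontr)
  assume "s \<noteq> t"
  obtain xs where xs: "set xs \<subseteq> S" "ev xs = w"
    using exists_expression assms(3) by blast
  have "ev (s # xs) = ev (xs @ [t])"
    using xs assms by (simp add: ev_append)
  then have "foldr (parity_act s) (s # xs) = foldr (parity_act s) (xs @ [t])"
    using xs assms by (intro parity_act_eq) auto
  from fun_cong[OF this, of True] show False
    using \<open>s \<noteq> t\<close> by (simp add: parity_act_def)
qed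

section \<open>Parabolic subgroups\<close>

definition parabolic :: "'a set \<Rightarrow> 'a set" where
  "parabolic P = {ev xs | xs. set xs \<subseteq> P}"

lemma parabolic_carrier: "P \<subseteq> S \<Longrightarrow> w \<in> parabolic P \<Longrightarrow> w \<in> carrier G"
  by (auto simp: parabolic_def)

lemma one_in_parabolic [simp, intro]: "\<one> \<in> parabolic P"
  by (auto simp: parabolic_def intro: exI[of _ "[]"])

lemma gen_in_parabolic: "P \<subseteq> S \<Longrightarrow> s \<in> P \<Longrightarrow> s \<in> parabolic P"
  unfolding parabolic_def using gen_closed by (intro CollectI exI[of _ "[s]"]) auto

lemma parabolic_mult:
  assumes "P \<subseteq> S" "u \<in> parabolic P" "w \<in> parabolic P"
  shows "u \<otimes> w \<in> parabolic P"
proof -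
  obtain xs ys where "set xs \<subseteq> P" "u = ev xs" "set ys \<subseteq> P" "w = ev ys"
    using assms by (auto simp: parabolic_def)
  then show ?thesis
    using assms(1) unfolding parabolic_def
    by (intro CollectI exI[of _ "xs @ ys"]) (auto simp: ev_append)
qed

lemma parabolic_mono: "P \<subseteq> Q \<Longrightarrow> parabolic P \<subseteq> parabolic Q"
  by (auto simp: parabolic_def)

lemma parabolic_step_iff:
  assumes "P \<subseteq> S" "s \<in> P" "w \<in> carrier G"
  shows "s \<otimes> w \<in> parabolic P \<longleftrightarrow> w \<in> parabolic P"
  using assms parabolic_mult[of P s] gen_in_parabolic[of P s] gen_square_left[of s w]
  by (metis subsetD)

lemma parabolic_step_right_iff:
  assumes "P \<subseteq> S" "s \<in> P" "w \<in> carrier G"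
  shows "w \<otimes> s \<in> parabolic P \<longleftrightarrow> w \<in> parabolic P"
  using assms parabolic_mult[of P _ s] gen_in_parabolic[of P s] gen_square_right[of s w]
  by (metis subsetD)

text \<open>The parity of \<open>s\<close> is trivial on every word that avoids
  \<open>s\<close>.\<close>

lemma gen_in_parabolic_iff:
  assumes "P \<subseteq> S" "s \<in> S"
  shows "s \<in> parabolic P \<longleftrightarrow> s \<in> P"
proof
  assume "s \<in> parabolic P"
  then obtain xs where xs: "set xs \<subseteq> P" "s = ev xs"
    by (auto simp: parabolic_def)
  show "s \<in> P"
  proof (rule ccontr)
    assume "s \<notin> P"
    with xs(1) have "foldr (parity_act s) xs b = b" for b
      by (induction xs) (auto simp: parity_act_def)
    moreover have "foldr (parity_act s) xs = foldr (parity_act s) [s]"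
      using xs assms by (intro parity_act_eq) auto
    from fun_cong[OF this, of True] have "\<not> foldr (parity_act s) xs True"
      by (simp add: parity_act_def)
    ultimately show False by simp
  qed
qed (use assms gen_in_parabolic in auto)

lemma parabolic_induct [consumes 2, case_names one step]:
  assumes "w \<in> parabolic P" "P \<subseteq> S" and "Q \<one>"
    and "\<And>s w. s \<in> P \<Longrightarrow> w \<in> parabolic P \<Longrightarrow> Q w \<Longrightarrow> Q (s \<otimes> w)"
  shows "Q w"
proof -
  obtain xs where xs: "set xs \<subseteq> P" "w = ev xs"
    using assms(1) by (auto simp: parabolic_def)
  have "Q (ev xs)"
    using xs(1)
  proof (induction xs)
    case (Cons x xs)
    then show ?case using assms(4)[of x "ev xs"] by (auto simp: parabolic_def)
  qed (use assms(3) in simp)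
  then show ?thesis using xs by simp
qed

subsection \<open>Reflections and the length function\<close>

text \<open>The classical action on signs times reflections, where the sign flips when the
  reflection is \<open>s\<close> itself. It is extended to all group elements, so that the set of
  reflections need not be singled out, and is trivial off the carrier to stay an involution.\<close>

definition refl_act :: "'a \<Rightarrow> bool \<times> 'a \<Rightarrow> bool \<times> 'a" where
  "refl_act s = (\<lambda>(b, g). if g \<in> carrier G then (b \<noteq> (g = s), s \<otimes> g \<otimes> s) else (b, g))"

lemma refl_act_eq:
  assumes "set xs \<subseteq> S" "set ys \<subseteq> S" "ev xs = ev ys"
  shows "fold refl_act xs = fold refl_act ys"
proof (rule fold_action_eq)
  show "refl_act s \<circ> refl_act s = id" if "s \<in> S" for s
    using that by (auto simp: fun_eq_iff refl_act_def gen_conj_eq_iff gen_mult_eq_one_iff)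
next
  fix s t
  assume s: "s \<in> S" and t: "t \<in> S" and "s \<noteq> t" and "m s t = 2"
  then have st: "s \<otimes> t = t \<otimes> s" by (intro commute_of_m_2)
  have ts: "t \<otimes> s \<otimes> t = s" "s \<otimes> t \<otimes> s = t" "t \<otimes> t \<otimes> t = t" "s \<otimes> s \<otimes> s = s"
    using s t by (metis st gen_closed gen_square_right, metis st gen_closed gen_square_right, simp, simp)
  \<comment> \<open>Conjugation by \<open>t\<close> fixes \<open>s\<close>, so the two sign flips
    occur at \<open>t\<close> and at \<open>s\<close>; applying the product twice flips each sign an
    even number of times.\<close>
  have 1: "refl_act s (refl_act t (b, g)) = (b \<noteq> ((g = t) \<noteq> (g = s)), s \<otimes> t \<otimes> g \<otimes> t \<otimes> s)"
    if "g \<in> carrier G" for b g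
    using s t that ts by (auto simp: refl_act_def gen_conj_eq_iff m_assoc)
  have 2: "s \<otimes> t \<otimes> g \<otimes> t \<otimes> s = h \<longleftrightarrow> g = h"
    if "g \<in> carrier G" "h = s \<or> h = t" for g h
  proof -
    have "s \<otimes> t \<otimes> g \<otimes> t \<otimes> s = s \<otimes> (t \<otimes> g \<otimes> t) \<otimes> s"
      using s t that by (simp add: m_assoc)
    also have "\<dots> = h \<longleftrightarrow> g = t \<otimes> (s \<otimes> h \<otimes> s) \<otimes> t"
      using s t that by (subst gen_conj_eq_iff; (subst gen_conj_eq_iff)?) auto
    also have "t \<otimes> (s \<otimes> h \<otimes> s) \<otimes> t = h"
      using that(2) s t ts by (auto simp: m_assoc)
    finally show ?thesis .
  qed
  have 3: "s \<otimes> t \<otimes> (s \<otimes> t \<otimes> g \<otimes> t \<otimes> s) \<otimes> t \<otimes> s = g" if "g \<in> carrier G" for g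
  proof -
    have "t \<otimes> (s \<otimes> (t \<otimes> s)) = t \<otimes> s \<otimes> t \<otimes> s"
      using s t by (simp add: m_assoc)
    also have "\<dots> = \<one>" using s ts by simp
    finally have 4: "t \<otimes> (s \<otimes> (t \<otimes> s)) = \<one>" .
    have "s \<otimes> (t \<otimes> (s \<otimes> (t \<otimes> g))) = s \<otimes> t \<otimes> s \<otimes> t \<otimes> g"
      using s t that by (simp add: m_assoc)
    also have "\<dots> = g" using s t that ts by simp
    finally have 5: "s \<otimes> (t \<otimes> (s \<otimes> (t \<otimes> g))) = g" .
    show ?thesis
      using s t that by (simp add: m_assoc 4 5)
  qed
  show "refl_act s \<circ> refl_act t \<circ> refl_act s \<circ> refl_act t = id"
  proof
    fix x :: "bool \<times> 'a"
    obtain b g where x: "x = (b, g)" by (cases x)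
    show "(refl_act s \<circ> refl_act t \<circ> refl_act s \<circ> refl_act t) x = id x"
    proof (cases "g \<in> carrier G")
      case True
      define g' where "g' = s \<otimes> t \<otimes> g \<otimes> t \<otimes> s"
      have g': "g' \<in> carrier G" "g' = t \<longleftrightarrow> g = t" "g' = s \<longleftrightarrow> g = s" "s \<otimes> t \<otimes> g' \<otimes> t \<otimes> s = g"
        using s t True 2[OF True, of t] 2[OF True, of s] 3[OF True] by (auto simp: g'_def)
      have "refl_act s (refl_act t (b, g)) = (b \<noteq> ((g = t) \<noteq> (g = s)), g')"
        using 1[OF True] by (simp add: g'_def)
      moreover have "refl_act s (refl_act t (b', g')) = (b' \<noteq> ((g = t) \<noteq> (g = s)), g)" for b'
        unfolding 1[OF g'(1)] by (simp only: g'(2-4))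
      ultimately show ?thesis
        by (auto simp: x)
    next
      case False
      then show ?thesis by (simp add: x refl_act_def)
    qed
  qed
qed (use assms in auto)

text \<open>For a reflection \<open>g\<close>, \<open>inversion w g\<close> holds iff \<open>g\<close> shortens \<open>w\<close> from the left. The
  definition counts modulo 2 how often \<open>g\<close> occurs among the reflections
  \<open>x\<^sub>1 \<dots> x\<^sub>i \<dots> x\<^sub>1\<close> of an expression of \<open>w\<close>.\<close>

definition inversion :: "'a \<Rightarrow> 'a \<Rightarrow> bool" where
  "inversion w g = fst (fold refl_act (SOME xs. set xs \<subseteq> S \<and> ev xs = w) (False, g))"

lemma inversion_ev:
  assumes "set xs \<subseteq> S"
  shows "inversion (ev xs) g = fst (fold refl_act xs (False, g))"
proof -
  have "set (SOME ys. set ys \<subseteq> S \<and> ev ys = ev xs) \<subseteq> S \<and> ev (SOME ys. set ys \<subseteq> S \<and> ev ys = ev xs) = ev xs"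
    by (rule someI[of _ xs]) (use assms in simp)
  then show ?thesis
    unfolding inversion_def using refl_act_eq[of _ xs] assms by metis
qed

lemma fst_fold_refl_act: "fst (fold refl_act xs (b, g)) = (b \<noteq> fst (fold refl_act xs (False, g)))"
proof (induction xs arbitrary: b g)
  case (Cons x xs)
  show ?case
  proof (cases "g \<in> carrier G")
    case True
    then show ?thesis
      using Cons[of "b \<noteq> (g = x)" "x \<otimes> g \<otimes> x"] Cons[of "g = x" "x \<otimes> g \<otimes> x"]
      by (auto simp: refl_act_def)
  next
    case False
    then show ?thesis
      using Cons[of b g] by (simp add: refl_act_def)
  qed
qed simp

lemma inversion_one [simp]: "\<not> inversion \<one> g"
  using inversion_ev[of "[]" g] by simp

lemma inversion_step:
  assumes "s \<in> S" "w \<in> carrier G" "g \<in> carrier G"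
  shows "inversion (s \<otimes> w) g = ((g = s) \<noteq> inversion w (s \<otimes> g \<otimes> s))"
proof -
  obtain xs where xs: "set xs \<subseteq> S" "ev xs = w"
    using exists_expression assms(2) by blast
  have "inversion (s \<otimes> w) g = fst (fold refl_act (s # xs) (False, g))"
    using inversion_ev[of "s # xs" g] xs assms by simp
  also have "\<dots> = ((g = s) \<noteq> fst (fold refl_act xs (False, s \<otimes> g \<otimes> s)))"
    using assms fst_fold_refl_act[of xs "g = s" "s \<otimes> g \<otimes> s"] by (simp add: refl_act_def)
  finally show ?thesis
    using inversion_ev[of xs] xs by simp
qed

text \<open>The cocycle identity: the inversions of a product are the symmetric difference of those
  of \<open>u\<close> and the conjugates by \<open>u\<close> of those of \<open>w\<close>.\<close>

lemma inversion_mult: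
  assumes "u \<in> carrier G" "w \<in> carrier G" "g \<in> carrier G"
  shows "inversion (u \<otimes> w) g = (inversion u g \<noteq> inversion w (inv u \<otimes> g \<otimes> u))"
  using assms(1,3)
proof (induction arbitrary: g rule: word_induct)
  case one
  then show ?case using assms(2) by simp
next
  case (step s u)
  have "inversion (s \<otimes> u \<otimes> w) g = inversion (s \<otimes> (u \<otimes> w)) g"
    using step assms by (simp add: m_assoc)
  also have "\<dots> = ((g = s) \<noteq> (inversion u (s \<otimes> g \<otimes> s) \<noteq> inversion w (inv u \<otimes> (s \<otimes> g \<otimes> s) \<otimes> u)))"
    using step assms by (simp add: inversion_step)
  also have "inv u \<otimes> (s \<otimes> g \<otimes> s) \<otimes> u = inv (s \<otimes> u) \<otimes> g \<otimes> (s \<otimes> u)"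
    using step by (simp add: inv_mult_group m_assoc)
  finally show ?case
    using step by (auto simp: inversion_step)
qed

definition len :: "'a \<Rightarrow> nat" where "len w = word_length G S w"

lemma is_expression_iff: "is_expression G S w xs \<longleftrightarrow> set xs \<subseteq> S \<and> ev xs = w"
  by (simp add: is_expression_def ev_def)

lemma exists_reduced:
  assumes "w \<in> carrier G"
  shows "\<exists>xs. set xs \<subseteq> S \<and> ev xs = w \<and> length xs = len w"
proof -
  have "\<exists>xs. is_expression G S w xs \<and> length xs = word_length G S w"
    unfolding word_length_def
    by (rule LeastI_ex) (use exists_expression[OF assms] in \<open>auto simp: is_expression_iff\<close>)
  then show ?thesis by (auto simp: is_expression_iff len_def)
qed

lemma len_ev_le: "set xs \<subseteq> S \<Longrightarrow> len (ev xs) \<le> length xs"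
  unfolding len_def word_length_def by (rule Least_le) (auto simp: is_expression_iff)

lemma len_one [simp]: "len \<one> = 0"
  using len_ev_le[of "[]"] by simp

lemma len_mult_le:
  assumes "u \<in> carrier G" "w \<in> carrier G"
  shows "len (u \<otimes> w) \<le> len u + len w"
proof -
  obtain xs ys where "set xs \<subseteq> S" "ev xs = u" "length xs = len u" "set ys \<subseteq> S" "ev ys = w" "length ys = len w"
    using exists_reduced assms by metis
  then show ?thesis
    using len_ev_le[of "xs @ ys"] by (simp add: ev_append)
qed

lemma len_gen_le: "s \<in> S \<Longrightarrow> len s \<le> 1"
  using len_ev_le[of "[s]"] by simp

lemma len_inv:
  assumes "w \<in> carrier G"
  shows "len (inv w) = len w"
proof -
  have *: "len (inv w) \<le> len w" if w: "w \<in> carrier G" for w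
  proof -
    obtain xs where xs: "set xs \<subseteq> S" "ev xs = w" "length xs = len w"
      using exists_reduced w by blast
    have "len (ev (rev xs)) \<le> length xs"
      using len_ev_le[of "rev xs"] xs by simp
    then show ?thesis
      using xs inv_ev[of xs] by simp
  qed
  show ?thesis
    using *[OF assms] *[of "inv w"] assms by simp
qed

text \<open>Either the first letter is \<open>g\<close> and is struck out, or the conjugate of
  \<open>g\<close> by that letter is an inversion of the tail and shortens it.\<close>

lemma strong_exchange:
  assumes "set xs \<subseteq> S" "g \<in> carrier G" "inversion (ev xs) g"
  shows "\<exists>zs. set zs \<subseteq> S \<and> ev zs = g \<otimes> ev xs \<and> length zs < length xs"
  using assms
proof (induction xs arbitrary: g)
  case Nil
  then show ?case by simp
next
  case (Cons x xs)
  show ?case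
  proof (cases "g = x")
    case True
    then show ?thesis using Cons by (intro exI[of _ xs]) auto
  next
    case False
    then have "inversion (ev xs) (x \<otimes> g \<otimes> x)"
      using Cons by (simp add: inversion_step)
    from Cons.IH[OF _ _ this] obtain zs where zs: "set zs \<subseteq> S" "ev zs = x \<otimes> g \<otimes> x \<otimes> ev xs" "length zs < length xs"
      using Cons by auto
    then show ?thesis
      using Cons by (intro exI[of _ "x # zs"]) (auto simp: m_assoc)
  qed
qed

lemma len_less_of_inversion:
  assumes "w \<in> carrier G" "g \<in> carrier G" "inversion w g"
  shows "len (g \<otimes> w) < len w"
proof -
  obtain xs where xs: "set xs \<subseteq> S" "ev xs = w" "length xs = len w"
    using exists_reduced assms by blast
  obtain zs where "set zs \<subseteq> S" "ev zs = g \<otimes> w" "length zs < length xs"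
    using strong_exchange[of xs g] xs assms by auto
  then show ?thesis using len_ev_le[of zs] xs by simp
qed

section \<open>Left and right descents\<close>

definition ldesc :: "'a \<Rightarrow> 'a \<Rightarrow> bool" where "ldesc s w \<longleftrightarrow> len (s \<otimes> w) < len w"

definition rdesc :: "'a \<Rightarrow> 'a \<Rightarrow> bool" where "rdesc s w \<longleftrightarrow> len (w \<otimes> s) < len w"

text \<open>Exactly one of \<open>w\<close> and \<open>s w\<close> has \<open>s\<close> as an
  inversion, and an inversion always shortens. Hence descents inherit the cocycle identity, which
  replaces length computations from here on.\<close>

lemma ldesc_iff_inversion:
  assumes "s \<in> S" "w \<in> carrier G"
  shows "ldesc s w \<longleftrightarrow> inversion w s"
proof
  assume "ldesc s w"
  show "inversion w s"
  proof (rule ccontr)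
    assume "\<not> inversion w s"
    then have "inversion (s \<otimes> w) s"
      using assms by (simp add: inversion_step)
    from len_less_of_inversion[OF _ _ this] \<open>ldesc s w\<close> assms show False
      by (simp add: ldesc_def)
  qed
qed (use assms len_less_of_inversion in \<open>auto simp: ldesc_def\<close>)

lemma ldesc_mult_self:
  assumes "s \<in> S" "w \<in> carrier G"
  shows "ldesc s (s \<otimes> w) \<longleftrightarrow> \<not> ldesc s w"
  using assms by (simp add: ldesc_iff_inversion inversion_step)

lemma len_ldesc:
  assumes "s \<in> S" "w \<in> carrier G" "ldesc s w"
  shows "len w = Suc (len (s \<otimes> w))"
  using assms len_mult_le[of s "s \<otimes> w"] len_gen_le[of s] by (simp add: ldesc_def)

lemma len_not_ldesc:
  assumes "s \<in> S" "w \<in> carrier G" "\<not> ldesc s w"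
  shows "len (s \<otimes> w) = Suc (len w)"
  using len_ldesc[of s "s \<otimes> w"] assms by (simp add: ldesc_mult_self)

lemma rdesc_iff_ldesc_inv:
  assumes "s \<in> S" "w \<in> carrier G"
  shows "rdesc s w \<longleftrightarrow> ldesc s (inv w)"
  using assms len_inv[of "w \<otimes> s"] len_inv[of w] by (simp add: rdesc_def ldesc_def inv_mult_group)

lemma rdesc_mult_self:
  assumes "s \<in> S" "w \<in> carrier G"
  shows "rdesc s (w \<otimes> s) \<longleftrightarrow> \<not> rdesc s w"
  using assms by (simp add: rdesc_iff_ldesc_inv inv_mult_group ldesc_mult_self)

lemma len_rdesc:
  assumes "s \<in> S" "w \<in> carrier G" "rdesc s w"
  shows "len w = Suc (len (w \<otimes> s))"
  using assms len_mult_le[of "w \<otimes> s" s] len_gen_le[of s] by (simp add: rdesc_def)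

lemma len_not_rdesc:
  assumes "s \<in> S" "w \<in> carrier G" "\<not> rdesc s w"
  shows "len (w \<otimes> s) = Suc (len w)"
  using len_rdesc[of s "w \<otimes> s"] assms by (simp add: rdesc_mult_self)

lemma not_ldesc_one [simp]: "\<not> ldesc s \<one>" and not_rdesc_one [simp]: "\<not> rdesc s \<one>"
  by (simp_all add: ldesc_def rdesc_def)

lemma ldesc_mult_commuting:
  assumes "s \<in> S" "t \<in> S" "s \<noteq> t" "s \<otimes> t = t \<otimes> s" "w \<in> carrier G"
  shows "ldesc s (t \<otimes> w) \<longleftrightarrow> ldesc s w"
proof -
  have "t \<otimes> s \<otimes> t = s"
    using assms by (metis gen_closed gen_square_right)
  then show ?thesis
    using assms by (simp add: ldesc_iff_inversion inversion_step)
qed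

text \<open>Right multiplication by \<open>t\<close> changes the inversions of \<open>w\<close> only
  at the reflection \<open>w t w^-1\<close>, and the hypothesis says that \<open>s\<close> is not
  this reflection.\<close>

lemma ldesc_mult_right:
  assumes "s \<in> S" "t \<in> S" "w \<in> carrier G" "s \<otimes> w \<noteq> w \<otimes> t"
  shows "ldesc s (w \<otimes> t) \<longleftrightarrow> ldesc s w"
proof -
  have "inversion t g \<longleftrightarrow> g = t" if "g \<in> carrier G" for g
    using inversion_step[of t \<one> g] that assms by simp
  moreover have "w \<otimes> (inv w \<otimes> s \<otimes> w) = s \<otimes> w"
    using assms by (simp add: m_assoc[symmetric])
  then have "inv w \<otimes> s \<otimes> w \<noteq> t"
    using assms by metis
  ultimately show ?thesis
    using assms by (simp add: ldesc_iff_inversion inversion_mult)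
qed

lemma rdesc_mult_left:
  assumes "s \<in> S" "t \<in> S" "w \<in> carrier G" "s \<otimes> w \<noteq> w \<otimes> t"
  shows "rdesc t (s \<otimes> w) \<longleftrightarrow> rdesc t w"
proof -
  have "t \<otimes> inv w \<noteq> inv w \<otimes> s"
  proof
    assume "t \<otimes> inv w = inv w \<otimes> s"
    then have "w \<otimes> (t \<otimes> inv w) \<otimes> w = w \<otimes> (inv w \<otimes> s) \<otimes> w" by simp
    moreover have "w \<otimes> (t \<otimes> inv w) \<otimes> w = w \<otimes> t" "w \<otimes> (inv w \<otimes> s) \<otimes> w = s \<otimes> w"
      using assms(1-3) by (simp_all add: m_assoc, simp add: m_assoc[symmetric])
    ultimately show False using assms by simp
  qed
  from ldesc_mult_right[OF assms(2,1) _ this] show ?thesis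
    using assms by (simp add: rdesc_iff_ldesc_inv inv_mult_group)
qed

text \<open>All inversions of an element of a parabolic subgroup lie in that subgroup. The induction
  needs this for arbitrary group elements, since they get conjugated.\<close>

lemma not_ldesc_parabolic:
  assumes "P \<subseteq> S" "s \<in> S" "s \<notin> P" "w \<in> parabolic P"
  shows "\<not> ldesc s w"
proof -
  have "\<not> inversion w g" if "g \<in> carrier G" "g \<notin> parabolic P" for g
    using assms(4,1) that
  proof (induction arbitrary: g rule: parabolic_induct)
    case (step x w)
    have x: "x \<in> S" using step assms by auto
    have "g \<noteq> x" using step assms gen_in_parabolic by auto
    moreover have "x \<otimes> g \<otimes> x \<notin> parabolic P"
      using step x assms by (simp add: parabolic_step_iff parabolic_step_right_iff)
    ultimately show ?case
      using step x assms parabolic_carrier[of P w] by (simp add: inversion_step)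
  qed simp
  then show ?thesis
    using assms gen_in_parabolic_iff[of P s] parabolic_carrier[of P w] by (simp add: ldesc_iff_inversion)
qed

lemma inv_in_parabolic:
  assumes "P \<subseteq> S" "w \<in> parabolic P"
  shows "inv w \<in> parabolic P"
proof -
  obtain xs where "set xs \<subseteq> P" "w = ev xs"
    using assms by (auto simp: parabolic_def)
  then show ?thesis
    using assms(1) inv_ev[of xs] unfolding parabolic_def
    by (intro CollectI exI[of _ "rev xs"]) auto
qed

lemma not_rdesc_parabolic:
  assumes "P \<subseteq> S" "s \<in> S" "s \<notin> P" "w \<in> parabolic P"
  shows "\<not> rdesc s w"
  using assms parabolic_carrier[of P w] inv_in_parabolic[of P w] not_ldesc_parabolic[of P s "inv w"]
  by (simp add: rdesc_iff_ldesc_inv)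

text \<open>Two equal neighbouring letters cancel. For a pair of generators this leaves the
  alternating normal form of the dihedral group.\<close>

lemma alternating_expression:
  assumes "set xs \<subseteq> P" "P \<subseteq> S"
  shows "\<exists>ys. set ys \<subseteq> P \<and> distinct_adj ys \<and> ev ys = ev xs"
  using assms(1)
proof (induction xs)
  case Nil
  then show ?case by (intro exI[of _ "[]"]) simp
next
  case (Cons x xs)
  then obtain ys where ys: "set ys \<subseteq> P" "distinct_adj ys" "ev ys = ev xs" by auto
  show ?case
  proof (cases "ys \<noteq> [] \<and> hd ys = x")
    case True
    then obtain zs where zs: "ys = x # zs" by (cases ys) auto
    have "ev zs \<in> carrier G" "x \<in> S"
      using ys Cons.prems assms zs by (auto intro!: ev_closed)
    then have "ev zs = ev (x # xs)"
      by (simp add: zs flip: ys(3))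
    then show ?thesis using ys zs by (intro exI[of _ zs]) (auto simp: distinct_adj_Cons)
  next
    case False
    then show ?thesis
      using ys Cons by (intro exI[of _ "x # ys"]) (auto simp: distinct_adj_Cons)
  qed
qed

text \<open>On the real line \<open>s\<close> is the reflection at 0, \<open>t\<close> the one at
  1/2, and \<open>ys\<close> the one with mirror c/2. An alternating word starting with
  \<open>s\<close> moves the base chamber (0, 1/2) to the left, across mirrors with c \<le> 0 only;
  one starting with \<open>t\<close> moves it to the right, across mirrors with c \<ge> 1. The
  hypothesis places the mirror on the opposite side.\<close>

lemma not_inversion_alternating:
  assumes "s \<in> S" "t \<in> S" "m s t = \<infinity>" "m t s = \<infinity>"
    and "set d \<subseteq> {s, t}" "distinct_adj d" "set ys \<subseteq> S"
    and "\<And>n. foldr (dihedral_act s t) ys n = c - n"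
    and "d \<noteq> [] \<Longrightarrow> if hd d = s then c \<ge> 1 else c \<le> 0"
  shows "\<not> inversion (ev d) (ev ys)"
  using assms(5-)
proof (induction d arbitrary: ys c)
  case Nil
  then show ?case by simp
next
  case (Cons x d)
  have "s \<noteq> t" using assms m_diag[of s] by (auto simp: one_enat_def)
  have x: "x \<in> S" "x = s \<or> x = t" using Cons assms by auto
  have "ev ys \<noteq> ev [x]"
  proof
    assume "ev ys = ev [x]"
    then have "foldr (dihedral_act s t) ys = foldr (dihedral_act s t) [x]"
      using x Cons assms by (intro dihedral_act_eq) auto
    from fun_cong[OF this, of 0] show False
      using Cons.prems(4)[of 0] Cons.prems(5) x \<open>s \<noteq> t\<close> by (auto simp: dihedral_act_def split: if_splits)
  qed
  then have ne: "ev ys \<noteq> x" using x by simp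
  have "\<not> inversion (ev d) (ev (x # ys @ [x]))"
  \<comment> \<open>Conjugation by \<open>s\<close> moves the mirror c/2 to -c/2, conjugation by
    \<open>t\<close> moves it to 1 - c/2.\<close>
  proof (rule Cons.IH[where c = "if x = s then - c else 2 - c"])
    show "foldr (dihedral_act s t) (x # ys @ [x]) n = (if x = s then - c else 2 - c) - n" for n
    proof -
      have "dihedral_act s t s k = - k" "dihedral_act s t t k = 1 - k" for k
        using \<open>s \<noteq> t\<close> by (auto simp: dihedral_act_def)
      then show ?thesis using Cons.prems(4) x by auto
    qed
    show "if hd d = s then (if x = s then - c else 2 - c) \<ge> 1 else (if x = s then - c else 2 - c) \<le> 0" if "d \<noteq> []"
      using Cons.prems x \<open>s \<noteq> t\<close> that by (cases d) (auto simp: distinct_adj_Cons split: if_splits)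
  qed (use Cons x in \<open>auto simp: distinct_adj_Cons\<close>)
  moreover have "set d \<subseteq> S" using Cons.prems assms by auto
  moreover have "ev (x # ys @ [x]) = x \<otimes> ev ys \<otimes> x"
    using x Cons.prems by (simp add: ev_append m_assoc)
  ultimately show ?case
    using ne x Cons.prems(3) by (simp add: inversion_step)
qed

text \<open>Pass to an element \<open>y\<close> of minimal length in the coset \<open>\<langle>s, t\<rangle> w\<close>. By the exchange property
  no reflection of \<open>\<langle>s, t\<rangle>\<close> is an inversion of \<open>y\<close>, so that the descents of \<open>w\<close> in \<open>{s, t}\<close> are
  those of an element of the infinite dihedral group.\<close>

lemma ldescs_commute:
  assumes s: "s \<in> S" and t: "t \<in> S" and w: "w \<in> carrier G" and ds: "ldesc s w" and dt: "ldesc t w"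
  shows "s \<otimes> t = t \<otimes> s"
proof (rule ccontr)
  assume "s \<otimes> t \<noteq> t \<otimes> s"
  then have inf: "m s t = \<infinity>" "m t s = \<infinity>"
    using m_infinity_of_not_commute s t by auto
  have st: "{s, t} \<subseteq> S" using s t by simp
  obtain e where e: "set e \<subseteq> {s, t}" and e_min: "\<And>e'. set e' \<subseteq> {s, t} \<Longrightarrow> len (ev e \<otimes> w) \<le> len (ev e' \<otimes> w)"
    using ex_has_least_nat[of "\<lambda>e. set e \<subseteq> {s, t}" "[]" "\<lambda>e. len (ev e \<otimes> w)"] by auto
  define y where "y = ev e \<otimes> w"
  have eS: "set e \<subseteq> S" using e st by blast
  then have y: "y \<in> carrier G" by (simp add: y_def w)
  obtain d where d: "set d \<subseteq> {s, t}" "distinct_adj d" "ev d = ev (rev e)"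
    using alternating_expression[of "rev e" "{s, t}"] e st by auto
  have dS: "set d \<subseteq> S" using d st by blast
  have "ev (rev e) \<otimes> y = w"
    using eS w inv_ev[OF eS] by (simp add: y_def m_assoc[symmetric] inv_ev[OF eS, symmetric])
  then have w_eq: "w = ev d \<otimes> y" using d by simp
  have not_inv: "\<not> inversion y (inv (ev d) \<otimes> l \<otimes> ev d)" if l: "l \<in> {s, t}" for l
  proof
    have lS: "l \<in> S" using l s t by auto
    assume "inversion y (inv (ev d) \<otimes> l \<otimes> ev d)"
    then have "len (inv (ev d) \<otimes> l \<otimes> ev d \<otimes> y) < len y"
      using y dS lS by (intro len_less_of_inversion) auto
    also have "inv (ev d) \<otimes> l \<otimes> ev d \<otimes> y = ev (rev d @ [l]) \<otimes> w"
      using dS lS y by (simp add: w_eq inv_ev ev_append m_assoc)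
    finally show False
      using e_min[of "rev d @ [l]"] d l by (auto simp: y_def)
  qed
  have inv_d: "inversion (ev d) l" if "l \<in> {s, t}" for l
  proof -
    have "l \<in> S" "ldesc l w" using that assms by auto
    then show ?thesis
      using not_inv[OF that] dS y w by (simp add: ldesc_iff_inversion w_eq inversion_mult)
  qed
  have "s \<noteq> t" using \<open>s \<otimes> t \<noteq> t \<otimes> s\<close> by auto
  \<comment> \<open>The letter that does not begin \<open>d\<close> is no inversion:
    \<open>t\<close> is the reflection with c = 1 and \<open>s\<close> the one with c = 0. For empty
    \<open>d\<close> either letter serves.\<close>
  have "\<not> inversion (ev d) (ev [if hd d = s then t else s])"
    using d s t inf \<open>s \<noteq> t\<close>
    by (intro not_inversion_alternating[of s t d _ "if hd d = s then 1 else 0"]) (auto simp: dihedral_act_def)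
  then show False
    using inv_d s t by (auto split: if_splits)
qed

lemma rdescs_commute:
  assumes "s \<in> S" "t \<in> S" "w \<in> carrier G" "rdesc s w" "rdesc t w"
  shows "s \<otimes> t = t \<otimes> s"
  using ldescs_commute[of s t "inv w"] assms by (simp add: rdesc_iff_ldesc_inv)

text \<open>The link of \<open>s\<close> in the commutation graph. Leaving out \<open>s\<close>
  itself ensures that no element of the parabolic subgroup of this set has \<open>s\<close> as a
  descent.\<close>

definition centralizing :: "'a \<Rightarrow> 'a set" where
  "centralizing s = {t \<in> S. t \<noteq> s \<and> s \<otimes> t = t \<otimes> s}"

text \<open>The first letter \<open>x\<close> of \<open>w\<close> is a descent of \<open>w s\<close>
  as well, and \<open>s\<close> is a descent of \<open>w s = s w\<close>. Two descents of one
  element commute, so \<open>x\<close> belongs to the link of \<open>s\<close> and can be split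
  off.\<close>

lemma commuting_in_parabolic:
  assumes "w \<in> carrier G" "s \<in> S" "s \<otimes> w = w \<otimes> s" "\<not> ldesc s w"
    "w \<in> parabolic P" "P \<subseteq> S"
  shows "w \<in> parabolic (P \<inter> centralizing s)"
  using assms(1,3-5)
proof (induction "len w" arbitrary: w rule: less_induct)
  case less
  show ?case
  proof (cases "w = \<one>")
    case False
    obtain xs where xs: "set xs \<subseteq> S" "ev xs = w" "length xs = len w"
      using exists_reduced less by blast
    with False obtain x ys where xs_eq: "xs = x # ys" by (cases xs) auto
    define v where "v = ev ys"
    have x: "x \<in> S" and v: "v \<in> carrier G" and w_eq: "w = x \<otimes> v" using xs xs_eq by (auto simp: v_def)
    have "len v < len w" using xs xs_eq len_ev_le[of ys] by (simp add: v_def)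
    then have dx: "ldesc x w" using x v by (simp add: ldesc_def w_eq)
    have xP: "x \<in> P" using not_ldesc_parabolic[of P x w] dx x less assms by blast
    have "x \<noteq> s" using dx less by auto
    have "ldesc x (w \<otimes> s)"
      using ldesc_mult_right[of x s w] conjugate_gens_eq[of x s w] x assms less \<open>x \<noteq> s\<close> dx by blast
    moreover have "ldesc s (w \<otimes> s)"
      using less assms by (simp add: ldesc_mult_self flip: less.prems(2))
    ultimately have xs_comm: "x \<otimes> s = s \<otimes> x"
      using ldescs_commute[of x s "w \<otimes> s"] x assms less by simp
    have "s \<otimes> v = v \<otimes> s"
    proof -
      have "x \<otimes> (s \<otimes> v) = x \<otimes> (v \<otimes> s)"
        using less.prems(2) x v assms xs_comm by (simp add: w_eq m_assoc[symmetric])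
      then show ?thesis using x v assms by simp
    qed
    moreover have "\<not> ldesc s v"
      using ldesc_mult_commuting[of s x v] less.prems(3) x v assms xs_comm \<open>x \<noteq> s\<close> by (simp add: w_eq)
    moreover have "v \<in> parabolic P"
      using less.prems(4) parabolic_step_iff[of P x v] xP v assms by (simp add: w_eq)
    ultimately have "v \<in> parabolic (P \<inter> centralizing s)"
      using less.hyps \<open>len v < len w\<close> v by blast
    moreover have "x \<in> P \<inter> centralizing s"
      using x xP xs_comm \<open>x \<noteq> s\<close> by (auto simp: centralizing_def)
    moreover have "P \<inter> centralizing s \<subseteq> S" using assms by auto
    ultimately show ?thesis
      using parabolic_step_iff[of "P \<inter> centralizing s" x v] v by (simp add: w_eq)
  qed simp
qed

lemma parabolic_gens: "w \<in> carrier G \<Longrightarrow> w \<in> parabolic S"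
  using exists_expression[of w] by (auto simp: parabolic_def)

lemma centralizing_subset: "centralizing s \<subseteq> S"
  by (auto simp: centralizing_def)

lemma parabolic_centralizing_commute:
  assumes "s \<in> S" "P \<subseteq> centralizing s" "w \<in> parabolic P"
  shows "s \<otimes> w = w \<otimes> s"
  using assms(3) subset_trans[OF assms(2) centralizing_subset]
proof (induction rule: parabolic_induct)
  case (step x w)
  have x: "x \<in> S" "s \<otimes> x = x \<otimes> s" using step assms by (auto simp: centralizing_def)
  have w: "w \<in> carrier G" using step parabolic_carrier assms centralizing_subset by blast
  have "s \<otimes> (x \<otimes> w) = x \<otimes> (s \<otimes> w)"
    using x w assms by (simp add: m_assoc[symmetric])
  then show ?case using step x w assms by (simp add: m_assoc)
qed (use assms in simp)


text \<open>If \<open>w\<close> commuted with \<open>s\<close>, then both \<open>s\<close> and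
  \<open>t\<close> would be descents of \<open>s w = w s\<close>, hence commute.\<close>

lemma ldesc_not_commute:
  assumes "s \<in> S" "t \<in> S" "s \<otimes> t \<noteq> t \<otimes> s" "w \<in> carrier G" "ldesc t w"
  shows "s \<otimes> w \<noteq> w \<otimes> s"
proof
  assume eq: "s \<otimes> w = w \<otimes> s"
  have "\<not> ldesc s w"
    using ldescs_commute assms by blast
  then have "ldesc s (w \<otimes> s)"
    using assms by (simp add: ldesc_mult_self flip: eq)
  moreover have "ldesc t (w \<otimes> s)"
    using ldesc_mult_right[of t s w] conjugate_gens_eq[of t s w] assms by metis
  ultimately show False
    using ldescs_commute[of s t "w \<otimes> s"] assms by simp
qed

text \<open>Every new letter lengthens the element: otherwise it and the preceding letter would be
  two non-commuting descents.\<close>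

lemma ldesc_alternating:
  assumes st: "s \<in> S" "t \<in> S" "s \<otimes> t \<noteq> t \<otimes> s" and v: "v \<in> carrier G" "\<not> ldesc s v" "\<not> ldesc t v"
    and d: "set d \<subseteq> {s, t}" "distinct_adj d" "d \<noteq> []"
  shows "ldesc (hd d) (ev d \<otimes> v)"
  using d
proof (induction d)
  case (Cons l d)
  have l: "l \<in> S" "l = s \<or> l = t" using Cons st by auto
  have dS: "set d \<subseteq> S" using Cons.prems st by auto
  have "\<not> ldesc l (ev d \<otimes> v)"
  proof (cases "d = []")
    case True
    then show ?thesis using l v by auto
  next
    case False
    then have "ldesc (hd d) (ev d \<otimes> v)"
      using Cons by (auto simp: distinct_adj_Cons)
    moreover have "hd d \<in> {s, t}" "hd d \<noteq> l"
      using Cons.prems False by (auto simp: distinct_adj_Cons neq_Nil_conv)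
    ultimately show ?thesis
      using ldescs_commute[of s t "ev d \<otimes> v"] l st v dS by auto
  qed
  then show ?case
    using l v dS by (simp add: m_assoc ldesc_mult_self)
qed simp

text \<open>When letters are removed from the left, each letter of \<open>d\<close> becomes a
  descent in turn, and elements of a parabolic subgroup have descents only among its
  generators.\<close>

lemma alternating_parabolic_letters:
  assumes "s \<in> S" "t \<in> S" "s \<otimes> t \<noteq> t \<otimes> s" "v \<in> carrier G" "\<not> ldesc s v" "\<not> ldesc t v"
    and "set d \<subseteq> {s, t}" "distinct_adj d" and "Q \<subseteq> S" "ev d \<otimes> v \<in> parabolic Q"
  shows "set d \<subseteq> Q"
  using assms(7,8,10)
proof (induction d)
  case (Cons l d)
  have l: "l \<in> S" using Cons assms by auto
  have dS: "set d \<subseteq> S" using Cons.prems assms by auto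
  have "l \<in> Q"
    using ldesc_alternating[of s t v "l # d"] not_ldesc_parabolic[of Q l "ev (l # d) \<otimes> v"] Cons.prems assms l by auto
  moreover have "ev d \<otimes> v \<in> parabolic Q"
    using Cons.prems(3) parabolic_step_iff[of Q l "ev d \<otimes> v"] \<open>l \<in> Q\<close> l dS assms by (simp add: m_assoc)
  ultimately show ?case
    using Cons by (auto simp: distinct_adj_Cons)
qed simp

definition dihedral_support :: "'a \<Rightarrow> 'a \<Rightarrow> 'a set" where
  "dihedral_support s t = {s, t} \<union> (centralizing s \<inter> centralizing t)"

lemma dihedral_support_subset: "s \<in> S \<Longrightarrow> t \<in> S \<Longrightarrow> dihedral_support s t \<subseteq> S"
  by (auto simp: dihedral_support_def centralizing_def)

lemma in_parabolic_both_centralizing: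
  assumes "s \<in> S" "t \<in> S" "w \<in> carrier G" "s \<otimes> w = w \<otimes> s" "t \<otimes> w = w \<otimes> t"
    "\<not> ldesc s w" "\<not> ldesc t w"
  shows "w \<in> parabolic (centralizing s \<inter> centralizing t)"
proof -
  have "w \<in> parabolic (S \<inter> centralizing s)"
    using assms parabolic_gens by (intro commuting_in_parabolic) auto
  then have "w \<in> parabolic (S \<inter> centralizing s \<inter> centralizing t)"
    using assms by (intro commuting_in_parabolic[of w t "S \<inter> centralizing s"]) auto
  then show ?thesis
    using parabolic_mono[of "S \<inter> centralizing s \<inter> centralizing t" "centralizing s \<inter> centralizing t"] by auto
qed

end

section \<open>Hecke multiplication of functions on the group\<close>

locale hecke = racg G S m for G :: "('a, 'b) monoid_scheme" (structure) and S m +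
  fixes p :: "'a \<Rightarrow> complex"
begin

text \<open>The formula is its own transpose. It gives the coefficients of \<open>T_s f\<close>,
  and, with \<open>f\<close> read as the functional sending \<open>T_w\<close> to
  \<open>f w\<close>, it gives the value of that functional at \<open>T_s T_w\<close>. Traces are
  treated in the second reading, where iterated left multiplications appear in reversed
  order.\<close>

definition lmul :: "'a \<Rightarrow> ('a \<Rightarrow> complex) \<Rightarrow> 'a \<Rightarrow> complex" where
  "lmul s f = (\<lambda>w. if w \<in> carrier G then f (s \<otimes> w) + (if ldesc s w then p s * f w else 0) else 0)"

definition rmul :: "'a \<Rightarrow> ('a \<Rightarrow> complex) \<Rightarrow> 'a \<Rightarrow> complex" where
  "rmul s f = (\<lambda>w. if w \<in> carrier G then f (w \<otimes> s) + (if rdesc s w then p s * f w else 0) else 0)"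

lemma lmul_apply: "w \<in> carrier G \<Longrightarrow> lmul s f w = f (s \<otimes> w) + (if ldesc s w then p s * f w else 0)"
  by (simp add: lmul_def)

lemma rmul_apply: "w \<in> carrier G \<Longrightarrow> rmul s f w = f (w \<otimes> s) + (if rdesc s w then p s * f w else 0)"
  by (simp add: rmul_def)

lemma lmul_outside [simp]: "w \<notin> carrier G \<Longrightarrow> lmul s f w = 0"
  and rmul_outside [simp]: "w \<notin> carrier G \<Longrightarrow> rmul s f w = 0"
  by (simp_all add: lmul_def rmul_def)

lemma lmul_diff: "lmul s (\<lambda>w. f w - g w) = (\<lambda>w. lmul s f w - lmul s g w)"
  and rmul_diff: "rmul s (\<lambda>w. f w - g w) = (\<lambda>w. rmul s f w - rmul s g w)"
  by (auto simp: lmul_def rmul_def fun_eq_iff algebra_simps)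

lemma lmul_add: "lmul s (\<lambda>w. f w + g w) = (\<lambda>w. lmul s f w + lmul s g w)"
  and rmul_add: "rmul s (\<lambda>w. f w + g w) = (\<lambda>w. rmul s f w + rmul s g w)"
  by (auto simp: lmul_def rmul_def fun_eq_iff algebra_simps)

lemma lmul_scale: "lmul s (\<lambda>w. c * f w) = (\<lambda>w. c * lmul s f w)"
  and rmul_scale: "rmul s (\<lambda>w. c * f w) = (\<lambda>w. c * rmul s f w)"
  by (auto simp: lmul_def rmul_def fun_eq_iff algebra_simps)

text \<open>Left and right descents do not interact unless \<open>s w = w t\<close>. In that case
  \<open>s = t\<close>, both multiplications move \<open>w\<close> to the same element, and both
  descents switch together.\<close>

lemma lmul_rmul_commute:
  assumes "s \<in> S" "t \<in> S"
  shows "lmul s (rmul t f) = rmul t (lmul s f)"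
proof
  fix w
  show "lmul s (rmul t f) w = rmul t (lmul s f) w"
  proof (cases "w \<in> carrier G")
    case True
    show ?thesis
    proof (cases "s \<otimes> w = w \<otimes> t")
      case eq: True
      then have st: "s = t" using conjugate_gens_eq assms True by blast
      have "rdesc t (s \<otimes> w) = (\<not> rdesc t w)" "ldesc s (w \<otimes> t) = (\<not> ldesc s w)"
        using rdesc_mult_self[of t w] ldesc_mult_self[of s w] assms True eq by simp_all
      moreover have "ldesc s w = rdesc t w"
        using eq by (simp add: ldesc_def rdesc_def)
      moreover have "t \<otimes> (w \<otimes> t) = w"
        using True assms eq st by (simp flip: eq)
      ultimately show ?thesis
        using True assms eq by (auto simp: lmul_apply rmul_apply m_assoc st)
    next
      case False
      then have "rdesc t (s \<otimes> w) = rdesc t w" "ldesc s (w \<otimes> t) = ldesc s w"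
        using rdesc_mult_left[of s t w] ldesc_mult_right[of s t w] assms True by simp_all
      then show ?thesis
        using True assms by (auto simp: lmul_apply rmul_apply m_assoc algebra_simps)
    qed
  qed simp
qed

lemma lmul_commute:
  assumes "s \<in> S" "t \<in> S" "s \<otimes> t = t \<otimes> s"
  shows "lmul s (lmul t f) = lmul t (lmul s f)"
proof (cases "s = t")
  case False
  show ?thesis
  proof
    fix w
    show "lmul s (lmul t f) w = lmul t (lmul s f) w"
    proof (cases "w \<in> carrier G")
      case True
      have "ldesc s (t \<otimes> w) = ldesc s w" "ldesc t (s \<otimes> w) = ldesc t w"
        using ldesc_mult_commuting assms False True by metis+
      moreover have "t \<otimes> (s \<otimes> w) = s \<otimes> (t \<otimes> w)"
        using True assms by (simp flip: m_assoc)
      ultimately show ?thesis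
        using True assms by (auto simp: lmul_apply algebra_simps)
    qed simp
  qed
qed simp

text \<open>The quadratic relation. \<open>f\<close> has to vanish off the carrier because
  \<open>lmul\<close> cuts it off there.\<close>

lemma lmul_square:
  assumes "s \<in> S" and "\<And>w. w \<notin> carrier G \<Longrightarrow> f w = 0"
  shows "lmul s (lmul s f) = (\<lambda>w. f w + p s * lmul s f w)"
proof
  fix w
  show "lmul s (lmul s f) w = f w + p s * lmul s f w"
    using assms by (cases "w \<in> carrier G") (auto simp: lmul_apply ldesc_mult_self algebra_simps)
qed

lemma lmul_delta_one:
  assumes "s \<in> S"
  shows "lmul s (delta \<one>) = delta s"
proof
  fix w
  show "lmul s (delta \<one>) w = delta s w"
    using assms by (cases "w \<in> carrier G") (auto simp: lmul_apply delta_def gen_mult_eq_one_iff)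
qed

lemma rmul_delta_one:
  assumes "s \<in> S"
  shows "rmul s (delta \<one>) = delta s"
proof
  fix w
  have "w \<otimes> s = \<one> \<longleftrightarrow> w = s" if "w \<in> carrier G"
    using that assms by (metis gen_closed gen_square gen_square_right l_one)
  then show "rmul s (delta \<one>) w = delta s w"
    using assms by (cases "w \<in> carrier G") (auto simp: rmul_apply delta_def)
qed

text \<open>\<open>t\<close> is no descent of \<open>s\<close>, so no extra term appears: these are
  the two values that survive for every trace.\<close>

lemma lmul_lmul_delta_one:
  assumes "s \<in> S" "t \<in> S" "s \<otimes> t \<noteq> t \<otimes> s"
  shows "lmul t (lmul s (delta \<one>)) = delta (t \<otimes> s)"
proof
  fix w
  show "lmul t (lmul s (delta \<one>)) w = delta (t \<otimes> s) w"
  proof (cases "w \<in> carrier G")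
    case True
    have "\<not> ldesc t s"
      using ldescs_commute[of s t s] ldesc_mult_self[of s \<one>] assms by auto
    moreover have "t \<otimes> w = s \<longleftrightarrow> w = t \<otimes> s"
      using True assms by auto
    ultimately show ?thesis
      using True assms unfolding lmul_delta_one[OF assms(1)] by (auto simp: lmul_apply delta_def)
  qed (use assms in \<open>auto simp: delta_def\<close>)
qed

end

subsection \<open>Traces vanishing at infinity\<close>

text \<open>Here \<open>\<kappa>\<close> stands for the values of a trace on the commutator of \<open>s\<close> and \<open>t\<close>.\<close>

locale skew_function = hecke G S m p for G :: "('a, 'b) monoid_scheme" (structure) and S m p +
  fixes s t :: 'a and \<kappa> :: "'a \<Rightarrow> complex"
  assumes s: "s \<in> S" and t: "t \<in> S" and st: "s \<otimes> t \<noteq> t \<otimes> s"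
    and skew: "l \<in> {s, t} \<Longrightarrow> w \<in> carrier G \<Longrightarrow> lmul l \<kappa> w + rmul l \<kappa> w = p l * \<kappa> w"
    and vanish: "l \<in> {s, t} \<Longrightarrow> w \<in> carrier G \<Longrightarrow> l \<otimes> w = w \<otimes> l \<Longrightarrow> \<kappa> w = 0"
    and decay: "0 < e \<Longrightarrow> finite {w \<in> carrier G. norm (\<kappa> w) \<ge> e}"
begin

lemma gens: "l \<in> {s, t} \<Longrightarrow> l \<in> S"
  using s t by auto

lemma other: "l \<in> {s, t} \<Longrightarrow> l' \<in> {s, t} \<Longrightarrow> l \<noteq> l' \<Longrightarrow> l \<otimes> l' \<noteq> l' \<otimes> l"
  using st by auto

text \<open>Evaluate the skew relation at \<open>l w\<close>, which has \<open>l\<close> as a left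
  but not as a right descent: the p-term of the left multiplication cancels the right-hand
  side.\<close>

lemma conj_value:
  assumes l: "l \<in> {s, t}" and w: "w \<in> carrier G"
    and "\<not> ldesc l w" "\<not> rdesc l w" "l \<otimes> w \<noteq> w \<otimes> l"
  shows "\<kappa> (l \<otimes> w \<otimes> l) = - \<kappa> w"
proof -
  have lS: "l \<in> S" using l gens by auto
  have "\<not> rdesc l (l \<otimes> w)" "ldesc l (l \<otimes> w)"
    using rdesc_mult_left[of l l w] ldesc_mult_self[of l w] assms lS by simp_all
  then show ?thesis
    using skew[of l "l \<otimes> w"] l lS w by (simp add: lmul_apply rmul_apply) (simp add: eq_neg_iff_add_eq_0 add.commute)
qed

text \<open>Conjugation by \<open>r\<close> makes \<open>r\<close> a descent on both sides. Then
  \<open>r'\<close> is a descent on neither side and does not commute with the new element, so the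
  letters can alternate forever; the length grows by two and \<kappa> only changes its sign.\<close>

lemma chain:
  assumes "{r, r'} = {s, t}" "w \<in> carrier G" "\<not> ldesc r w" "\<not> rdesc r w" "r \<otimes> w \<noteq> w \<otimes> r"
  shows "\<exists>v\<in>carrier G. len v \<ge> len w + n \<and> norm (\<kappa> v) = norm (\<kappa> w)"
  using assms
proof (induction n arbitrary: r r' w)
  case 0
  then show ?case by auto
next
  case (Suc n)
  have r: "r \<in> {s, t}" "r' \<in> {s, t}" using Suc.prems by auto
  have ne: "r \<noteq> r'" using Suc.prems st by auto
  have rS: "r \<in> S" "r' \<in> S" using r gens by auto
  define v where "v = r \<otimes> w \<otimes> r"
  have v: "v \<in> carrier G" using Suc.prems rS by (simp add: v_def)
  have "\<not> rdesc r (r \<otimes> w)"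
    using rdesc_mult_left[of r r w] Suc.prems rS by simp
  then have "rdesc r v" "len v = Suc (Suc (len w))"
    using Suc.prems rS len_not_rdesc[of r "r \<otimes> w"] len_not_ldesc[of r w]
    by (simp_all add: v_def rdesc_mult_self)
  moreover have "\<not> ldesc r (w \<otimes> r)"
    using ldesc_mult_right[of r r w] Suc.prems rS by simp
  then have "ldesc r v"
    using Suc.prems rS by (simp add: v_def m_assoc ldesc_mult_self)
  ultimately have "\<not> rdesc r' v" "\<not> ldesc r' v" "r' \<otimes> v \<noteq> v \<otimes> r'"
    using rdescs_commute[of r r' v] ldescs_commute[of r r' v] other[OF r ne] v rS
      ldesc_not_commute[of r' r v] by auto
  moreover have "{r', r} = {s, t}" using Suc.prems by auto
  ultimately obtain v' where "v' \<in> carrier G" "len v' \<ge> len v + n" "norm (\<kappa> v') = norm (\<kappa> v)"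
    using Suc.IH[of r' r v] v by auto
  moreover have "norm (\<kappa> v) = norm (\<kappa> w)"
    using conj_value[of r w] Suc.prems r by (simp add: v_def)
  ultimately show ?case
    using \<open>len v = Suc (Suc (len w))\<close> by (intro bexI[of _ v']) auto
qed

text \<open>A non-zero value would recur in modulus at elements of unbounded length, against the
  finiteness of level sets.\<close>

lemma chain_zero:
  assumes "{r, r'} = {s, t}" "w \<in> carrier G" "\<not> ldesc r w" "\<not> rdesc r w" "r \<otimes> w \<noteq> w \<otimes> r"
  shows "\<kappa> w = 0"
proof (rule ccontr)
  assume "\<kappa> w \<noteq> 0"
  define F where "F = {v \<in> carrier G. norm (\<kappa> v) \<ge> norm (\<kappa> w)}"
  have "finite F"
    using decay[of "norm (\<kappa> w)"] \<open>\<kappa> w \<noteq> 0\<close> by (simp add: F_def)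
  obtain v where "v \<in> carrier G" "len v \<ge> len w + Suc (Max (len ` F))" "norm (\<kappa> v) = norm (\<kappa> w)"
    using chain[OF assms] by blast
  moreover from this have "len v \<le> Max (len ` F)"
    using \<open>finite F\<close> by (intro Max_ge) (auto simp: F_def)
  ultimately show False by simp
qed

text \<open>Vanishing of \<kappa> on the whole coset of \<open>w\<close> under left multiplication
  by the dihedral group. Unlike a single zero, this is stable under right multiplication by
  \<open>s\<close> and \<open>t\<close>.\<close>

definition coset_null :: "'a set" where
  "coset_null = {w \<in> carrier G. \<forall>d\<in>parabolic {s, t}. \<kappa> (d \<otimes> w) = 0}"

lemma st_subset: "{s, t} \<subseteq> S"
  using s t by simp

text \<open>The skew relation at \<open>d w\<close> expresses the value at \<open>d w l\<close>
  through those at \<open>l d w\<close> and \<open>d w\<close>, both in the coset.\<close>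

lemma coset_null_right:
  assumes "w \<in> coset_null" "l \<in> {s, t}"
  shows "w \<otimes> l \<in> coset_null"
proof -
  have w: "w \<in> carrier G" using assms by (simp add: coset_null_def)
  have l: "l \<in> S" using assms gens by auto
  have "\<kappa> (d \<otimes> (w \<otimes> l)) = 0" if d: "d \<in> parabolic {s, t}" for d
  proof -
    have dc: "d \<in> carrier G" using d st_subset parabolic_carrier by blast
    have "l \<otimes> d \<in> parabolic {s, t}"
      using d dc assms st_subset by (simp add: parabolic_step_iff)
    then have "\<kappa> (l \<otimes> (d \<otimes> w)) = 0" "\<kappa> (d \<otimes> w) = 0"
      using assms(1) d dc w l by (auto simp: coset_null_def simp flip: m_assoc)
    then show ?thesis
      using skew[of l "d \<otimes> w"] assms dc w l by (auto simp: lmul_apply rmul_apply m_assoc split: if_splits)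
  qed
  then show ?thesis using w l by (auto simp: coset_null_def)
qed

lemma coset_null_right_parabolic:
  assumes "w \<in> coset_null" "d \<in> parabolic {s, t}"
  shows "w \<otimes> d \<in> coset_null"
  using assms(2) st_subset assms(1)
proof (induction arbitrary: w rule: parabolic_induct)
  case one
  then show ?case by (auto simp: coset_null_def)
next
  case (step l d)
  then have "w \<otimes> l \<otimes> d \<in> coset_null"
    using coset_null_right by blast
  moreover have "w \<in> carrier G" "l \<in> carrier G" "d \<in> carrier G"
    using step st_subset parabolic_carrier[of "{s, t}" d] by (auto simp: coset_null_def)
  ultimately show ?case by (simp add: m_assoc)
qed

text \<open>A left multiplication creates a right descent \<open>r\<close> only if
  \<open>l w = w r\<close>, hence \<open>l = r\<close> commutes with \<open>w\<close>. After the
  first step this contradicts the left descent \<open>hd d\<close> of \<open>w\<close>, at the first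
  step the assumption on \<open>last d\<close>.\<close>

lemma rdesc_alternating_minimal:
  assumes u: "u \<in> carrier G" and min: "\<And>l. l \<in> {s, t} \<Longrightarrow> \<not> ldesc l u \<and> \<not> rdesc l u"
    and d: "set d \<subseteq> {s, t}" "distinct_adj d" "d \<noteq> [] \<Longrightarrow> last d \<otimes> u \<noteq> u \<otimes> last d"
    and r: "r \<in> {s, t}"
  shows "\<not> rdesc r (ev d \<otimes> u)"
  using d
proof (induction d)
  case Nil
  then show ?case using u min r by simp
next
  case (Cons l d)
  have l: "l \<in> S" "l \<in> {s, t}" and rS: "r \<in> S" using Cons.prems gens r by auto
  have dS: "set d \<subseteq> S" using Cons.prems st_subset by auto
  define w where "w = ev d \<otimes> u"
  have w: "w \<in> carrier G" using u dS by (simp add: w_def)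
  have "\<not> rdesc r w"
    unfolding w_def using Cons.prems by (intro Cons.IH) (auto simp: distinct_adj_Cons)
  moreover have "l \<otimes> w \<noteq> w \<otimes> r"
  proof
    assume eq: "l \<otimes> w = w \<otimes> r"
    then have lr: "l = r" using conjugate_gens_eq[of l r w] l rS w by simp
    show False
    proof (cases "d = []")
      case True
      then show False using Cons.prems eq u by (simp add: lr w_def)
    next
      case False
      then have hd: "hd d \<in> {s, t}" "hd d \<noteq> l"
        using Cons.prems by (auto simp: distinct_adj_Cons neq_Nil_conv)
      then have "ldesc (hd d) w"
        unfolding w_def using Cons.prems False s t st u min
        by (intro ldesc_alternating[of s t]) (auto simp: distinct_adj_Cons)
      then show False
        using ldesc_not_commute[of l "hd d" w] other[of l "hd d"] gens[of "hd d"] hd l w eq lr by auto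
    qed
  qed
  ultimately have "\<not> rdesc r (l \<otimes> w)"
    using rdesc_mult_left[of l r w] l rS w by simp
  then show ?case
    using l dS u by (simp add: w_def m_assoc)
qed

text \<open>If the last letter of \<open>d\<close> does not commute with \<open>u\<close>, a chain
  to infinity starts at \<open>ev d \<otimes> u\<close>. If it does commute, it can be moved to the
  right of \<open>u\<close>, and the skew relation leads back to the first case, or to
  \<open>vanish\<close> when it is the only letter.\<close>

lemma minimal_in_coset_null:
  assumes u: "u \<in> carrier G" and min: "\<And>l. l \<in> {s, t} \<Longrightarrow> \<not> ldesc l u \<and> \<not> rdesc l u"
    and nc: "\<exists>l\<in>{s, t}. l \<otimes> u \<noteq> u \<otimes> l"
  shows "u \<in> coset_null"
proof -
  have free: "\<kappa> (ev d \<otimes> u) = 0"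
    if d: "set d \<subseteq> {s, t}" "distinct_adj d" "d \<noteq> [] \<Longrightarrow> last d \<otimes> u \<noteq> u \<otimes> last d" for d
  proof (cases "d = []")
    case True
    obtain l where l: "l \<in> {s, t}" "l \<otimes> u \<noteq> u \<otimes> l" using nc by auto
    then obtain l' where "{l, l'} = {s, t}" by auto
    from chain_zero[OF this u] min l have "\<kappa> u = 0" by auto
    then show ?thesis using True u by simp
  next
    case False
    define h where "h = hd d"
    have h: "h \<in> {s, t}" using d False by (cases d) (auto simp: h_def)
    \<comment> \<open>The chain starts with the letter other than the first one of \<open>d\<close>:
      since \<open>h\<close> is a left descent, \<open>r\<close> is none and does not commute with
      the element.\<close>
    then obtain r where r: "{r, h} = {s, t}" by auto
    then have rh: "r \<in> {s, t}" "r \<noteq> h" using st by auto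
    have dS: "set d \<subseteq> S" using d st_subset by auto
    have dh: "ldesc h (ev d \<otimes> u)"
      unfolding h_def using s t st u min d False by (intro ldesc_alternating[of s t]) auto
    show ?thesis
    proof (rule chain_zero[OF r])
      show "\<not> ldesc r (ev d \<otimes> u)"
        using ldescs_commute[of r h "ev d \<otimes> u"] dh other[OF rh(1) h rh(2)] gens h rh u dS by auto
      show "\<not> rdesc r (ev d \<otimes> u)"
        using u min d rh by (intro rdesc_alternating_minimal) auto
      show "r \<otimes> (ev d \<otimes> u) \<noteq> ev d \<otimes> u \<otimes> r"
        using ldesc_not_commute[of r h "ev d \<otimes> u"] dh other[OF rh(1) h rh(2)] gens[of r] gens[of h] h rh u dS by auto
    qed (use u dS in auto)
  qed
  have all: "\<kappa> (ev d \<otimes> u) = 0" if d: "set d \<subseteq> {s, t}" "distinct_adj d" for d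
  proof (cases "d \<noteq> [] \<and> last d \<otimes> u = u \<otimes> last d")
    case False
    then show ?thesis using free d by blast
  next
    case True
    define l where "l = last d"
    obtain e where de: "d = e @ [l]" using True by (metis append_butlast_last_id l_def)
    have l: "l \<in> {s, t}" "l \<otimes> u = u \<otimes> l" using True d unfolding l_def[symmetric] by (simp_all add: de)
    have lS: "l \<in> S" using l gens by auto
    have eS: "set e \<subseteq> S" using d de st_subset by auto
    show ?thesis
    proof (cases "e = []")
      case True
      have "l \<otimes> (u \<otimes> l) = u"
        using lS u by (simp flip: l(2))
      then have "\<kappa> (l \<otimes> u) = 0"
        using vanish[OF l(1), of "l \<otimes> u"] lS u by (simp add: l(2))
      then show ?thesis using True de lS by simp
    next
      case False
      have e: "set e \<subseteq> {s, t}" "distinct_adj e" "last e \<noteq> l"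
        using d de False by (auto simp: distinct_adj_append_iff)
      have last_nc: "x \<otimes> u \<noteq> u \<otimes> x" if "x \<in> {s, t}" "x \<noteq> l" for x
        using nc l that by auto
      have "last e \<in> {s, t}"
        using e False last_in_set by blast
      then have last_e: "last e \<otimes> u \<noteq> u \<otimes> last e"
        using e last_nc by blast
      have e_free: "\<kappa> (ev e \<otimes> u) = 0"
        using e last_e False by (intro free) auto
      \<comment> \<open>Prefixing \<open>l\<close> either cancels the first letter of
        \<open>e\<close> or extends the alternating word. In both cases the last letter is still
        \<open>last e\<close>, which differs from \<open>l\<close>, so \<open>free\<close>
        applies.\<close>
      have le_free: "\<kappa> (l \<otimes> (ev e \<otimes> u)) = 0"
      proof (cases "hd e = l")
        case True
        then obtain e' where e': "e = l # e'" using False by (cases e) auto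
        then have "e' \<noteq> []" "last e' = last e" using e by auto
        then have "\<kappa> (ev e' \<otimes> u) = 0"
          using e e' last_e False by (intro free) (auto simp: distinct_adj_Cons)
        then show ?thesis using e' lS u eS by (simp add: m_assoc)
      next
        case hd: False
        have "\<kappa> (ev (l # e) \<otimes> u) = 0"
          using e last_e False hd l by (intro free) (auto simp: distinct_adj_Cons)
        then show ?thesis using lS u eS by (simp add: m_assoc)
      qed
      have "ev d \<otimes> u = ev e \<otimes> u \<otimes> l"
        using de eS lS u l by (simp add: ev_append m_assoc)
      then show ?thesis
        using skew[of l "ev e \<otimes> u"] l lS u eS e_free le_free
        by (auto simp: lmul_apply rmul_apply split: if_splits)
    qed
  qed
  have "\<kappa> (d \<otimes> u) = 0" if d: "d \<in> parabolic {s, t}" for d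
  proof -
    obtain xs where "set xs \<subseteq> {s, t}" "d = ev xs"
      using d unfolding parabolic_def by blast
    then obtain ys where "set ys \<subseteq> {s, t}" "distinct_adj ys" "ev ys = d"
      using alternating_expression[of xs "{s, t}"] st_subset by auto
    then show ?thesis using all by blast
  qed
  then show ?thesis using u by (simp add: coset_null_def)
qed

text \<open>Take a shortest element \<open>u\<close> of the double coset of \<open>w\<close>. If it
  commutes with \<open>s\<close> and \<open>t\<close>, it lies in the parabolic subgroup of their
  common link; otherwise \<kappa> vanishes on the entire double coset.\<close>

lemma support:
  assumes w: "w \<in> carrier G" and nz: "\<kappa> w \<noteq> 0"
  shows "w \<in> parabolic (dihedral_support s t)"
proof (rule ccontr)
  assume not: "w \<notin> parabolic (dihedral_support s t)"
  let ?D = "parabolic {s, t}"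
  have Dc: "d \<in> carrier G" if "d \<in> ?D" for d
    using that st_subset parabolic_carrier by blast
  have sub: "dihedral_support s t \<subseteq> S" using s t by (rule dihedral_support_subset)
  have Dsub: "?D \<subseteq> parabolic (dihedral_support s t)"
    by (rule parabolic_mono) (auto simp: dihedral_support_def)
  obtain de where de: "fst de \<in> ?D" "snd de \<in> ?D"
    and de_min: "\<And>xy. fst xy \<in> ?D \<and> snd xy \<in> ?D \<Longrightarrow> len (fst de \<otimes> w \<otimes> snd de) \<le> len (fst xy \<otimes> w \<otimes> snd xy)"
    using ex_has_least_nat[of "\<lambda>xy. fst xy \<in> ?D \<and> snd xy \<in> ?D" "(\<one>, \<one>)" "\<lambda>xy. len (fst xy \<otimes> w \<otimes> snd xy)"]
    by auto
  define d e where "d = fst de" and "e = snd de"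
  define u where "u = d \<otimes> w \<otimes> e"
  have d: "d \<in> ?D" "d \<in> carrier G" and e: "e \<in> ?D" "e \<in> carrier G"
    using de Dc by (auto simp: d_def e_def)
  have u: "u \<in> carrier G" using d e w by (simp add: u_def)
  have min: "\<not> ldesc l u \<and> \<not> rdesc l u" if l: "l \<in> {s, t}" for l
  proof -
    have lS: "l \<in> S" using l gens by auto
    have "l \<otimes> d \<in> ?D" "e \<otimes> l \<in> ?D"
      using l d e st_subset by (simp_all add: parabolic_step_iff parabolic_step_right_iff)
    then have "len u \<le> len (l \<otimes> d \<otimes> w \<otimes> e)" "len u \<le> len (d \<otimes> w \<otimes> (e \<otimes> l))"
      using de_min[of "(l \<otimes> d, e)"] de_min[of "(d, e \<otimes> l)"] d e by (simp_all add: u_def d_def e_def)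
    then show ?thesis
      using d e w lS by (simp add: u_def ldesc_def rdesc_def m_assoc)
  qed
  have w_eq: "w = inv d \<otimes> (u \<otimes> inv e)"
    using d e w by (simp add: u_def m_assoc) (simp flip: m_assoc)
  have inv: "inv d \<in> ?D" "inv e \<in> ?D"
    using d e st_subset by (simp_all add: inv_in_parabolic)
  have "u \<notin> parabolic (dihedral_support s t)"
  proof
    assume "u \<in> parabolic (dihedral_support s t)"
    then have "w \<in> parabolic (dihedral_support s t)"
      unfolding w_eq using inv Dsub by (intro parabolic_mult[OF sub]) auto
    with not show False by simp
  qed
  moreover have "u \<in> parabolic (dihedral_support s t)" if "s \<otimes> u = u \<otimes> s" "t \<otimes> u = u \<otimes> t"
  proof -
    have "u \<in> parabolic (centralizing s \<inter> centralizing t)"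
      using that s t u min by (intro in_parabolic_both_centralizing) auto
    then show ?thesis
      using parabolic_mono[of "centralizing s \<inter> centralizing t" "dihedral_support s t"]
      by (auto simp: dihedral_support_def)
  qed
  ultimately have "\<exists>l\<in>{s, t}. l \<otimes> u \<noteq> u \<otimes> l" by auto
  with u min have "u \<in> coset_null" by (rule minimal_in_coset_null)
  then have "u \<otimes> inv e \<in> coset_null"
    using inv by (intro coset_null_right_parabolic)
  then have "\<kappa> w = 0"
    using inv by (simp add: coset_null_def w_eq)
  with nz show False by simp
qed

end

text \<open>Irreducibility as it is used: connectedness of the graph that joins non-commuting
  generators. A property passed along its edges holds for all generators.\<close>

locale irreducible_racg = racg +
  assumes connected: "A \<subseteq> S \<Longrightarrow> A \<noteq> {} \<Longrightarrow>
      (\<And>a x. a \<in> A \<Longrightarrow> x \<in> S \<Longrightarrow> a \<otimes> x \<noteq> x \<otimes> a \<Longrightarrow> x \<in> A) \<Longrightarrow> A = S"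
    and card_S: "card S \<ge> 3"

section \<open>Values of a trace on commutators of generators\<close>

locale hecke_trace = hecke G S m p + irreducible_racg G S m
  for G :: "('a, 'b) monoid_scheme" (structure) and S m p +
  fixes z :: "'a \<Rightarrow> complex"
  assumes trace: "s \<in> S \<Longrightarrow> lmul s z = rmul s z"
    and outside: "w \<notin> carrier G \<Longrightarrow> z w = 0"
    and z_decay: "0 < e \<Longrightarrow> finite {w \<in> carrier G. norm (z w) \<ge> e}"
begin

text \<open>The value of the functional \<open>z\<close> at \<open>[T_s, T_t] T_w\<close>; the order
  is reversed because left multiplications act on functionals by transposition.\<close>

definition commutator_value :: "'a \<Rightarrow> 'a \<Rightarrow> 'a \<Rightarrow> complex" where
  "commutator_value s t = (\<lambda>w. lmul t (lmul s z) w - lmul s (lmul t z) w)"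

lemma commutator_value_swap: "commutator_value t s w = - commutator_value s t w"
  by (simp add: commutator_value_def)

lemma commutator_value_commuting:
  assumes "s \<in> S" "t \<in> S" "s \<otimes> t = t \<otimes> s"
  shows "commutator_value s t w = 0"
  using lmul_commute[OF assms] by (simp add: commutator_value_def)

lemma commutator_value_outside: "w \<notin> carrier G \<Longrightarrow> commutator_value s t w = 0"
  by (simp add: commutator_value_def)

lemma lmul_commutator_value:
  assumes "x \<in> S"
  shows "lmul x (commutator_value s t) = (\<lambda>w. lmul x (lmul t (lmul s z)) w - lmul x (lmul s (lmul t z)) w)"
  unfolding commutator_value_def by (simp add: lmul_diff)

text \<open>The right multiplication passes through the left ones to \<open>z\<close>, where the
  trace property turns it into a left one.\<close>

lemma rmul_commutator_value:
  assumes "s \<in> S" "t \<in> S" "x \<in> S"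
  shows "rmul x (commutator_value s t) = (\<lambda>w. lmul t (lmul s (lmul x z)) w - lmul s (lmul t (lmul x z)) w)"
  using assms unfolding commutator_value_def
  by (simp add: rmul_diff flip: lmul_rmul_commute trace)

text \<open>For \<open>l = s\<close> this is
  \<open>T_s [T_s, T_t] + [T_s, T_t] T_s = [T_s^2, T_t]\<close> with
  \<open>T_s^2 = 1 + p_s T_s\<close>, for \<open>l = t\<close> the same with
  \<open>[T_s, T_t^2]\<close>.\<close>

lemma commutator_value_skew:
  assumes "s \<in> S" "t \<in> S" "l = s \<or> l = t"
  shows "lmul l (commutator_value s t) w + rmul l (commutator_value s t) w = p l * commutator_value s t w"
proof -
  have sq: "lmul l (lmul l f) = (\<lambda>w. f w + p l * lmul l f w)" if "\<And>w. w \<notin> carrier G \<Longrightarrow> f w = 0" for f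
    using assms that by (intro lmul_square) auto
  have "lmul a (lmul b (lmul b z)) = (\<lambda>w. lmul a z w + p b * lmul a (lmul b z) w)" if "b = l" for a b
    using that outside by (simp add: sq lmul_add lmul_scale)
  moreover have "lmul b (lmul b (lmul a z)) = (\<lambda>w. lmul a z w + p b * lmul b (lmul a z) w)" if "b = l" for a b
    using that by (simp add: sq)
  moreover have val: "commutator_value s t w = lmul t (lmul s z) w - lmul s (lmul t z) w"
    by (simp add: commutator_value_def)
  ultimately show ?thesis
    unfolding val using assms(3) assms(1,2)
    by (elim disjE) (simp_all add: lmul_commutator_value rmul_commutator_value algebra_simps)
qed

text \<open>The trace applied to the Jacobi identity for \<open>T_s\<close>, \<open>T_t\<close>,
  \<open>T_x\<close>, multiplied by \<open>T_w\<close>: a difference of left and right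
  multiplication is a commutator with the third generator.\<close>

lemma jacobi:
  assumes "s \<in> S" "t \<in> S" "x \<in> S"
  shows "lmul x (commutator_value s t) w - rmul x (commutator_value s t) w
    + (lmul s (commutator_value t x) w - rmul s (commutator_value t x) w)
    + (lmul t (commutator_value x s) w - rmul t (commutator_value x s) w) = 0"
  using assms by (simp add: lmul_commutator_value rmul_commutator_value)

text \<open>Left and right multiplication by \<open>l\<close> agree at \<open>w\<close>, so the
  trace property lets \<open>T_l\<close> travel around the other generator.\<close>

lemma commutator_value_vanish:
  assumes "s \<in> S" "t \<in> S" "l = s \<or> l = t" "w \<in> carrier G" "l \<otimes> w = w \<otimes> l"
  shows "commutator_value s t w = 0"
proof -
  have same: "lmul l f w = rmul l f w" for f
    using assms(4,5) by (simp add: lmul_apply rmul_apply ldesc_def rdesc_def)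
  have "lmul a (lmul l z) w = lmul l (lmul a z) w" if a: "a \<in> S" for a
  proof -
    have "lmul a (lmul l z) = rmul l (lmul a z)"
      using assms a by (auto simp: trace lmul_rmul_commute)
    then show ?thesis by (simp add: same)
  qed
  then show ?thesis
    using assms(1-3) by (auto simp: commutator_value_def)
qed

lemma decay_translate:
  assumes "\<And>e. 0 < e \<Longrightarrow> finite {w \<in> carrier G. norm (f w) \<ge> e}" "s \<in> S" "0 < e"
  shows "finite {w \<in> carrier G. norm (lmul s f w) \<ge> e}"
proof -
  define c where "c = 1 + norm (p s)"
  have c: "c > 0" by (simp add: c_def add_pos_nonneg)
  define e' where "e' = e / (2 * c)"
  have e': "e' > 0" using assms(3) c by (simp add: e'_def)
  define F where "F = {w \<in> carrier G. norm (f w) \<ge> e'}"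
  have "finite F" unfolding F_def using assms(1)[OF e'] .
  have "{w \<in> carrier G. norm (lmul s f w) \<ge> e} \<subseteq> F \<union> (\<lambda>w. s \<otimes> w) ` F"
  proof
    fix w
    assume w: "w \<in> {w \<in> carrier G. norm (lmul s f w) \<ge> e}"
    show "w \<in> F \<union> (\<lambda>w. s \<otimes> w) ` F"
    proof (rule ccontr)
      assume not: "w \<notin> F \<union> (\<lambda>w. s \<otimes> w) ` F"
      have sw: "s \<otimes> w \<in> carrier G" "s \<otimes> (s \<otimes> w) = w" using w assms by auto
      have "s \<otimes> w \<notin> F" using not sw by (metis UnCI imageI)
      with not w sw have small: "norm (f w) < e'" "norm (f (s \<otimes> w)) < e'"
        by (auto simp: F_def)
      have "norm (lmul s f w) \<le> norm (f (s \<otimes> w)) + norm (p s) * norm (f w)"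
        using w norm_triangle_ineq[of "f (s \<otimes> w)" "p s * f w"]
        by (auto simp: lmul_apply norm_mult)
      also have "\<dots> \<le> e' + norm (p s) * e'"
        using small by (intro add_mono mult_left_mono) auto
      also have "\<dots> = e / 2"
      proof -
        have "e' + norm (p s) * e' = c * e'" by (simp add: c_def algebra_simps)
        then show ?thesis using c by (simp add: e'_def)
      qed
      also have "\<dots> < e" using assms by simp
      finally show False using w by simp
    qed
  qed
  then show ?thesis
    by (rule finite_subset) (use \<open>finite F\<close> in auto)
qed

lemma commutator_value_decay:
  assumes "s \<in> S" "t \<in> S" "0 < e"
  shows "finite {w \<in> carrier G. norm (commutator_value s t w) \<ge> e}"
proof -
  have fin: "finite {w \<in> carrier G. norm (lmul t' (lmul s' z) w) \<ge> e / 2}" if "s' \<in> S" "t' \<in> S" for s' t'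
    using that assms(3) z_decay by (intro decay_translate) auto
  have "{w \<in> carrier G. norm (commutator_value s t w) \<ge> e} \<subseteq>
      {w \<in> carrier G. norm (lmul t (lmul s z) w) \<ge> e / 2} \<union> {w \<in> carrier G. norm (lmul s (lmul t z) w) \<ge> e / 2}"
  proof
    fix w
    assume w: "w \<in> {w \<in> carrier G. norm (commutator_value s t w) \<ge> e}"
    then show "w \<in> {w \<in> carrier G. norm (lmul t (lmul s z) w) \<ge> e / 2} \<union> {w \<in> carrier G. norm (lmul s (lmul t z) w) \<ge> e / 2}"
      using norm_triangle_ineq4[of "lmul t (lmul s z) w" "lmul s (lmul t z) w"]
      by (auto simp: commutator_value_def)
  qed
  then show ?thesis
    using fin assms by (meson finite_UnI finite_subset)
qed

lemma commutator_value_support: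
  assumes "s \<in> S" "t \<in> S" "commutator_value s t w \<noteq> 0"
  shows "w \<in> parabolic (dihedral_support s t)" "s \<otimes> t \<noteq> t \<otimes> s"
proof -
  show st: "s \<otimes> t \<noteq> t \<otimes> s" using commutator_value_commuting assms by auto
  interpret skew_function G S m p s t "commutator_value s t"
    by unfold_locales
      (use assms st commutator_value_skew commutator_value_vanish commutator_value_decay in auto)
  show "w \<in> parabolic (dihedral_support s t)"
    using support[of w] assms commutator_value_outside[of w s t] by blast
qed

text \<open>The support statement in the form that eliminates terms of the Jacobi identity: a
  descent outside the support forces the value 0, and with it the p-term.\<close>

lemma commutator_value_no_descent:
  assumes "s \<in> S" "t \<in> S" "commutator_value s t w \<noteq> 0" "x \<in> S" "x \<notin> dihedral_support s t"
  shows "\<not> ldesc x w" "\<not> rdesc x w"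
  using assms commutator_value_support(1)[OF assms(1-3)] dihedral_support_subset[OF assms(1,2)]
    not_ldesc_parabolic not_rdesc_parabolic by blast+

text \<open>Evaluate \<open>jacobi\<close> at \<open>u x\<close> with
  \<open>u = ev d \<otimes> v\<close>. Of the pair (s, t) only the value at \<open>u x x = u\<close>
  survives, since \<open>u x\<close> and \<open>x u x\<close> have the right descent
  \<open>x\<close>. The pair (t, x) contributes nothing because \<open>s\<close> is outside its
  support, and of the pair (x, s) only the left translate by \<open>t\<close> remains. The words
  \<open>d1\<close> and \<open>d2\<close> for \<open>s d\<close> and \<open>d t\<close> are
  parameters so that two-letter and longer \<open>d\<close> are covered alike.\<close>

lemma commutator_value_reduce:
  assumes s: "s \<in> S" and t: "t \<in> S" and st: "s \<otimes> t \<noteq> t \<otimes> s"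
    and x: "x \<in> S" "x \<noteq> t" "x \<otimes> s \<noteq> s \<otimes> x"
    and v: "v \<in> parabolic (centralizing s \<inter> centralizing t)"
    and d: "set d = {s, t}" "distinct_adj d"
    and d1: "set d1 \<subseteq> {s, t}" "distinct_adj d1" "ev d1 = s \<otimes> ev d" "s \<in> set d1"
    and d2: "set d2 \<subseteq> {s, t}" "distinct_adj d2" "ev d2 = ev d \<otimes> t" "t \<in> set d2"
  shows "commutator_value s t (ev d \<otimes> v) = commutator_value x s (t \<otimes> ev d \<otimes> v \<otimes> x)"
proof -
  let ?C = "centralizing s \<inter> centralizing t"
  let ?P = "dihedral_support s t"
  have dS: "set d \<subseteq> S" "set d1 \<subseteq> S" "set d2 \<subseteq> S" using d d1 d2 s t by auto
  have CS: "?C \<subseteq> S" using centralizing_subset by blast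
  have PS: "?P \<subseteq> S" using s t by (rule dihedral_support_subset)
  have vc: "v \<in> carrier G" using v CS parabolic_carrier by blast
  have vs: "\<not> ldesc s v" "\<not> ldesc t v"
    using not_ldesc_parabolic[OF CS _ _ v] s t by (auto simp: centralizing_def)
  have vt: "t \<otimes> v = v \<otimes> t"
    using parabolic_centralizing_commute[OF t _ v] by simp
  have xne: "x \<noteq> s" using x by auto
  have xP: "x \<notin> ?P" using x xne by (auto simp: dihedral_support_def centralizing_def)
  have vx: "v \<otimes> x \<in> carrier G" "\<not> ldesc s (v \<otimes> x)" "\<not> ldesc t (v \<otimes> x)"
    using vs vc x s t xne ldesc_mult_right[of s x v] ldesc_mult_right[of t x v]
      conjugate_gens_eq[of s x v] conjugate_gens_eq[of t x v] by auto
  define u where "u = ev d \<otimes> v"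
  have u: "u \<in> carrier G" using dS vc by (simp add: u_def)
  have "ev d \<in> parabolic ?P"
    using d by (auto simp: parabolic_def dihedral_support_def)
  moreover have "v \<in> parabolic ?P"
    using v parabolic_mono[of ?C ?P] by (auto simp: dihedral_support_def)
  ultimately have uP: "u \<in> parabolic ?P"
    unfolding u_def by (intro parabolic_mult[OF PS])
  have ux: "\<not> ldesc x u" "\<not> rdesc x u"
    using not_ldesc_parabolic[OF PS x(1) xP uP] not_rdesc_parabolic[OF PS x(1) xP uP] by auto
  have rx: "rdesc x (u \<otimes> x)" using ux u x by (simp add: rdesc_mult_self)
  have zero1: "commutator_value s t (u \<otimes> x) = 0"
    using commutator_value_no_descent(2)[OF s t _ x(1) xP] rx by blast
  \<comment> \<open>Otherwise all letters of \<open>d\<close>, among them \<open>s\<close>, would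
    commute with \<open>x\<close>.\<close>
  have "x \<otimes> u \<noteq> u \<otimes> x"
  proof
    assume "x \<otimes> u = u \<otimes> x"
    then have "u \<in> parabolic (S \<inter> centralizing x)"
      using ux u x parabolic_gens by (intro commuting_in_parabolic[of u x S]) auto
    then have "ev d \<otimes> v \<in> parabolic (S \<inter> centralizing x)" by (simp add: u_def)
    then have "set d \<subseteq> S \<inter> centralizing x"
      using alternating_parabolic_letters[of s t v d "S \<inter> centralizing x"] d s t st vc vs by auto
    then show False using d x by (auto simp: centralizing_def)
  qed
  then have "\<not> rdesc x (x \<otimes> u)"
    using rdesc_mult_left[of x x u] x u ux by simp
  then have "rdesc x (x \<otimes> (u \<otimes> x))"
    using x u by (simp add: rdesc_mult_self flip: m_assoc)
  then have zero2: "commutator_value s t (x \<otimes> (u \<otimes> x)) = 0"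
    using commutator_value_no_descent(2)[OF s t _ x(1) xP] by blast
  have nc_s: "s \<notin> dihedral_support t x" and nc_t: "t \<notin> dihedral_support x s"
    using st x xne by (auto simp: dihedral_support_def centralizing_def)
  have supp_tx: "dihedral_support t x \<subseteq> S" and supp_xs: "dihedral_support x s \<subseteq> S"
    using dihedral_support_subset s t x by auto
  \<comment> \<open>The argument \<open>s u x\<close> is \<open>d1\<close> followed by
    \<open>v x\<close>, and the letter \<open>s\<close> of \<open>d1\<close> is not allowed in the
    support of the pair (t, x).\<close>
  have term1: "lmul s (commutator_value t x) (u \<otimes> x) = 0"
  proof -
    have "commutator_value t x (u \<otimes> x) = 0 \<or> \<not> ldesc s (u \<otimes> x)"
      using commutator_value_no_descent(1)[OF t x(1) _ s nc_s] by blast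
    moreover have "commutator_value t x (s \<otimes> (u \<otimes> x)) = 0"
    proof (rule ccontr)
      assume "commutator_value t x (s \<otimes> (u \<otimes> x)) \<noteq> 0"
      then have "s \<otimes> (u \<otimes> x) \<in> parabolic (dihedral_support t x)"
        by (rule commutator_value_support(1)[OF t x(1)])
      also have "s \<otimes> (u \<otimes> x) = ev d1 \<otimes> (v \<otimes> x)"
        using dS s vc x d1 by (simp add: u_def m_assoc)
      finally have "set d1 \<subseteq> dihedral_support t x"
        using alternating_parabolic_letters[of s t "v \<otimes> x" d1] s t st vx d1 supp_tx by blast
      then show False using nc_s d1 by auto
    qed
    ultimately show ?thesis
      using u x by (auto simp: lmul_apply)
  qed
  \<comment> \<open>A non-zero value at \<open>u x s\<close> would make \<open>s\<close> a right
    descent of \<open>u x\<close> besides \<open>x\<close>, although they do not commute.\<close>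
  have term2: "rmul s (commutator_value t x) (u \<otimes> x) = 0"
  proof -
    have "commutator_value t x (u \<otimes> x) = 0 \<or> \<not> rdesc s (u \<otimes> x)"
      using commutator_value_no_descent(2)[OF t x(1) _ s nc_s] by blast
    moreover have "commutator_value t x (u \<otimes> x \<otimes> s) = 0"
    proof (rule ccontr)
      assume "commutator_value t x (u \<otimes> x \<otimes> s) \<noteq> 0"
      then have "\<not> rdesc s (u \<otimes> x \<otimes> s)"
        by (rule commutator_value_no_descent(2)[OF t x(1) _ s nc_s])
      then have "rdesc s (u \<otimes> x)"
        using u x s by (simp add: rdesc_mult_self)
      then show False
        using rdescs_commute[of x s "u \<otimes> x"] rx x s u by simp
    qed
    ultimately show ?thesis
      using u x by (auto simp: rmul_apply)
  qed
  have term3: "lmul t (commutator_value x s) (u \<otimes> x) = commutator_value x s (t \<otimes> u \<otimes> x)"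
    using commutator_value_no_descent(1)[OF x(1) s _ t nc_t] u x t by (auto simp: lmul_apply m_assoc)
  \<comment> \<open>A non-zero value at \<open>u x t\<close> forces \<open>t\<close> to commute with
    \<open>x\<close>. Then \<open>t\<close> moves past \<open>x\<close> and \<open>v\<close> into
    the dihedral part, and \<open>d2\<close> shows a letter \<open>t\<close> outside the support of
    the pair (x, s).\<close>
  have term4: "rmul t (commutator_value x s) (u \<otimes> x) = 0"
  proof -
    have "commutator_value x s (u \<otimes> x) = 0 \<or> \<not> rdesc t (u \<otimes> x)"
      using commutator_value_no_descent(2)[OF x(1) s _ t nc_t] by blast
    moreover have "commutator_value x s (u \<otimes> x \<otimes> t) = 0"
    proof (rule ccontr)
      assume nz: "commutator_value x s (u \<otimes> x \<otimes> t) \<noteq> 0"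
      then have "\<not> rdesc t (u \<otimes> x \<otimes> t)"
        by (rule commutator_value_no_descent(2)[OF x(1) s _ t nc_t])
      then have "rdesc t (u \<otimes> x)"
        using u x t by (simp add: rdesc_mult_self)
      then have xt: "x \<otimes> t = t \<otimes> x"
        using rdescs_commute[of x t "u \<otimes> x"] rx x t u by simp
      have "u \<otimes> x \<otimes> t = ev d \<otimes> (v \<otimes> t) \<otimes> x"
        using dS vc x t xt by (simp add: u_def m_assoc)
      also have "\<dots> = ev d2 \<otimes> (v \<otimes> x)"
        using dS vc x t d2 by (simp add: m_assoc flip: vt)
      finally have "ev d2 \<otimes> (v \<otimes> x) \<in> parabolic (dihedral_support x s)"
        using commutator_value_support(1)[OF x(1) s nz] by simp
      then have "set d2 \<subseteq> dihedral_support x s"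
        using alternating_parabolic_letters[of s t "v \<otimes> x" d2] s t st vx d2 supp_xs by blast
      then show False using nc_t d2 by auto
    qed
    ultimately show ?thesis
      using u x by (auto simp: rmul_apply)
  qed
  have "lmul x (commutator_value s t) (u \<otimes> x) = 0" "rmul x (commutator_value s t) (u \<otimes> x) = commutator_value s t u"
    using zero1 zero2 u x by (simp_all add: lmul_apply rmul_apply)
  then have "commutator_value s t u = commutator_value x s (t \<otimes> u \<otimes> x)"
    using jacobi[OF s t x(1), of "u \<otimes> x"] term1 term2 term3 term4 by simp
  then show ?thesis
    using dS vc t x by (simp add: u_def m_assoc)
qed

end

context hecke_trace
begin

text \<open>Length at least three guarantees that both letters remain when the first one
  cancels.\<close>

lemma left_mult_alternating:
  assumes "s \<in> S" "t \<in> S" "set d = {s, t}" "distinct_adj d" "length d \<ge> 3" "l \<in> {s, t}"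
  shows "\<exists>d'. set d' = {s, t} \<and> distinct_adj d' \<and> ev d' = l \<otimes> ev d"
proof -
  obtain a b c ds where d: "d = a # b # c # ds"
    using assms(5) by (metis Suc_le_length_iff numeral_3_eq_3)
  show ?thesis
  proof (cases "a = l")
    case True
    have "b \<in> {s, t}" "c \<in> {s, t}" "b \<noteq> c"
      using assms(3,4) unfolding d by (auto simp: distinct_adj_Cons)
    then have "{b, c} = {s, t}" by auto
    moreover have "set ds \<subseteq> {s, t}"
      using assms(3) unfolding d by auto
    ultimately have "set (b # c # ds) = {s, t}" by auto
    moreover have "set d \<subseteq> S" using assms by auto
    then have "ev (b # c # ds) = l \<otimes> ev d"
      unfolding d True by simp
    ultimately show ?thesis
      using assms(4) d by (intro exI[of _ "b # c # ds"]) (auto simp: distinct_adj_Cons)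
  next
    case False
    then show ?thesis
      using assms d by (intro exI[of _ "l # d"]) (auto simp: distinct_adj_Cons)
  qed
qed

lemma right_mult_alternating:
  assumes "s \<in> S" "t \<in> S" "set d = {s, t}" "distinct_adj d" "length d \<ge> 3" "l \<in> {s, t}"
  shows "\<exists>d'. set d' = {s, t} \<and> distinct_adj d' \<and> ev d' = ev d \<otimes> l"
proof -
  obtain e where e: "set e = {s, t}" "distinct_adj e" "ev e = l \<otimes> ev (rev d)"
    using left_mult_alternating[of s t "rev d" l] assms by auto
  have S: "set e \<subseteq> S" "set d \<subseteq> S" "l \<in> S" using e assms by auto
  have "ev (rev e) = inv (ev e)" using S by (simp add: inv_ev)
  also have "\<dots> = ev d \<otimes> l"
    using S inv_ev[of "rev d"] by (simp add: e(3) inv_mult_group)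
  finally show ?thesis
    using e by (intro exI[of _ "rev e"]) simp
qed

text \<open>After the reduction the argument still begins with an alternating word in both letters,
  and its letter \<open>t\<close> lies outside the support of the pair (x, s).\<close>

lemma commutator_value_long:
  assumes s: "s \<in> S" and t: "t \<in> S" and st: "s \<otimes> t \<noteq> t \<otimes> s"
    and v: "v \<in> parabolic (centralizing s \<inter> centralizing t)"
    and d: "set d = {s, t}" "distinct_adj d" "length d \<ge> 3"
  shows "commutator_value s t (ev d \<otimes> v) = 0"
proof -
  have *: "commutator_value s t (ev d \<otimes> v) = 0"
    if st: "s \<in> S" "t \<in> S" "s \<otimes> t \<noteq> t \<otimes> s" and x: "x \<in> S" "x \<noteq> t" "x \<otimes> s \<noteq> s \<otimes> x"
      and v: "v \<in> parabolic (centralizing s \<inter> centralizing t)" and d: "set d = {s, t}" for s t x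
  proof -
    obtain d1 where d1: "set d1 = {s, t}" "distinct_adj d1" "ev d1 = s \<otimes> ev d"
      using left_mult_alternating[of s t d s] st d assms(6,7) by auto
    obtain d2 where d2: "set d2 = {s, t}" "distinct_adj d2" "ev d2 = ev d \<otimes> t"
      using right_mult_alternating[of s t d t] st d assms(6,7) by auto
    obtain d3 where d3: "set d3 = {s, t}" "distinct_adj d3" "ev d3 = t \<otimes> ev d"
      using left_mult_alternating[of s t d t] st d assms(6,7) by auto
    have "commutator_value s t (ev d \<otimes> v) = commutator_value x s (t \<otimes> ev d \<otimes> v \<otimes> x)"
      using st x v d assms(6) d1 d2 by (intro commutator_value_reduce[of s t x v d d1 d2]) auto
    also have "\<dots> = 0"
    proof (rule ccontr)
      let ?C = "centralizing s \<inter> centralizing t"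
      have CS: "?C \<subseteq> S" using centralizing_subset by blast
      have vc: "v \<in> carrier G" using v CS parabolic_carrier by blast
      have vs: "\<not> ldesc s v" "\<not> ldesc t v"
        using not_ldesc_parabolic[OF CS _ _ v] st by (auto simp: centralizing_def)
      have "x \<noteq> s" using x by auto
      then have vx: "v \<otimes> x \<in> carrier G" "\<not> ldesc s (v \<otimes> x)" "\<not> ldesc t (v \<otimes> x)"
        using vs vc x st ldesc_mult_right[of s x v] ldesc_mult_right[of t x v]
          conjugate_gens_eq[of s x v] conjugate_gens_eq[of t x v] by auto
      assume "commutator_value x s (t \<otimes> ev d \<otimes> v \<otimes> x) \<noteq> 0"
      then have "t \<otimes> ev d \<otimes> v \<otimes> x \<in> parabolic (dihedral_support x s)"
        by (rule commutator_value_support(1)[OF x(1) st(1)])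
      moreover have "set d \<subseteq> S" using d st by auto
      then have "t \<otimes> ev d \<otimes> v \<otimes> x = ev d3 \<otimes> (v \<otimes> x)"
        using d3 st vc x by (simp add: m_assoc)
      ultimately have "set d3 \<subseteq> dihedral_support x s"
        using alternating_parabolic_letters[of s t "v \<otimes> x" d3] st vx d3 dihedral_support_subset[OF x(1) st(1)] by auto
      then show False using d3 x st by (auto simp: dihedral_support_def centralizing_def)
    qed
    finally show ?thesis .
  qed
  \<comment> \<open>Connectedness provides a third generator joined to \<open>s\<close> or to
    \<open>t\<close>; skew symmetry in the pair interchanges the two cases.\<close>
  have "{s, t} \<noteq> S"
    using card_S card_insert_le_m1[of 2 "{t}" s] by (auto simp: card_insert_if split: if_splits)
  then obtain a x where ax: "a \<in> {s, t}" "x \<in> S" "a \<otimes> x \<noteq> x \<otimes> a" "x \<notin> {s, t}"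
    using connected[of "{s, t}"] s t by blast
  show ?thesis
  proof (cases "a = s")
    case True
    then show ?thesis using *[of s t x] s t st ax v d by auto
  next
    case False
    then have "commutator_value t s (ev d \<otimes> v) = 0"
      using *[of t s x] s t st ax v d by (auto simp: Int_commute insert_commute)
    then show ?thesis using commutator_value_swap[of s t] by simp
  qed
qed

text \<open>For \<open>v\<close> in the parabolic subgroup of the common link, \<open>t s v\<close>
  and \<open>s t v\<close> are the last candidates for the support. Their values are opposite, which
  leaves one number per unordered non-commuting pair and \<open>v\<close>.\<close>

definition edge_value :: "'a \<Rightarrow> 'a \<Rightarrow> 'a \<Rightarrow> complex" where
  "edge_value s t v = commutator_value s t (t \<otimes> s \<otimes> v)"

text \<open>The skew relation for \<open>s\<close> at \<open>t v\<close>: the value there is 0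
  because \<open>t v\<close> commutes with \<open>t\<close>, and the two translates are
  \<open>s t v\<close> and \<open>t v s = t s v\<close>.\<close>

lemma commutator_value_st:
  assumes s: "s \<in> S" and t: "t \<in> S" and st: "s \<otimes> t \<noteq> t \<otimes> s"
    and v: "v \<in> parabolic (centralizing s \<inter> centralizing t)"
  shows "commutator_value s t (s \<otimes> t \<otimes> v) = - edge_value s t v"
proof -
  let ?C = "centralizing s \<inter> centralizing t"
  have CS: "?C \<subseteq> S" using centralizing_subset by blast
  have vc: "v \<in> carrier G" using v CS parabolic_carrier by blast
  have sv: "s \<otimes> v = v \<otimes> s" and tv: "t \<otimes> v = v \<otimes> t"
    using parabolic_centralizing_commute[OF s _ v] parabolic_centralizing_commute[OF t _ v] by auto
  have "t \<otimes> v \<otimes> t = v"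
    using t vc by (simp add: tv)
  then have "commutator_value s t (t \<otimes> v) = 0"
    using s t vc by (intro commutator_value_vanish[of s t t]) auto
  moreover have "t \<otimes> v \<otimes> s = t \<otimes> s \<otimes> v"
    using s t vc sv by (simp add: m_assoc)
  ultimately show ?thesis
    using commutator_value_skew[of s t s "t \<otimes> v"] s t vc
    by (auto simp: lmul_apply rmul_apply edge_value_def m_assoc eq_neg_iff_add_eq_0 split: if_splits)
qed

lemma edge_value_swap:
  assumes "s \<in> S" "t \<in> S" "s \<otimes> t \<noteq> t \<otimes> s" "v \<in> parabolic (centralizing s \<inter> centralizing t)"
  shows "edge_value t s v = edge_value s t v"
  using commutator_value_st[OF assms] commutator_value_swap[of t s "s \<otimes> t \<otimes> v"]
  by (simp add: edge_value_def)

text \<open>\<open>commutator_value_reduce\<close> carries the value at \<open>t s v\<close> for the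
  pair (s, t) to the one at \<open>s v x\<close> for (x, s). If \<open>x\<close> commutes with
  \<open>v\<close>, this is the value of the neighbouring edge; otherwise \<open>s v x\<close> is
  outside the support, for \<open>v\<close> would lie in the link of \<open>x\<close>.\<close>

lemma edge_value_transfer:
  assumes s: "s \<in> S" and t: "t \<in> S" and st: "s \<otimes> t \<noteq> t \<otimes> s"
    and x: "x \<in> S" "x \<noteq> t" "x \<otimes> s \<noteq> s \<otimes> x"
    and v: "v \<in> parabolic (centralizing s \<inter> centralizing t)"
  shows "if x \<otimes> v = v \<otimes> x
    then v \<in> parabolic (centralizing s \<inter> centralizing x) \<and> edge_value s t v = edge_value s x v
    else edge_value s t v = 0"
proof -
  let ?C = "centralizing s \<inter> centralizing t"
  have CS: "?C \<subseteq> S" using centralizing_subset by blast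
  have vc: "v \<in> carrier G" using v CS parabolic_carrier by blast
  have vs: "\<not> ldesc s v"
    using not_ldesc_parabolic[OF CS _ _ v] s by (auto simp: centralizing_def)
  have sv: "s \<otimes> v = v \<otimes> s"
    using parabolic_centralizing_commute[OF s _ v] by auto
  have xne: "x \<noteq> s" using x by auto
  have st_ne: "s \<noteq> t" using st by auto
  have xC: "x \<notin> ?C" using x by (auto simp: centralizing_def)
  have vx: "\<not> ldesc x v"
    using not_ldesc_parabolic[OF CS x(1) xC v] .
  have "commutator_value s t (ev [t, s] \<otimes> v) = commutator_value x s (t \<otimes> ev [t, s] \<otimes> v \<otimes> x)"
    using s t st x v st_ne
    by (intro commutator_value_reduce[of s t x v "[t, s]" "[s, t, s]" "[t, s, t]"]) (auto simp: m_assoc)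
  then have eq: "edge_value s t v = commutator_value x s (s \<otimes> v \<otimes> x)"
    using s t vc x by (simp add: edge_value_def m_assoc)
  show ?thesis
  proof (cases "x \<otimes> v = v \<otimes> x")
    case True
    have v': "v \<in> parabolic (centralizing s \<inter> centralizing x)"
      using s x vc sv True vs vx by (intro in_parabolic_both_centralizing) auto
    have "s \<otimes> v \<otimes> x = s \<otimes> x \<otimes> v"
      using True s x vc by (simp add: m_assoc)
    then have "edge_value s t v = edge_value x s v"
      using eq by (simp add: edge_value_def)
    also have "\<dots> = edge_value s x v"
      using v' s x by (intro edge_value_swap) (auto simp: Int_commute)
    finally show ?thesis using v' True by simp
  next
    case False
    have "edge_value s t v = 0"
    proof (rule ccontr)
      assume "edge_value s t v \<noteq> 0"
      then have "s \<otimes> v \<otimes> x \<in> parabolic (dihedral_support x s)"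
        using commutator_value_support(1)[OF x(1) s] eq by simp
      moreover have sub: "dihedral_support x s \<subseteq> S" using x s by (intro dihedral_support_subset)
      ultimately have "v \<in> parabolic (dihedral_support x s)"
        using s x vc by (simp add: parabolic_step_iff parabolic_step_right_iff dihedral_support_def)
      then have "v \<in> parabolic (dihedral_support x s \<inter> centralizing s)"
        using vc s sv vs sub by (intro commuting_in_parabolic)
      moreover have "dihedral_support x s \<inter> centralizing s \<subseteq> centralizing x"
        using x s by (auto simp: dihedral_support_def centralizing_def)
      ultimately have "x \<otimes> v = v \<otimes> x"
        using x by (intro parabolic_centralizing_commute) auto
      with False show False by simp
    qed
    then show ?thesis using False by simp
  qed
qed

text \<open>A non-zero value spreads with the same \<open>v\<close> to edges at every generator, so
  \<open>v\<close> would be supported in the link of each generator, in particular in that of its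
  own first letter.\<close>

lemma edge_value_nontrivial:
  assumes s: "s \<in> S" and t: "t \<in> S" and st: "s \<otimes> t \<noteq> t \<otimes> s"
    and v: "v \<in> parabolic (centralizing s \<inter> centralizing t)" "v \<noteq> \<one>"
  shows "edge_value s t v = 0"
proof (rule ccontr)
  assume nz: "edge_value s t v \<noteq> 0"
  define A where "A = {a \<in> S. \<exists>b\<in>S. a \<otimes> b \<noteq> b \<otimes> a \<and> v \<in> parabolic (centralizing a \<inter> centralizing b) \<and> edge_value a b v \<noteq> 0}"
  have "A = S"
  proof (rule connected)
    show "A \<subseteq> S" by (auto simp: A_def)
    show "A \<noteq> {}" using s t st v nz by (auto simp: A_def)
    fix a x
    assume "a \<in> A" and x: "x \<in> S" "a \<otimes> x \<noteq> x \<otimes> a"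
    then obtain b where ab: "a \<in> S" "b \<in> S" "a \<otimes> b \<noteq> b \<otimes> a"
      "v \<in> parabolic (centralizing a \<inter> centralizing b)" "edge_value a b v \<noteq> 0"
      by (auto simp: A_def)
    have "v \<in> parabolic (centralizing a \<inter> centralizing x) \<and> edge_value a x v \<noteq> 0"
    proof (cases "x = b")
      case False
      then show ?thesis
        using edge_value_transfer[of a b x v] ab x by (auto split: if_splits)
    qed (use ab in auto)
    then show "x \<in> A"
      using x ab edge_value_swap[of a x v] by (auto simp: A_def Int_commute intro!: bexI[of _ a])
  qed
  have vc: "v \<in> carrier G"
    using v(1) parabolic_carrier[of "centralizing s \<inter> centralizing t" v] centralizing_subset by blast
  obtain xs where xs: "set xs \<subseteq> S" "ev xs = v" "length xs = len v"
    using exists_reduced vc by blast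
  then obtain l ys where xs_eq: "xs = l # ys" using v(2) by (cases xs) auto
  have l: "l \<in> S" "ldesc l v"
    using xs xs_eq len_ev_le[of ys] by (auto simp: ldesc_def)
  then obtain b where "v \<in> parabolic (centralizing l \<inter> centralizing b)"
    using \<open>A = S\<close> by (auto simp: A_def)
  then show False
    using l not_ldesc_parabolic[of "centralizing l \<inter> centralizing b" l v] centralizing_subset[of l]
    by (auto simp: centralizing_def)
qed

text \<open>For trivial \<open>v\<close> the transfer always preserves the value, and the graph is
  connected.\<close>

lemma edge_value_constant:
  "\<exists>c. \<forall>s\<in>S. \<forall>t\<in>S. s \<otimes> t \<noteq> t \<otimes> s \<longrightarrow> edge_value s t \<one> = c"
proof (cases "\<exists>s\<in>S. \<exists>t\<in>S. s \<otimes> t \<noteq> t \<otimes> s")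
  case True
  then obtain s t where st: "s \<in> S" "t \<in> S" "s \<otimes> t \<noteq> t \<otimes> s" by auto
  define A where "A = {a \<in> S. \<forall>b\<in>S. a \<otimes> b \<noteq> b \<otimes> a \<longrightarrow> edge_value a b \<one> = edge_value s t \<one>}"
  have move: "edge_value a b \<one> = edge_value a x \<one>"
    if "a \<in> S" "b \<in> S" "a \<otimes> b \<noteq> b \<otimes> a" "x \<in> S" "x \<otimes> a \<noteq> a \<otimes> x" for a b x
    using edge_value_transfer[of a b x \<one>] that by (cases "x = b") auto
  have "A = S"
  proof (rule connected)
    show "A \<subseteq> S" by (auto simp: A_def)
    have "s \<in> A"
      unfolding A_def using st move by (intro CollectI conjI ballI impI) metis+
    then show "A \<noteq> {}" by auto
    fix a x
    assume "a \<in> A" and x: "x \<in> S" "a \<otimes> x \<noteq> x \<otimes> a"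
    then have a: "a \<in> S" "edge_value a x \<one> = edge_value s t \<one>" by (auto simp: A_def)
    have "edge_value x b \<one> = edge_value s t \<one>" if "b \<in> S" "x \<otimes> b \<noteq> b \<otimes> x" for b
      using move[of x b a] edge_value_swap[of a x \<one>] that x a by auto
    then show "x \<in> A" using x by (auto simp: A_def)
  qed
  then show ?thesis by (auto simp: A_def)
qed auto

text \<open>The letters of the common link commute with \<open>s\<close> and \<open>t\<close> and
  can be collected on the right.\<close>

lemma dihedral_support_decomposition:
  assumes s: "s \<in> S" and t: "t \<in> S" and w: "w \<in> parabolic (dihedral_support s t)"
  shows "\<exists>d v. set d \<subseteq> {s, t} \<and> distinct_adj d \<and> v \<in> parabolic (centralizing s \<inter> centralizing t) \<and> w = ev d \<otimes> v"
proof -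
  let ?C = "centralizing s \<inter> centralizing t"
  have CS: "?C \<subseteq> S" using centralizing_subset by blast
  have "\<exists>d v. set d \<subseteq> {s, t} \<and> v \<in> parabolic ?C \<and> w = ev d \<otimes> v"
    using w dihedral_support_subset[OF s t]
  proof (induction rule: parabolic_induct)
    case one
    then show ?case by (intro exI[of _ "[]"] exI[of _ \<one>]) auto
  next
    case (step l w)
    then obtain d v where d: "set d \<subseteq> {s, t}" and v: "v \<in> parabolic ?C" and w: "w = ev d \<otimes> v" by auto
    have dS: "set d \<subseteq> S" using d s t by auto
    have vc: "v \<in> carrier G" using v CS parabolic_carrier by blast
    show ?case
    proof (cases "l \<in> {s, t}")
      case True
      then have "set (l # d) \<subseteq> {s, t}" "l \<otimes> w = ev (l # d) \<otimes> v" using d s t dS vc w by (auto simp: m_assoc)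
      then show ?thesis using v by blast
    next
      case False
      then have l: "l \<in> ?C" using step by (auto simp: dihedral_support_def)
      then have lS: "l \<in> S" using CS by auto
      have "ev d \<in> parabolic {s, t}" using d unfolding parabolic_def by blast
      then have "l \<otimes> ev d = ev d \<otimes> l"
        using l lS s t False by (intro parabolic_centralizing_commute) (auto simp: centralizing_def)
      then have "l \<otimes> w = ev d \<otimes> (l \<otimes> v)"
        using lS dS vc w by (simp flip: m_assoc)
      moreover have "l \<otimes> v \<in> parabolic ?C"
        using l v vc CS by (simp add: parabolic_step_iff)
      ultimately show ?thesis using d by blast
    qed
  qed
  then obtain d v where "set d \<subseteq> {s, t}" "v \<in> parabolic ?C" "w = ev d \<otimes> v" by auto
  then show ?thesis
    using alternating_expression[of d "{s, t}"] s t by (metis empty_subsetI insert_subset)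
qed

lemma commutator_value_formula:
  "\<exists>c. \<forall>s\<in>S. \<forall>t\<in>S. s \<otimes> t \<noteq> t \<otimes> s \<longrightarrow> (\<forall>w.
     commutator_value s t w = (if w = t \<otimes> s then c else if w = s \<otimes> t then - c else 0))"
proof -
  from edge_value_constant obtain c
    where c: "\<forall>s\<in>S. \<forall>t\<in>S. s \<otimes> t \<noteq> t \<otimes> s \<longrightarrow> edge_value s t \<one> = c" ..
  have "commutator_value s t w = (if w = t \<otimes> s then c else if w = s \<otimes> t then - c else 0)"
    if s: "s \<in> S" and t: "t \<in> S" and st: "s \<otimes> t \<noteq> t \<otimes> s" for s t w
  proof -
    have ts_val: "commutator_value s t (t \<otimes> s) = c"
      using c s t st by (simp add: edge_value_def)
    have st_val: "commutator_value s t (s \<otimes> t) = - c"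
      using commutator_value_st[OF s t st, of \<one>] c s t st by simp
    have "commutator_value s t w = 0" if ne: "w \<noteq> t \<otimes> s" "w \<noteq> s \<otimes> t"
    proof (rule ccontr)
      assume nz: "commutator_value s t w \<noteq> 0"
      let ?C = "centralizing s \<inter> centralizing t"
      have CS: "?C \<subseteq> S" using centralizing_subset by blast
      obtain d v where d: "set d \<subseteq> {s, t}" "distinct_adj d" and v: "v \<in> parabolic ?C" and w: "w = ev d \<otimes> v"
        using dihedral_support_decomposition[OF s t] commutator_value_support(1)[OF s t nz] by blast
      have vc: "v \<in> carrier G" using v CS parabolic_carrier by blast
      have sv: "s \<otimes> v = v \<otimes> s" and tv: "t \<otimes> v = v \<otimes> t"
        using parabolic_centralizing_commute[OF s _ v] parabolic_centralizing_commute[OF t _ v] by auto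
      \<comment> \<open>At most one dihedral letter: \<open>w\<close> commutes with \<open>s\<close>
        or \<open>t\<close>. Two letters: an edge value, zero for non-trivial \<open>v\<close>.
        Three or more: \<open>commutator_value_long\<close>.\<close>
      consider "d = []" | l where "d = [l]" | l l' where "d = [l, l']" | l l' l'' ds where "d = l # l' # l'' # ds"
        by (metis list.exhaust)
      then show False
      proof cases
        case 1
        then have "s \<otimes> w = w \<otimes> s" using w vc sv by simp
        then show False using commutator_value_vanish[of s t s w] s t vc w 1 nz by simp
      next
        case (2 l)
        then have l: "l = s \<or> l = t" using d by auto
        then have lS: "l \<in> S" using s t by auto
        have "l \<otimes> v = v \<otimes> l" using l sv tv by auto
        then have "l \<otimes> v \<otimes> l = v" using lS vc by simp
        then have "l \<otimes> w = w \<otimes> l" "w \<in> carrier G" using w 2 vc lS by simp_all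
        then show False using commutator_value_vanish[of s t l w] s t l nz by simp
      next
        case (3 l l')
        then have "(l = s \<and> l' = t) \<or> (l = t \<and> l' = s)" using d by auto
        then have "w = s \<otimes> t \<otimes> v \<or> w = t \<otimes> s \<otimes> v" using w 3 s t vc by (auto simp: m_assoc)
        moreover from this have "v \<noteq> \<one>" using ne s t by auto
        ultimately show False
          using edge_value_nontrivial[OF s t st v] commutator_value_st[OF s t st v] nz
          by (auto simp: edge_value_def)
      next
        case (4 a b)
        then have "a \<in> {s, t}" "b \<in> {s, t}" "a \<noteq> b" using d by (auto simp: distinct_adj_Cons)
        then have "{a, b} = {s, t}" by auto
        then have "set d = {s, t}" using d(1) unfolding 4 by auto
        then show False using commutator_value_long[OF s t st v _ d(2)] 4 nz w by simp
      qed
    qed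
    then show ?thesis using ts_val st_val st by auto
  qed
  then show ?thesis by (intro exI[of _ c] ballI impI allI)
qed

text \<open>The commutator values of \<open>c * delta \<one>\<close> are \<open>c\<close> at
  \<open>t s\<close> and \<open>- c\<close> at \<open>s t\<close>, exactly those found for
  \<open>z\<close>.\<close>

theorem trace_structure:
  "\<exists>c. \<forall>s\<in>S. \<forall>t\<in>S. lmul t (lmul s (\<lambda>w. z w - c * delta \<one> w)) = lmul s (lmul t (\<lambda>w. z w - c * delta \<one> w))"
proof -
  from commutator_value_formula obtain c where c: "\<forall>s\<in>S. \<forall>t\<in>S. s \<otimes> t \<noteq> t \<otimes> s \<longrightarrow>
     (\<forall>w. commutator_value s t w = (if w = t \<otimes> s then c else if w = s \<otimes> t then - c else 0))" ..
  have "lmul t (lmul s (\<lambda>w. z w - c * delta \<one> w)) = lmul s (lmul t (\<lambda>w. z w - c * delta \<one> w))"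
    if s: "s \<in> S" and t: "t \<in> S" for s t
  proof (cases "s \<otimes> t = t \<otimes> s")
    case True
    then show ?thesis using s t by (intro lmul_commute) auto
  next
    case False
    have "lmul t (lmul s z) w - c * lmul t (lmul s (delta \<one>)) w = lmul s (lmul t z) w - c * lmul s (lmul t (delta \<one>)) w" for w
      using c[rule_format, OF s t False, of w] False
      unfolding lmul_lmul_delta_one[OF s t False] lmul_lmul_delta_one[OF t s False[symmetric]]
      by (auto simp: commutator_value_def delta_def algebra_simps split: if_splits)
    then show ?thesis
      by (simp add: lmul_diff lmul_scale fun_eq_iff)
  qed
  then show ?thesis by blast
qed

end

subsection \<open>Sequence spaces\<close>

text \<open>The r-th power of the norm. Boundedness is shown on this level, where constants are
  arbitrary and no roots occur.\<close>

definition energy :: "real \<Rightarrow> 'a set \<Rightarrow> ('a \<Rightarrow> complex) \<Rightarrow> real" where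
  "energy r X f = (\<Sum>\<^sub>\<infinity>x\<in>X. cmod (f x) powr r)"

lemma lnorm_energy: "lnorm r X f = energy r X f powr (1 / r)"
  by (simp add: lnorm_def energy_def)

lemma energy_nonneg [simp]: "energy r X f \<ge> 0"
  unfolding energy_def by (rule infsum_nonneg) simp

lemma energy_lnorm: "r > 0 \<Longrightarrow> energy r X f = lnorm r X f powr r"
  by (simp add: lnorm_energy powr_powr)

lemma lnorm_nonneg [simp]: "lnorm r X f \<ge> 0"
  by (simp add: lnorm_energy)

lemma lspace_outside: "f \<in> lspace r X \<Longrightarrow> x \<notin> X \<Longrightarrow> f x = 0"
  by (simp add: lspace_def)

lemma lspace_summable: "f \<in> lspace r X \<Longrightarrow> (\<lambda>x. cmod (f x) powr r) summable_on X"
  by (simp add: lspace_def)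

lemma zero_in_lspace [simp, intro]: "(\<lambda>x. 0) \<in> lspace r X"
  by (simp add: lspace_def)

lemma lspace_comparison:
  assumes "f \<in> lspace r X" "\<And>x. x \<notin> X \<Longrightarrow> g x = 0"
    and "\<And>x. x \<in> X \<Longrightarrow> cmod (g x) powr r \<le> c * cmod (f x) powr r"
  shows "g \<in> lspace r X" "energy r X g \<le> c * energy r X f"
proof -
  have s: "(\<lambda>x. c * cmod (f x) powr r) summable_on X"
    using assms(1) by (intro summable_on_cmult_right lspace_summable)
  then have g: "(\<lambda>x. cmod (g x) powr r) summable_on X"
    by (rule summable_on_comparison_test) (use assms(3) in auto)
  then show "g \<in> lspace r X"
    using assms(2) by (simp add: lspace_def)
  have "energy r X g \<le> (\<Sum>\<^sub>\<infinity>x\<in>X. c * cmod (f x) powr r)"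
    unfolding energy_def by (rule infsum_mono[OF g s]) (use assms(3) in auto)
  then show "energy r X g \<le> c * energy r X f"
    by (simp add: energy_def infsum_cmult_right')
qed

lemma lspace_mult:
  assumes "r > 0" "f \<in> lspace r X" "\<And>x. x \<in> X \<Longrightarrow> cmod (c x) \<le> M"
  shows "(\<lambda>x. c x * f x) \<in> lspace r X" "energy r X (\<lambda>x. c x * f x) \<le> M powr r * energy r X f"
proof -
  have *: "cmod (c x * f x) powr r \<le> M powr r * cmod (f x) powr r" if "x \<in> X" for x
    using assms(1) assms(3)[OF that]
    by (auto simp: norm_mult powr_mult intro!: mult_right_mono powr_mono2)
  show "(\<lambda>x. c x * f x) \<in> lspace r X" "energy r X (\<lambda>x. c x * f x) \<le> M powr r * energy r X f"
    using lspace_comparison[of f r X "\<lambda>x. c x * f x" "M powr r"] * assms(2) lspace_outside[OF assms(2)]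
    by auto
qed

lemma lspace_scale: "r > 0 \<Longrightarrow> f \<in> lspace r X \<Longrightarrow> (\<lambda>x. c * f x) \<in> lspace r X"
  using lspace_mult(1)[of r f X "\<lambda>_. c" "cmod c"] by simp

lemma energy_scale: "energy r X (\<lambda>x. c * f x) = cmod c powr r * energy r X f"
  by (simp add: energy_def norm_mult powr_mult infsum_cmult_right')

text \<open>The bound by twice the larger modulus replaces the Minkowski inequality; the factor
  \<open>2 powr r\<close> is harmless for boundedness.\<close>

lemma lspace_add:
  assumes "r > 0" "f \<in> lspace r X" "g \<in> lspace r X"
  shows "(\<lambda>x. f x + g x) \<in> lspace r X"
    and "energy r X (\<lambda>x. f x + g x) \<le> 2 powr r * (energy r X f + energy r X g)"
proof -
  have *: "cmod (f x + g x) powr r \<le> 2 powr r * (cmod (f x) powr r + cmod (g x) powr r)" for x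
  proof -
    define M where "M = max (cmod (f x)) (cmod (g x))"
    have "cmod (f x + g x) \<le> 2 * M"
      using norm_triangle_ineq[of "f x" "g x"] by (simp add: M_def)
    then have "cmod (f x + g x) powr r \<le> (2 * M) powr r"
      using assms(1) by (intro powr_mono2) auto
    also have "\<dots> = 2 powr r * M powr r"
      by (simp add: powr_mult M_def)
    also have "M powr r \<le> cmod (f x) powr r + cmod (g x) powr r"
      by (simp add: M_def max_def)
    finally show ?thesis by simp
  qed
  have s: "(\<lambda>x. cmod (f x) powr r + cmod (g x) powr r) summable_on X"
    using assms by (intro summable_on_add lspace_summable)
  have s': "(\<lambda>x. 2 powr r * (cmod (f x) powr r + cmod (g x) powr r)) summable_on X"
    by (rule summable_on_cmult_right[OF s])
  have sum: "(\<lambda>x. cmod (f x + g x) powr r) summable_on X"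
    by (rule summable_on_comparison_test[OF s']) (use * in auto)
  then show "(\<lambda>x. f x + g x) \<in> lspace r X"
    using assms by (auto simp: lspace_def)
  have "energy r X (\<lambda>x. f x + g x) \<le> (\<Sum>\<^sub>\<infinity>x\<in>X. 2 powr r * (cmod (f x) powr r + cmod (g x) powr r))"
    unfolding energy_def by (rule infsum_mono[OF sum s']) (use * in auto)
  also have "\<dots> = 2 powr r * (energy r X f + energy r X g)"
    using assms by (simp add: energy_def infsum_cmult_right' infsum_add lspace_summable)
  finally show "energy r X (\<lambda>x. f x + g x) \<le> 2 powr r * (energy r X f + energy r X g)" .
qed

lemma lspace_diff:
  assumes "r > 0" "f \<in> lspace r X" "g \<in> lspace r X"
  shows "(\<lambda>x. f x - g x) \<in> lspace r X"
  using lspace_add(1)[OF assms(1,2) lspace_scale[OF assms(1,3), of "-1"]] by simp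

lemma lspace_reindex:
  assumes "bij_betw \<pi> X X" "f \<in> lspace r X"
  shows "(\<lambda>x. if x \<in> X then f (\<pi> x) else 0) \<in> lspace r X"
    and "energy r X (\<lambda>x. if x \<in> X then f (\<pi> x) else 0) = energy r X f"
proof -
  have "(\<lambda>x. cmod (f (\<pi> x)) powr r) summable_on X"
    using summable_on_reindex_bij_betw[OF assms(1), of "\<lambda>x. cmod (f x) powr r"] lspace_summable[OF assms(2)]
    by simp
  then show "(\<lambda>x. if x \<in> X then f (\<pi> x) else 0) \<in> lspace r X"
    by (simp add: lspace_def cong: summable_on_cong)
  show "energy r X (\<lambda>x. if x \<in> X then f (\<pi> x) else 0) = energy r X f"
    using infsum_reindex_bij_betw[OF assms(1), of "\<lambda>x. cmod (f x) powr r"]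
    by (simp add: energy_def cong: infsum_cong)
qed

lemma finite_support_lspace:
  assumes "r > 0" "finite F" "F \<subseteq> X" "\<And>x. x \<notin> F \<Longrightarrow> f x = 0"
  shows "f \<in> lspace r X" "energy r X f = (\<Sum>x\<in>F. cmod (f x) powr r)"
proof -
  have "(\<lambda>x. cmod (f x) powr r) summable_on X \<longleftrightarrow> (\<lambda>x. cmod (f x) powr r) summable_on F"
    by (rule summable_on_cong_neutral) (use assms in auto)
  then show "f \<in> lspace r X"
    using assms by (auto simp: lspace_def)
  have "energy r X f = (\<Sum>\<^sub>\<infinity>x\<in>F. cmod (f x) powr r)"
    unfolding energy_def by (rule infsum_cong_neutral) (use assms in auto)
  then show "energy r X f = (\<Sum>x\<in>F. cmod (f x) powr r)"
    using assms by simp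
qed

lemma delta_in_lspace: "r > 0 \<Longrightarrow> w \<in> X \<Longrightarrow> delta w \<in> lspace r X"
  by (rule finite_support_lspace(1)[of r "{w}"]) (auto simp: delta_def)

lemma cmod_powr_le_energy:
  assumes "f \<in> lspace r X" "x \<in> X"
  shows "cmod (f x) powr r \<le> energy r X f"
  using finite_sum_le_infsum[OF lspace_summable[OF assms(1)], of "{x}"] assms(2)
  by (simp add: energy_def)

lemma cmod_le_lnorm:
  assumes "r > 0" "f \<in> lspace r X" "x \<in> X"
  shows "cmod (f x) \<le> lnorm r X f"
proof -
  have "cmod (f x) = (cmod (f x) powr r) powr (1 / r)"
    using assms by (simp add: powr_powr)
  also have "\<dots> \<le> lnorm r X f"
    unfolding lnorm_energy using assms cmod_powr_le_energy[OF assms(2,3)] by (intro powr_mono2) auto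
  finally show ?thesis .
qed

text \<open>Values are bounded by the norm, so the surplus power \<open>b - a\<close> costs only a
  constant.\<close>

lemma lspace_mono_exponent:
  assumes "0 < a" "a \<le> b" "f \<in> lspace a X"
  shows "f \<in> lspace b X"
proof -
  define M where "M = lnorm a X f powr (b - a)"
  have *: "cmod (f x) powr b \<le> M * cmod (f x) powr a" if "x \<in> X" for x
  proof -
    have "cmod (f x) powr b = cmod (f x) powr (b - a) * cmod (f x) powr a"
      by (simp flip: powr_add)
    also have "\<dots> \<le> M * cmod (f x) powr a"
      unfolding M_def using assms cmod_le_lnorm[OF assms(1,3) that]
      by (intro mult_right_mono powr_mono2) auto
    finally show ?thesis .
  qed
  have "(\<lambda>x. cmod (f x) powr b) summable_on X"
    by (rule summable_on_comparison_test[OF summable_on_cmult_right[OF lspace_summable[OF assms(3)], of M]])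
      (use * in auto)
  then show ?thesis using assms(3) by (simp add: lspace_def)
qed

lemma lspace_decay:
  assumes "r > 0" "f \<in> lspace r X" "e > 0"
  shows "finite {x \<in> X. cmod (f x) \<ge> e}"
proof (rule ccontr)
  assume inf: "infinite {x \<in> X. cmod (f x) \<ge> e}"
  have pos: "e powr r > 0" using assms by simp
  obtain n :: nat where n: "real n * e powr r > energy r X f"
    using reals_Archimedean3[OF pos] by blast
  obtain F where F: "F \<subseteq> {x \<in> X. cmod (f x) \<ge> e}" "finite F" "card F = n"
    using infinite_arbitrarily_large[OF inf] by blast
  have "real n * e powr r = (\<Sum>x\<in>F. e powr r)" using F by simp
  also have "\<dots> \<le> (\<Sum>x\<in>F. cmod (f x) powr r)"
    using F assms by (intro sum_mono powr_mono2) auto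
  also have "\<dots> \<le> energy r X f"
    unfolding energy_def by (rule finite_sum_le_infsum) (use F assms lspace_summable in auto)
  finally show False using n by simp
qed

lemma lspace_truncate:
  assumes "r > 0" "f \<in> lspace r X" "e > 0"
  shows "\<exists>F. finite F \<and> F \<subseteq> X \<and> energy r X (\<lambda>x. if x \<in> F then 0 else f x) < e"
proof -
  have s: "(\<lambda>x. cmod (f x) powr r) summable_on X" using assms by (intro lspace_summable)
  have "\<exists>F. finite F \<and> F \<subseteq> X \<and> energy r X f - e < (\<Sum>x\<in>F. cmod (f x) powr r)"
  proof (rule ccontr)
    assume neg: "\<not> ?thesis"
    have "(\<Sum>\<^sub>\<infinity>x\<in>X. cmod (f x) powr r) \<le> energy r X f - e"
      by (rule infsum_le_finite_sums[OF s]) (use neg not_less in blast)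
    then have "energy r X f \<le> energy r X f - e" by (simp add: energy_def)
    then show False using assms by simp
  qed
  then obtain F where F: "finite F" "F \<subseteq> X" "energy r X f - e < (\<Sum>x\<in>F. cmod (f x) powr r)" by auto
  have "energy r X (\<lambda>x. if x \<in> F then 0 else f x) = (\<Sum>\<^sub>\<infinity>x\<in>X - F. cmod (f x) powr r)"
    unfolding energy_def by (rule infsum_cong_neutral) (auto simp: assms(1))
  also have "\<dots> = energy r X f - (\<Sum>x\<in>F. cmod (f x) powr r)"
    unfolding energy_def using F s by (subst infsum_Diff) auto
  also have "\<dots> < e" using F by simp
  finally show ?thesis using F by auto
qed

subsection \<open>Bounded operators\<close>

lemma bounded_opsI:
  assumes "r > 0"
    and "\<And>f. f \<in> lspace r X \<Longrightarrow> T f \<in> lspace r X"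
    and "\<And>f. f \<notin> lspace r X \<Longrightarrow> T f = (\<lambda>x. 0)"
    and "\<And>f g. f \<in> lspace r X \<Longrightarrow> g \<in> lspace r X \<Longrightarrow> T (\<lambda>x. f x + g x) = (\<lambda>x. T f x + T g x)"
    and "\<And>c f. f \<in> lspace r X \<Longrightarrow> T (\<lambda>x. c * f x) = (\<lambda>x. c * T f x)"
    and K: "\<And>f. f \<in> lspace r X \<Longrightarrow> energy r X (T f) \<le> K * energy r X f"
  shows "T \<in> bounded_ops r X"
proof -
  have "lnorm r X (T f) \<le> (max K 0) powr (1 / r) * lnorm r X f" if "f \<in> lspace r X" for f
  proof -
    have "energy r X (T f) \<le> max K 0 * energy r X f"
      using K[OF that] mult_right_mono[of K "max K 0" "energy r X f"] by simp
    then have "lnorm r X (T f) \<le> (max K 0 * energy r X f) powr (1 / r)"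
      unfolding lnorm_energy using assms(1) by (intro powr_mono2) auto
    then show ?thesis by (simp add: powr_mult lnorm_energy)
  qed
  then show ?thesis
    using assms(2-5) unfolding bounded_ops_def by blast
qed

lemma bounded_ops_lspace: "T \<in> bounded_ops r X \<Longrightarrow> f \<in> lspace r X \<Longrightarrow> T f \<in> lspace r X"
  by (simp add: bounded_ops_def)

lemma bounded_ops_outside: "T \<in> bounded_ops r X \<Longrightarrow> f \<notin> lspace r X \<Longrightarrow> T f = (\<lambda>x. 0)"
  by (simp add: bounded_ops_def)

lemma bounded_ops_add:
  "T \<in> bounded_ops r X \<Longrightarrow> f \<in> lspace r X \<Longrightarrow> g \<in> lspace r X \<Longrightarrow> T (\<lambda>x. f x + g x) = (\<lambda>x. T f x + T g x)"
  by (simp add: bounded_ops_def)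

lemma bounded_ops_scale:
  "T \<in> bounded_ops r X \<Longrightarrow> f \<in> lspace r X \<Longrightarrow> T (\<lambda>x. c * f x) = (\<lambda>x. c * T f x)"
  by (simp add: bounded_ops_def)

lemma bounded_ops_zero [simp]: "T \<in> bounded_ops r X \<Longrightarrow> T (\<lambda>x. 0) = (\<lambda>x. 0)"
  using bounded_ops_scale[of T r X "\<lambda>x. 0" 0] by simp

lemma bounded_ops_range: "T \<in> bounded_ops r X \<Longrightarrow> T f \<in> lspace r X"
  using bounded_ops_lspace[of T r X f] bounded_ops_outside[of T r X f]
  by (cases "f \<in> lspace r X") simp_all

lemma bounded_ops_bound:
  assumes "T \<in> bounded_ops r X"
  shows "\<exists>K>0. \<forall>f\<in>lspace r X. lnorm r X (T f) \<le> K * lnorm r X f"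
proof -
  have "\<exists>K. \<forall>f\<in>lspace r X. lnorm r X (T f) \<le> K * lnorm r X f"
    using assms by (simp add: bounded_ops_def)
  then obtain K where K: "\<forall>f\<in>lspace r X. lnorm r X (T f) \<le> K * lnorm r X f" ..
  have "lnorm r X (T f) \<le> (\<bar>K\<bar> + 1) * lnorm r X f" if f: "f \<in> lspace r X" for f
  proof -
    have "K * lnorm r X f \<le> (\<bar>K\<bar> + 1) * lnorm r X f"
      by (intro mult_right_mono) auto
    then show ?thesis using bspec[OF K f] by linarith
  qed
  then show ?thesis by (intro exI[of _ "\<bar>K\<bar> + 1"]) simp
qed

lemma bounded_ops_energy:
  assumes "r > 0" "T \<in> bounded_ops r X"
  shows "\<exists>K>0. \<forall>f\<in>lspace r X. energy r X (T f) \<le> K * energy r X f"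
proof -
  obtain K where K: "K > 0" "\<forall>f\<in>lspace r X. lnorm r X (T f) \<le> K * lnorm r X f"
    using bounded_ops_bound[OF assms(2)] by (elim exE conjE)
  have "energy r X (T f) \<le> K powr r * energy r X f" if f: "f \<in> lspace r X" for f
  proof -
    have "lnorm r X (T f) powr r \<le> (K * lnorm r X f) powr r"
      using bspec[OF K(2) f] assms(1) by (intro powr_mono2) simp_all
    then show ?thesis
      using assms(1) K(1) by (simp add: energy_lnorm powr_mult)
  qed
  then show ?thesis using K(1) by (intro exI[of _ "K powr r"]) simp
qed

lemma op_zero_bounded [simp]: "r > 0 \<Longrightarrow> op_zero \<in> bounded_ops r X"
  by (rule bounded_opsI[where K = 0]) (auto simp: op_zero_def energy_def)

lemma op_one_bounded [simp]: "r > 0 \<Longrightarrow> op_one r X \<in> bounded_ops r X"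
  by (rule bounded_opsI[where K = 1]) (auto simp: op_one_def on_lspace_def lspace_add lspace_scale)

lemma op_add_bounded:
  assumes "r > 0" "A \<in> bounded_ops r X" "B \<in> bounded_ops r X"
  shows "op_add A B \<in> bounded_ops r X"
proof -
  obtain K where K: "\<forall>f\<in>lspace r X. energy r X (A f) \<le> K * energy r X f"
    using bounded_ops_energy[OF assms(1,2)] by (elim exE conjE)
  obtain L where L: "\<forall>f\<in>lspace r X. energy r X (B f) \<le> L * energy r X f"
    using bounded_ops_energy[OF assms(1,3)] by (elim exE conjE)
  show ?thesis
  proof (rule bounded_opsI[where K = "2 powr r * (K + L)", OF assms(1)])
    fix f assume f: "f \<in> lspace r X"
    have "energy r X (op_add A B f) \<le> 2 powr r * (energy r X (A f) + energy r X (B f))"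
      unfolding op_add_def
      by (rule lspace_add(2)[OF assms(1) bounded_ops_range[OF assms(2)] bounded_ops_range[OF assms(3)]])
    also have "\<dots> \<le> 2 powr r * (K * energy r X f + L * energy r X f)"
      using bspec[OF K f] bspec[OF L f] by (intro mult_left_mono add_mono) auto
    finally show "energy r X (op_add A B f) \<le> 2 powr r * (K + L) * energy r X f"
      by (simp add: algebra_simps)
  next
    fix f g assume f: "f \<in> lspace r X" and g: "g \<in> lspace r X"
    show "op_add A B (\<lambda>x. f x + g x) = (\<lambda>x. op_add A B f x + op_add A B g x)"
      using bounded_ops_add[OF assms(2) f g] bounded_ops_add[OF assms(3) f g] by (simp add: op_add_def algebra_simps)
  next
    fix c f assume f: "f \<in> lspace r X"
    show "op_add A B (\<lambda>x. c * f x) = (\<lambda>x. c * op_add A B f x)"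
      using bounded_ops_scale[OF assms(2) f, of c] bounded_ops_scale[OF assms(3) f, of c]
      by (simp add: op_add_def algebra_simps)
    show "op_add A B f \<in> lspace r X"
      unfolding op_add_def
      by (rule lspace_add(1)[OF assms(1) bounded_ops_range[OF assms(2)] bounded_ops_range[OF assms(3)]])
  next
    fix f assume "f \<notin> lspace r X"
    then show "op_add A B f = (\<lambda>x. 0)"
      using bounded_ops_outside[OF assms(2)] bounded_ops_outside[OF assms(3)] by (simp add: op_add_def)
  qed
qed

lemma op_scale_bounded:
  assumes "r > 0" "A \<in> bounded_ops r X"
  shows "op_scale c A \<in> bounded_ops r X"
proof -
  obtain K where K: "\<forall>f\<in>lspace r X. energy r X (A f) \<le> K * energy r X f"
    using bounded_ops_energy[OF assms] by (elim exE conjE)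
  show ?thesis
  proof (rule bounded_opsI[where K = "cmod c powr r * K", OF assms(1)])
    fix f assume f: "f \<in> lspace r X"
    show "energy r X (op_scale c A f) \<le> cmod c powr r * K * energy r X f"
      using mult_left_mono[OF bspec[OF K f], of "cmod c powr r"] by (simp add: op_scale_def energy_scale mult.assoc)
    show "op_scale c A f \<in> lspace r X"
      unfolding op_scale_def by (rule lspace_scale[OF assms(1) bounded_ops_range[OF assms(2)]])
  next
    fix f g assume f: "f \<in> lspace r X" and g: "g \<in> lspace r X"
    show "op_scale c A (\<lambda>x. f x + g x) = (\<lambda>x. op_scale c A f x + op_scale c A g x)"
      using bounded_ops_add[OF assms(2) f g] by (simp add: op_scale_def algebra_simps)
  next
    fix d f assume f: "f \<in> lspace r X"
    show "op_scale c A (\<lambda>x. d * f x) = (\<lambda>x. d * op_scale c A f x)"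
      using bounded_ops_scale[OF assms(2) f, of d] by (simp add: op_scale_def algebra_simps)
  next
    fix f assume "f \<notin> lspace r X"
    then show "op_scale c A f = (\<lambda>x. 0)"
      using bounded_ops_outside[OF assms(2)] by (simp add: op_scale_def)
  qed
qed

lemma op_comp_bounded:
  assumes "r > 0" "A \<in> bounded_ops r X" "B \<in> bounded_ops r X"
  shows "A \<circ> B \<in> bounded_ops r X"
proof -
  obtain K where K: "K > 0" "\<forall>f\<in>lspace r X. energy r X (A f) \<le> K * energy r X f"
    using bounded_ops_energy[OF assms(1,2)] by (elim exE conjE)
  obtain L where L: "\<forall>f\<in>lspace r X. energy r X (B f) \<le> L * energy r X f"
    using bounded_ops_energy[OF assms(1,3)] by (elim exE conjE)
  show ?thesis
  proof (rule bounded_opsI[where K = "K * L", OF assms(1)])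
    fix f assume f: "f \<in> lspace r X"
    have "energy r X (A (B f)) \<le> K * energy r X (B f)"
      by (rule bspec[OF K(2) bounded_ops_range[OF assms(3)]])
    also have "\<dots> \<le> K * (L * energy r X f)"
      using bspec[OF L f] K(1) by (intro mult_left_mono) auto
    finally show "energy r X ((A \<circ> B) f) \<le> K * L * energy r X f" by simp
    show "(A \<circ> B) f \<in> lspace r X"
      using bounded_ops_range[OF assms(2)] by simp
  next
    fix f g assume f: "f \<in> lspace r X" and g: "g \<in> lspace r X"
    show "(A \<circ> B) (\<lambda>x. f x + g x) = (\<lambda>x. (A \<circ> B) f x + (A \<circ> B) g x)"
      using bounded_ops_add[OF assms(3) f g]
        bounded_ops_add[OF assms(2) bounded_ops_lspace[OF assms(3) f] bounded_ops_lspace[OF assms(3) g]] by simp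
  next
    fix d f assume f: "f \<in> lspace r X"
    show "(A \<circ> B) (\<lambda>x. d * f x) = (\<lambda>x. d * (A \<circ> B) f x)"
      using bounded_ops_scale[OF assms(3) f, of d] bounded_ops_scale[OF assms(2) bounded_ops_lspace[OF assms(3) f], of d]
      by simp
  next
    fix f assume "f \<notin> lspace r X"
    then show "(A \<circ> B) f = (\<lambda>x. 0)"
      using bounded_ops_outside[OF assms(3)] bounded_ops_zero[OF assms(2)] by simp
  qed
qed

text \<open>The finitely supported functions are dense.\<close>

lemma bounded_ops_eqI:
  assumes r: "r > 0" and A: "A \<in> bounded_ops r X" and B: "B \<in> bounded_ops r X"
    and eq: "\<And>w. w \<in> X \<Longrightarrow> A (delta w) = B (delta w)"
  shows "A = B"
proof
  fix f
  show "A f = B f"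
  proof (cases "f \<in> lspace r X")
    case True
    obtain K where K: "K > 0" "\<forall>f\<in>lspace r X. lnorm r X (A f) \<le> K * lnorm r X f"
      using bounded_ops_bound[OF A] by (elim exE conjE)
    obtain L where L: "L > 0" "\<forall>f\<in>lspace r X. lnorm r X (B f) \<le> L * lnorm r X f"
      using bounded_ops_bound[OF B] by (elim exE conjE)
    have fin: "A (\<lambda>x. if x \<in> F then f x else 0) = B (\<lambda>x. if x \<in> F then f x else 0)" if "finite F" "F \<subseteq> X" for F
      using that
    proof (induction F)
      case empty
      then show ?case using A B by simp
    next
      case (insert w F)
      have split: "(\<lambda>x. if x \<in> insert w F then f x else 0) =
          (\<lambda>x. (if x \<in> F then f x else 0) + f w * delta w x)"
        using insert.hyps by (auto simp: delta_def)
      have m: "(\<lambda>x. if x \<in> F then f x else 0) \<in> lspace r X" "delta w \<in> lspace r X"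
        "(\<lambda>x. f w * delta w x) \<in> lspace r X"
        using insert r by (auto intro!: finite_support_lspace(1)[of r F] delta_in_lspace lspace_scale)
      show ?case
        unfolding split bounded_ops_add[OF A m(1,3)] bounded_ops_add[OF B m(1,3)]
          bounded_ops_scale[OF A m(2)] bounded_ops_scale[OF B m(2)]
        using insert eq by simp
    qed
    have "A f v = B f v" for v
    proof (rule ccontr)
      assume ne: "A f v \<noteq> B f v"
      then have v: "v \<in> X"
        using lspace_outside[OF bounded_ops_range[OF A]] lspace_outside[OF bounded_ops_range[OF B]] by metis
      \<comment> \<open>The tail \<open>g\<close> is made shorter than \<open>d\<close>, chosen so
        that \<open>(K + L) * d\<close> is the supposed discrepancy at \<open>v\<close>.\<close>
      define d where "d = cmod (A f v - B f v) / (K + L)"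
      have d: "d > 0" using ne K L by (simp add: d_def)
      obtain F where F: "finite F" "F \<subseteq> X" "energy r X (\<lambda>x. if x \<in> F then 0 else f x) < d powr r"
        using lspace_truncate[OF r True, of "d powr r"] d by auto
      define g h where "g = (\<lambda>x. if x \<in> F then 0 else f x)" and "h = (\<lambda>x. if x \<in> F then f x else 0)"
      have h: "h \<in> lspace r X" unfolding h_def using F r by (intro finite_support_lspace(1)[of r F]) auto
      have gh: "f = (\<lambda>x. g x + h x)" and g_eq: "g = (\<lambda>x. f x - h x)" by (auto simp: g_def h_def)
      have g: "g \<in> lspace r X" unfolding g_eq using r True h by (rule lspace_diff)
      have "lnorm r X g < d"
      proof -
        have "lnorm r X g powr r < d powr r"
          using F r by (simp add: g_def flip: energy_lnorm)
        moreover have "d powr r \<le> lnorm r X g powr r" if "d \<le> lnorm r X g"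
          using r d that by (intro powr_mono2) auto
        ultimately show ?thesis by (meson not_less)
      qed
      have "A f v - B f v = A g v - B g v"
        using fin[OF F(1,2)] bounded_ops_add[OF A g h] bounded_ops_add[OF B g h]
        by (simp flip: gh h_def)
      also have "cmod \<dots> \<le> cmod (A g v) + cmod (B g v)" by (rule norm_triangle_ineq4)
      also have "\<dots> \<le> K * lnorm r X g + L * lnorm r X g"
        using cmod_le_lnorm[OF r bounded_ops_range[OF A] v, of g] cmod_le_lnorm[OF r bounded_ops_range[OF B] v, of g]
          bspec[OF K(2) g] bspec[OF L(2) g] by simp
      also have "\<dots> = (K + L) * lnorm r X g" by (simp add: algebra_simps)
      also have "\<dots> < (K + L) * d"
        using \<open>lnorm r X g < d\<close> K L by (intro mult_strict_left_mono) auto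
      also have "\<dots> = cmod (A f v - B f v)" using K L by (simp add: d_def)
      finally show False by simp
    qed
    then show ?thesis by auto
  next
    case False
    then show ?thesis using A B by (simp add: bounded_ops_outside)
  qed
qed

subsection \<open>Duality\<close>

text \<open>Young's inequality gives an additive bound, and normalising \<open>g\<close> makes it
  homogeneous. The constant is not the norm of \<open>f\<close>, but any finite one suffices to
  bound the projections.\<close>

lemma holder_pairing:
  assumes r: "r > 1" "r' > 1" "1 / r + 1 / r' = 1" and f: "f \<in> lspace r' X"
  shows "g \<in> lspace r X \<Longrightarrow> (\<lambda>x. cmod (f x * g x)) summable_on X"
    and "g \<in> lspace r X \<Longrightarrow> cmod (pairing X f g) \<le> (energy r' X f / r' + 1 / r) * lnorm r X g"
proof -
  have young: "cmod (f x * g x) \<le> cmod (f x) powr r' / r' + cmod (g x) powr r / r" for g x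
    using Youngs_inequality[of r' r "cmod (f x)" "cmod (g x)"] r by (simp add: norm_mult)
  have sm: "(\<lambda>x. cmod (f x) powr r' / r' + cmod (g x) powr r / r) summable_on X" if "g \<in> lspace r X" for g
    using summable_on_cmult_right[OF lspace_summable[OF f], of "1 / r'"]
      summable_on_cmult_right[OF lspace_summable[OF that], of "1 / r"]
    by (intro summable_on_add) (simp_all add: mult.commute)
  show abs: "(\<lambda>x. cmod (f x * g x)) summable_on X" if "g \<in> lspace r X" for g
    by (rule summable_on_comparison_test[OF sm[OF that]]) (use young in auto)
  have bound: "cmod (pairing X f g) \<le> energy r' X f / r' + energy r X g / r" if g: "g \<in> lspace r X" for g
  proof -
    have "cmod (pairing X f g) \<le> (\<Sum>\<^sub>\<infinity>x\<in>X. cmod (f x * g x))"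
      unfolding pairing_def by (rule norm_infsum_bound[OF abs[OF g]])
    also have "\<dots> \<le> (\<Sum>\<^sub>\<infinity>x\<in>X. cmod (f x) powr r' / r' + cmod (g x) powr r / r)"
      by (rule infsum_mono[OF abs[OF g] sm[OF g]]) (rule young)
    also have "\<dots> = (\<Sum>\<^sub>\<infinity>x\<in>X. cmod (f x) powr r' / r') + (\<Sum>\<^sub>\<infinity>x\<in>X. cmod (g x) powr r / r)"
      using summable_on_cmult_right[OF lspace_summable[OF f], of "1 / r'"]
        summable_on_cmult_right[OF lspace_summable[OF g], of "1 / r"]
      by (intro infsum_add) (simp_all add: mult.commute)
    also have "\<dots> = energy r' X f / r' + energy r X g / r"
      using infsum_cmult_right'[of "1 / r'" "\<lambda>x. cmod (f x) powr r'" X]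
        infsum_cmult_right'[of "1 / r" "\<lambda>x. cmod (g x) powr r" X]
      by (simp add: energy_def)
    finally show ?thesis .
  qed
  show "cmod (pairing X f g) \<le> (energy r' X f / r' + 1 / r) * lnorm r X g" if g: "g \<in> lspace r X" for g
  proof (cases "lnorm r X g = 0")
    case True
    then have "g x = 0" if "x \<in> X" for x
      using cmod_le_lnorm[of r g X x] g r that by simp
    then have "pairing X f g = 0"
      unfolding pairing_def by (intro infsum_0) simp
    then show ?thesis using True by simp
  next
    case False
    define N where "N = lnorm r X g"
    have N: "N > 0" using False by (simp add: N_def lnorm_energy)
    define h where "h = (\<lambda>x. complex_of_real (1 / N) * g x)"
    have h: "h \<in> lspace r X" unfolding h_def using r g by (intro lspace_scale) auto
    have "cmod (complex_of_real (1 / N)) = 1 / N"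
      using N by (simp add: norm_divide)
    then have "energy r X h = (1 / N) powr r * N powr r"
      unfolding h_def energy_scale using r by (simp only: energy_lnorm N_def)
    also have "\<dots> = 1" using N by (simp flip: powr_mult)
    finally have "energy r X h = 1" .
    have "pairing X f g = complex_of_real N * pairing X f h"
      unfolding pairing_def h_def using N
      by (simp flip: infsum_cmult_right' add: algebra_simps)
    then have "cmod (pairing X f g) = N * cmod (pairing X f h)"
      using N by (simp add: norm_mult)
    also have "\<dots> \<le> N * (energy r' X f / r' + 1 / r)"
      using bound[OF h] N \<open>energy r X h = 1\<close> by (intro mult_left_mono) auto
    finally show ?thesis by (simp add: N_def mult.commute)
  qed
qed

text \<open>Converse of the Hoelder inequality: test the functional on the extremal vector of each
  finite set and let the set grow.\<close>

lemma lspace_of_bounded_functional: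
  assumes r: "r > 1" "r' > 1" "1 / r + 1 / r' = 1" and a: "\<And>x. x \<notin> X \<Longrightarrow> a x = 0"
    and K: "\<And>F \<theta>. finite F \<Longrightarrow> F \<subseteq> X \<Longrightarrow> (\<And>x. x \<notin> F \<Longrightarrow> \<theta> x = 0) \<Longrightarrow>
      cmod (\<Sum>x\<in>F. a x * \<theta> x) \<le> K * lnorm r X \<theta>"
  shows "a \<in> lspace r' X"
proof -
  have bound: "(\<Sum>x\<in>F. cmod (a x) powr r') \<le> \<bar>K\<bar> powr r'" if F: "finite F" "F \<subseteq> X" for F
  proof -
    define A where "A = (\<Sum>x\<in>F. cmod (a x) powr r')"
    have "A \<ge> 0" unfolding A_def by (intro sum_nonneg) simp
    \<comment> \<open>Chosen such that the products \<open>a x * \<theta> x\<close> and the powers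
      \<open>cmod (\<theta> x) powr r\<close> both equal \<open>cmod (a x) powr r'\<close> on
      \<open>F\<close>.\<close>
    define \<theta> where "\<theta> = (\<lambda>x. if x \<in> F then cnj (a x) * complex_of_real (cmod (a x) powr (r' - 2)) else 0)"
    have cm: "cmod (\<theta> x) = cmod (a x) powr (r' - 1)" if "x \<in> F" for x
      using that powr_add[of "cmod (a x)" 1 "r' - 2"] by (cases "a x = 0") (auto simp: \<theta>_def norm_mult)
    have conj: "(r' - 1) * r = r'" using r by (simp add: field_simps)
    have "lnorm r X \<theta> = A powr (1 / r)"
    proof -
      have "energy r X \<theta> = (\<Sum>x\<in>F. cmod (\<theta> x) powr r)"
        using F r by (intro finite_support_lspace(2)) (auto simp: \<theta>_def)
      also have "\<dots> = A"
        unfolding A_def by (intro sum.cong) (simp_all add: cm powr_powr conj)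
      finally show ?thesis by (simp add: lnorm_energy)
    qed
    moreover have "(\<Sum>x\<in>F. a x * \<theta> x) = complex_of_real A"
    proof -
      have "a x * \<theta> x = complex_of_real (cmod (a x) powr r')" if "x \<in> F" for x
      proof (cases "a x = 0")
        case False
        have "cmod (a x) ^ 2 = cmod (a x) powr 2"
          using False by (simp add: powr_numeral)
        then have "cmod (a x) ^ 2 * cmod (a x) powr (r' - 2) = cmod (a x) powr r'"
          using powr_add[of "cmod (a x)" 2 "r' - 2"] by simp
        then have eq: "complex_of_real ((cmod (a x))\<^sup>2) * complex_of_real (cmod (a x) powr (r' - 2)) =
            complex_of_real (cmod (a x) powr r')"
          by (simp only: flip: of_real_mult)
        have "a x * \<theta> x = a x * cnj (a x) * complex_of_real (cmod (a x) powr (r' - 2))"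
          using that by (simp add: \<theta>_def)
        then show ?thesis
          using eq by (simp only: complex_norm_square)
      qed (use r that in simp)
      then show ?thesis by (simp add: A_def)
    qed
    ultimately have "A \<le> K * A powr (1 / r)"
      using K[OF F, of \<theta>] \<open>A \<ge> 0\<close> by (simp add: \<theta>_def)
    show ?thesis
    proof (cases "A = 0")
      case True
      then show ?thesis by (simp flip: A_def)
    next
      case False
      then have "A > 0" using \<open>A \<ge> 0\<close> by simp
      have "A = A powr (1 / r') * A powr (1 / r)"
        using \<open>A > 0\<close> r by (simp flip: powr_add add: add.commute)
      then have "A powr (1 / r') * A powr (1 / r) \<le> K * A powr (1 / r)"
        using \<open>A \<le> K * A powr (1 / r)\<close> by simp
      then have "A powr (1 / r') \<le> K" using \<open>A > 0\<close> by simp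
      then have "(A powr (1 / r')) powr r' \<le> \<bar>K\<bar> powr r'"
        using r by (intro powr_mono2) auto
      then show ?thesis using r \<open>A > 0\<close> by (simp add: powr_powr flip: A_def)
    qed
  qed
  have "(\<lambda>x. cmod (a x) powr r') summable_on X"
    by (rule nonneg_bdd_above_summable_on) (auto intro!: bdd_aboveI2[where M = "\<bar>K\<bar> powr r'"] bound)
  then show ?thesis using a by (simp add: lspace_def)
qed

context racg
begin

subsection \<open>Irreducibility\<close>

lemma generate_eq_parabolic:
  assumes "P \<subseteq> S"
  shows "generate G P = parabolic P"
proof
  show "generate G P \<subseteq> parabolic P"
  proof
    fix w assume "w \<in> generate G P"
    then show "w \<in> parabolic P"
    proof (induction rule: generate.induct)
      case (incl h)
      then show ?case using assms gen_in_parabolic by blast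
    next
      case (inv h)
      then have "inv h = h" using assms by auto
      then show ?case using inv assms gen_in_parabolic by auto
    next
      case (eng h1 h2)
      then show ?case using assms parabolic_mult by blast
    qed simp
  qed
  show "parabolic P \<subseteq> generate G P"
  proof
    fix w assume "w \<in> parabolic P"
    then show "w \<in> generate G P"
      using assms by (induction rule: parabolic_induct) (auto intro: generate.intros)
  qed
qed

lemma parabolic_commutes:
  assumes "P \<subseteq> S" "g \<in> carrier G" "\<And>s. s \<in> P \<Longrightarrow> s \<otimes> g = g \<otimes> s" "w \<in> parabolic P"
  shows "w \<otimes> g = g \<otimes> w"
  using assms(4,1)
proof (induction rule: parabolic_induct)
  case (step s w)
  have c: "s \<in> carrier G" "w \<in> carrier G" using step assms parabolic_carrier by blast+
  have "s \<otimes> w \<otimes> g = s \<otimes> (g \<otimes> w)" using c step assms by (simp add: m_assoc)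
  also have "\<dots> = g \<otimes> (s \<otimes> w)" using c assms(2) assms(3)[OF step(1)] by (simp flip: m_assoc)
  finally show ?case .
qed (use assms in simp)

lemma parabolics_commute:
  assumes "P \<subseteq> S" "Q \<subseteq> S" "\<And>s t. s \<in> P \<Longrightarrow> t \<in> Q \<Longrightarrow> s \<otimes> t = t \<otimes> s" "u \<in> parabolic P" "w \<in> parabolic Q"
  shows "u \<otimes> w = w \<otimes> u"
proof (rule parabolic_commutes[OF assms(1) _ _ assms(4)])
  show "w \<in> carrier G" using assms parabolic_carrier by blast
  fix s assume s: "s \<in> P"
  have "w \<otimes> s = s \<otimes> w"
  proof (rule parabolic_commutes[OF assms(2) _ _ assms(5)])
    show "s \<in> carrier G" using s assms(1) by auto
    show "t \<otimes> s = s \<otimes> t" if "t \<in> Q" for t using assms(3)[OF s that] by simp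
  qed
  then show "s \<otimes> w = w \<otimes> s" by simp
qed

lemma exists_ldesc:
  assumes "w \<in> carrier G" "w \<noteq> \<one>"
  shows "\<exists>l\<in>S. \<exists>v\<in>carrier G. w = l \<otimes> v \<and> \<not> ldesc l v \<and> len v < len w"
proof -
  obtain xs where xs: "set xs \<subseteq> S" "ev xs = w" "length xs = len w"
    using exists_reduced assms by blast
  with assms obtain l ys where xs_eq: "xs = l # ys" by (cases xs) auto
  then show ?thesis
    using xs len_ev_le[of ys]
    by (intro bexI[of _ l] bexI[of _ "ev ys"]) (auto simp: ldesc_def)
qed

text \<open>The first letter of a reduced word of \<open>w\<close> is a descent and would have to
  belong to both generating sets.\<close>

lemma parabolic_disjoint:
  assumes "P \<subseteq> S" "Q \<subseteq> S" "P \<inter> Q = {}" "w \<in> parabolic P" "w \<in> parabolic Q"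
  shows "w = \<one>"
proof (rule ccontr)
  assume "w \<noteq> \<one>"
  moreover have "w \<in> carrier G" using assms parabolic_carrier by blast
  ultimately obtain l v where l: "l \<in> S" "v \<in> carrier G" "w = l \<otimes> v" "\<not> ldesc l v"
    using exists_ldesc by blast
  then have "ldesc l w" by (simp add: ldesc_mult_self)
  then show False
    using l assms not_ldesc_parabolic[of P l w] not_ldesc_parabolic[of Q l w] by blast
qed

text \<open>A proper closed set commutes with its complement, so multiplication maps the product of
  the two parabolic subgroups isomorphically to the group; their trivial intersection gives
  injectivity.\<close>

lemma irreducible_connected:
  assumes irr: "irreducible_system G S" and A: "A \<subseteq> S" "A \<noteq> {}"
    and closed: "\<And>a x. a \<in> A \<Longrightarrow> x \<in> S \<Longrightarrow> a \<otimes> x \<noteq> x \<otimes> a \<Longrightarrow> x \<in> A"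
  shows "A = S"
proof (rule ccontr)
  assume "A \<noteq> S"
  define B where "B = S - A"
  have B: "B \<subseteq> S" "B \<noteq> {}" "A \<inter> B = {}" "A \<union> B = S"
    using A \<open>A \<noteq> S\<close> by (auto simp: B_def)
  have comm: "x \<otimes> y = y \<otimes> x" if "x \<in> parabolic A" "y \<in> parabolic B" for x y
  proof (rule parabolics_commute[OF A(1) B(1) _ that])
    fix s t
    assume "s \<in> A" "t \<in> B"
    then show "s \<otimes> t = t \<otimes> s"
      using closed[of s t] by (cases "s \<otimes> t = t \<otimes> s") (simp_all add: B_def)
  qed
  have cA: "x \<in> carrier G" if "x \<in> parabolic A" for x using that A parabolic_carrier by blast
  have cB: "x \<in> carrier G" if "x \<in> parabolic B" for x using that B parabolic_carrier by blast
  have "(\<lambda>(x, y). x \<otimes> y) \<in> iso (G\<lparr>carrier := parabolic A\<rparr> \<times>\<times> G\<lparr>carrier := parabolic B\<rparr>) G"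
  proof (rule isoI)
    show "(\<lambda>(x, y). x \<otimes> y) \<in> hom (G\<lparr>carrier := parabolic A\<rparr> \<times>\<times> G\<lparr>carrier := parabolic B\<rparr>) G"
    proof (rule homI)
      fix x y
      assume "x \<in> carrier (G\<lparr>carrier := parabolic A\<rparr> \<times>\<times> G\<lparr>carrier := parabolic B\<rparr>)"
        "y \<in> carrier (G\<lparr>carrier := parabolic A\<rparr> \<times>\<times> G\<lparr>carrier := parabolic B\<rparr>)"
      then obtain a b c d where xy: "x = (a, b)" "y = (c, d)"
        "a \<in> parabolic A" "c \<in> parabolic A" "b \<in> parabolic B" "d \<in> parabolic B"
        by (auto simp: DirProd_def)
      have "a \<otimes> c \<otimes> (b \<otimes> d) = a \<otimes> (c \<otimes> b) \<otimes> d"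
        using xy cA cB by (simp add: m_assoc)
      also have "c \<otimes> b = b \<otimes> c" using comm xy by blast
      also have "a \<otimes> (b \<otimes> c) \<otimes> d = a \<otimes> b \<otimes> (c \<otimes> d)"
        using xy cA cB by (simp add: m_assoc)
      finally show "(case x \<otimes>\<^bsub>G\<lparr>carrier := parabolic A\<rparr> \<times>\<times> G\<lparr>carrier := parabolic B\<rparr>\<^esub> y of (x, y) \<Rightarrow> x \<otimes> y) =
          (case x of (x, y) \<Rightarrow> x \<otimes> y) \<otimes> (case y of (x, y) \<Rightarrow> x \<otimes> y)"
        by (simp add: xy DirProd_def)
    qed (auto simp: DirProd_def cA cB)
    show "bij_betw (\<lambda>(x, y). x \<otimes> y) (carrier (G\<lparr>carrier := parabolic A\<rparr> \<times>\<times> G\<lparr>carrier := parabolic B\<rparr>)) (carrier G)"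
      unfolding bij_betw_def
    proof
      show "inj_on (\<lambda>(x, y). x \<otimes> y) (carrier (G\<lparr>carrier := parabolic A\<rparr> \<times>\<times> G\<lparr>carrier := parabolic B\<rparr>))"
      proof (rule inj_onI)
        fix x y
        assume x: "x \<in> carrier (G\<lparr>carrier := parabolic A\<rparr> \<times>\<times> G\<lparr>carrier := parabolic B\<rparr>)"
          and y: "y \<in> carrier (G\<lparr>carrier := parabolic A\<rparr> \<times>\<times> G\<lparr>carrier := parabolic B\<rparr>)"
          and eq: "(case x of (x, y) \<Rightarrow> x \<otimes> y) = (case y of (x, y) \<Rightarrow> x \<otimes> y)"
        obtain a b c d where xy: "x = (a, b)" "y = (c, d)"
          "a \<in> parabolic A" "c \<in> parabolic A" "b \<in> parabolic B" "d \<in> parabolic B"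
          using x y by (auto simp: DirProd_def)
        have cc: "a \<in> carrier G" "b \<in> carrier G" "c \<in> carrier G" "d \<in> carrier G" using xy cA cB by auto
        have ab: "a \<otimes> b = c \<otimes> d" using eq xy by simp
        have "inv c \<otimes> a = inv c \<otimes> (a \<otimes> b) \<otimes> inv b" using cc by (simp add: m_assoc)
        also have "\<dots> = d \<otimes> inv b" unfolding ab using cc by (simp flip: m_assoc)
        finally have eq': "inv c \<otimes> a = d \<otimes> inv b" .
        have "inv c \<otimes> a \<in> parabolic A" "d \<otimes> inv b \<in> parabolic B"
          using xy A B by (auto intro!: parabolic_mult inv_in_parabolic)
        then have "inv c \<otimes> a = \<one>"
          using parabolic_disjoint[OF A(1) B(1) B(3)] eq' by simp
        then have "inv c \<otimes> a = \<one>" "d \<otimes> inv b = \<one>" using eq' by auto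
        then have "a = c" "d = b"
          using cc by (metis inv_closed inv_equality inv_inv inv_comm, metis cc(2,4) inv_closed inv_equality inv_inv)
        then show "x = y" using xy by simp
      qed
      have "w \<in> (\<lambda>(x, y). x \<otimes> y) ` (parabolic A \<times> parabolic B)" if "w \<in> carrier G" for w
        using that
      proof (induction rule: word_induct)
        case one
        show ?case by (rule image_eqI[of _ _ "(\<one>, \<one>)"]) auto
      next
        case (step s w)
        then obtain a b where ab: "w = a \<otimes> b" "a \<in> parabolic A" "b \<in> parabolic B" by auto
        have cc: "a \<in> carrier G" "b \<in> carrier G" using ab cA cB by auto
        show ?case
        proof (cases "s \<in> A")
          case True
          then have "s \<otimes> a \<in> parabolic A" using ab A cc by (simp add: parabolic_step_iff)
          then show ?thesis
            using ab cc step by (intro image_eqI[of _ _ "(s \<otimes> a, b)"]) (auto simp: m_assoc)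
        next
          case False
          then have s: "s \<in> B" using step by (simp add: B_def)
          then have sb: "s \<otimes> b \<in> parabolic B" using ab B cc by (simp add: parabolic_step_iff)
          have "s \<otimes> (a \<otimes> b) = s \<otimes> a \<otimes> b" using cc step by (simp add: m_assoc)
          also have "s \<otimes> a = a \<otimes> s" using comm[of a s] ab s B gen_in_parabolic by simp
          also have "a \<otimes> s \<otimes> b = a \<otimes> (s \<otimes> b)" using cc step by (simp add: m_assoc)
          finally show ?thesis
            using ab sb by (intro image_eqI[of _ _ "(a, s \<otimes> b)"]) auto
        qed
      qed
      then show "(\<lambda>(x, y). x \<otimes> y) ` carrier (G\<lparr>carrier := parabolic A\<rparr> \<times>\<times> G\<lparr>carrier := parabolic B\<rparr>) = carrier G"
        using cA cB by (auto simp: DirProd_def)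
    qed
  qed
  then have "(\<lambda>(x, y). x \<otimes> y) \<in>
      iso (G\<lparr>carrier := generate G A\<rparr> \<times>\<times> G\<lparr>carrier := generate G B\<rparr>) G"
    by (simp only: generate_eq_parabolic[OF A(1)] generate_eq_parabolic[OF B(1)])
  with A(2) B(2-4) have "\<exists>S1 S2. S1 \<noteq> {} \<and> S2 \<noteq> {} \<and> S1 \<inter> S2 = {} \<and> S1 \<union> S2 = S \<and>
      (\<lambda>(x, y). x \<otimes> y) \<in> iso (G\<lparr>carrier := generate G S1\<rparr> \<times>\<times> G\<lparr>carrier := generate G S2\<rparr>) G"
    by (intro exI[of _ A] exI[of _ B] conjI)
  with irr show False
    unfolding irreducible_system_def by (rule notE)
qed

subsection \<open>Multiplicative functions on reduced expressions\<close>

text \<open>Reduced words of one element differ by exchanges of commuting letters. The multiset is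
  enough here, since the letters are mapped into a commutative ring.\<close>

lemma reduced_mset_eq:
  assumes "set xs \<subseteq> S" "set ys \<subseteq> S" "ev xs = ev ys" "length xs = len (ev xs)" "length ys = len (ev ys)"
  shows "mset xs = mset ys"
  using assms
proof (induction "length xs" arbitrary: xs ys rule: less_induct)
  case less
  show ?case
  proof (cases xs)
    case Nil
    then have "ev ys = \<one>" using less.prems(3)[symmetric] by simp
    then have "ys = []" using less.prems(5) by simp
    then show ?thesis using Nil by simp
  next
    case (Cons x xs')
    have "length ys = length xs"
      using less.prems(4,5) by (simp add: less.prems(3))
    then obtain y ys' where ys: "ys = y # ys'"
      using Cons by (cases ys) auto
    note xs = Cons
    define w where "w = ev xs"
    have xy: "x \<in> S" "y \<in> S" "set xs' \<subseteq> S" "set ys' \<subseteq> S" using less.prems xs ys by auto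
    have w: "w = x \<otimes> ev xs'" "w = y \<otimes> ev ys'" "w \<in> carrier G"
    proof -
      show "w = x \<otimes> ev xs'" by (simp add: w_def xs)
      show "w = y \<otimes> ev ys'" using less.prems(3) by (simp add: w_def ys)
      show "w \<in> carrier G" using less.prems(1) by (simp add: w_def)
    qed
    have len_w: "len w = Suc (length xs')" "len w = Suc (length ys')"
      using less.prems(4,5) unfolding less.prems(3)[symmetric] w_def[symmetric] by (simp_all add: xs ys)
    have tails: "x \<otimes> w = ev xs'" "y \<otimes> w = ev ys'"
      using xy by (simp add: w(1), simp add: w(2))
    have red: "len (ev xs') = length xs'" "len (ev ys') = length ys'"
      using len_ev_le[OF xy(3)] len_ev_le[OF xy(4)] len_mult_le[of x "ev xs'"] len_mult_le[of y "ev ys'"]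
        len_gen_le[OF xy(1)] len_gen_le[OF xy(2)] len_w w xy by auto
    have lt: "length xs' < length xs" "length ys' < length xs"
      using len_w xs by simp_all
    show ?thesis
    proof (cases "x = y")
      case True
      then have "ev xs' = ev ys'" using tails by simp
      then have "mset xs' = mset ys'"
        by (rule less.hyps[OF lt(1) xy(3,4) _ red(1)[symmetric] red(2)[symmetric]])
      then show ?thesis using xs ys True by simp
    next
      case False
      have d: "ldesc x w" "ldesc y w"
        using tails red len_w by (simp_all add: ldesc_def)
      then have comm: "x \<otimes> y = y \<otimes> x" using ldescs_commute xy w by blast
      have "ldesc y (x \<otimes> w)"
        using ldesc_mult_commuting[of y x w] xy w comm False d by simp
      then have len2: "len (ev xs') = Suc (len (y \<otimes> ev xs'))"
        using len_ldesc[of y "ev xs'"] xy tails by simp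
      \<comment> \<open>A reduced word of \<open>y x w\<close>. As the distinct descents
        \<open>x\<close> and \<open>y\<close> commute, \<open>y # zs\<close> and
        \<open>x # zs\<close> are reduced words of the two tails, to which the induction hypothesis
        applies.\<close>
      obtain zs where zs: "set zs \<subseteq> S" "ev zs = y \<otimes> ev xs'" "length zs = len (y \<otimes> ev xs')"
        using exists_reduced[of "y \<otimes> ev xs'"] xy by auto
      have 1: "ev (y # zs) = ev xs'" using zs xy by simp
      have "x \<otimes> (y \<otimes> (x \<otimes> w)) = y \<otimes> (x \<otimes> (x \<otimes> w))"
        using xy w comm by (simp flip: m_assoc)
      then have 2: "ev (x # zs) = ev ys'" using zs tails xy w by simp
      have "mset xs' = mset (y # zs)"
        by (rule less.hyps[OF lt(1) xy(3) _ 1[symmetric] red(1)[symmetric]])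
          (use xy zs in simp, unfold 1, use len2 zs in simp)
      moreover have "mset ys' = mset (x # zs)"
        by (rule less.hyps[OF lt(2) xy(4) _ 2[symmetric] red(2)[symmetric]])
          (use xy zs in simp, unfold 2, use len2 zs red len_w in simp)
      ultimately show ?thesis using xs ys by simp
    qed
  qed
qed

lemma q_elem_reduced:
  assumes "set xs \<subseteq> S" "ev xs = w" "length xs = len w"
  shows "q_elem G S q \<epsilon> w = prod_list (map (q_gen q \<epsilon>) xs)"
proof -
  define ys where "ys = (SOME ys. reduced_expression G S w ys)"
  have red: "reduced_expression G S w ys' \<longleftrightarrow> set ys' \<subseteq> S \<and> ev ys' = w \<and> length ys' = len w" for ys'
    by (auto simp: reduced_expression_def is_expression_iff len_def)
  have "reduced_expression G S w ys"
    unfolding ys_def by (rule someI[of _ xs]) (use assms red in auto)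
  then have "mset ys = mset xs"
    using assms red by (intro reduced_mset_eq) auto
  then have "prod_list (map (q_gen q \<epsilon>) ys) = prod_list (map (q_gen q \<epsilon>) xs)"
    by (metis mset_map prod_mset_prod_list)
  then show ?thesis by (simp add: q_elem_def ys_def)
qed

lemma q_elem_one [simp]: "q_elem G S q \<epsilon> \<one> = 1"
  using q_elem_reduced[of "[]" \<one>] by simp

lemma q_elem_step:
  assumes "s \<in> S" "w \<in> carrier G" "\<not> ldesc s w"
  shows "q_elem G S q \<epsilon> (s \<otimes> w) = q_gen q \<epsilon> s * q_elem G S q \<epsilon> w"
proof -
  obtain xs where xs: "set xs \<subseteq> S" "ev xs = w" "length xs = len w"
    using exists_reduced assms by blast
  then show ?thesis
    using q_elem_reduced[of xs w q \<epsilon>] q_elem_reduced[of "s # xs" "s \<otimes> w" q \<epsilon>] assms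
    by (simp add: len_not_ldesc)
qed

end

section \<open>Signed powers and the vectors \<open>eta\<close>\<close>

lemma signed_powr_mult: "signed_powr (x * y) t = signed_powr x t * signed_powr y t"
  by (simp add: signed_powr_def sgn_mult abs_mult powr_mult)

text \<open>Turns the convergence condition on the signs into membership of \<open>eta\<close> in a
  sequence space.\<close>

lemma abs_signed_powr: "\<bar>signed_powr x (t / 2)\<bar> = \<bar>signed_powr x (1 / 2)\<bar> powr t"
  by (cases "x = 0") (simp_all add: signed_powr_def abs_mult powr_powr abs_sgn_eq)

context racg
begin

lemma eta_one [simp]: "eta G S q \<epsilon> \<one> = 1"
  by (simp add: eta_def signed_powr_def)

lemma eta_outside [simp]: "w \<notin> carrier G \<Longrightarrow> eta G S q \<epsilon> w = 0"
  by (simp add: eta_def)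

lemma eta_step:
  assumes "s \<in> S" "w \<in> carrier G" "\<not> ldesc s w"
  shows "eta G S q \<epsilon> (s \<otimes> w) = weight q \<epsilon> s * eta G S q \<epsilon> w"
  using assms by (simp add: eta_def weight_def q_elem_step signed_powr_mult)

lemma convergent_signs_iff:
  "\<epsilon> \<in> convergent_signs G S q t \<longleftrightarrow> \<epsilon> \<in> S \<rightarrow>\<^sub>E {-1, 1} \<and> eta G S q \<epsilon> \<in> lspace t (carrier G)"
proof -
  have "cmod (eta G S q \<epsilon> w) powr t = \<bar>signed_powr (q_elem G S q \<epsilon> w) (t / 2)\<bar>" if "w \<in> carrier G" for w
    using that by (simp add: eta_def) (rule abs_signed_powr[symmetric])
  then show ?thesis
    by (auto simp: convergent_signs_def lspace_def cong: summable_on_cong)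
qed

end

section \<open>Weights and joint eigenfunctions\<close>

lemma weight_values:
  assumes "q s > 0"
  shows "\<epsilon> s = 1 \<Longrightarrow> weight q \<epsilon> s = complex_of_real (sqrt (q s))"
    and "\<epsilon> s = -1 \<Longrightarrow> weight q \<epsilon> s = - complex_of_real (1 / sqrt (q s))"
  using assms
  by (simp_all add: weight_def q_gen_def signed_powr_def powr_half_sqrt real_sqrt_inverse inverse_eq_divide real_sqrt_divide)

text \<open>Finite sums only: joint eigenfunctions of varying weights do not form a
  subspace.\<close>

inductive_set sums_of :: "('a \<Rightarrow> complex) set \<Rightarrow> ('a \<Rightarrow> complex) set" for J where
  zero: "(\<lambda>w. 0) \<in> sums_of J"
| add: "g \<in> J \<Longrightarrow> h \<in> sums_of J \<Longrightarrow> (\<lambda>w. g w + h w) \<in> sums_of J"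

context hecke
begin

text \<open>At a non-descent the eigenvalue equation determines the value at \<open>l v\<close> from
  that at \<open>v\<close>, so a reduced word leads back to the value at the identity.\<close>

lemma eigenfunction_unique:
  assumes g: "\<And>w. w \<notin> carrier G \<Longrightarrow> g w = 0" and \<phi>: "\<And>w. w \<notin> carrier G \<Longrightarrow> \<phi> w = 0" "\<phi> \<one> = 1"
    and step: "\<And>s w. s \<in> S \<Longrightarrow> w \<in> carrier G \<Longrightarrow> \<not> ldesc s w \<Longrightarrow> \<phi> (s \<otimes> w) = c s * \<phi> w"
    and eigen: "\<And>s. s \<in> S \<Longrightarrow> lmul s g = (\<lambda>w. c s * g w)"
  shows "g = (\<lambda>w. g \<one> * \<phi> w)"
proof
  fix w
  show "g w = g \<one> * \<phi> w"
  proof (cases "w \<in> carrier G")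
    case True
    then show ?thesis
    proof (induction "len w" arbitrary: w rule: less_induct)
      case less
      show ?case
      proof (cases "w = \<one>")
        case False
        then obtain l v where l: "l \<in> S" "v \<in> carrier G" "w = l \<otimes> v" "\<not> ldesc l v" "len v < len w"
          using exists_ldesc[OF less.prems False] by blast
        have "g w = c l * g v"
          using fun_cong[OF eigen[OF l(1)], of v] l by (simp add: lmul_apply)
        also have "g v = g \<one> * \<phi> v" using l(2,5) by (intro less.hyps)
        also have "c l * (g \<one> * \<phi> v) = g \<one> * \<phi> w"
          using step[OF l(1,2,4)] l(3) by simp
        finally show ?thesis .
      qed (use \<phi> in simp)
    qed
  qed (use g \<phi> in simp)
qed

text \<open>At non-descents the equation is the multiplicativity of \<phi>, at descents it is the
  quadratic equation for \<open>c s\<close>.\<close>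

lemma eigenfunction:
  assumes \<phi>: "\<And>w. w \<notin> carrier G \<Longrightarrow> \<phi> w = 0"
    and step: "\<And>s w. s \<in> S \<Longrightarrow> w \<in> carrier G \<Longrightarrow> \<not> ldesc s w \<Longrightarrow> \<phi> (s \<otimes> w) = c s * \<phi> w"
    and s: "s \<in> S" and quad: "c s * c s = 1 + p s * c s"
  shows "lmul s \<phi> = (\<lambda>w. c s * \<phi> w)"
proof
  fix w
  show "lmul s \<phi> w = c s * \<phi> w"
  proof (cases "w \<in> carrier G")
    case w: True
    show ?thesis
    proof (cases "ldesc s w")
      case True
      have "\<phi> w = c s * \<phi> (s \<otimes> w)"
        using step[of s "s \<otimes> w"] True w s by (simp add: ldesc_mult_self)
      moreover have "c s * (c s * \<phi> (s \<otimes> w)) = (1 + p s * c s) * \<phi> (s \<otimes> w)"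
        by (simp flip: quad)
      ultimately show ?thesis using True w by (simp add: lmul_apply algebra_simps)
    qed (use w s step in \<open>simp add: lmul_apply\<close>)
  qed (use \<phi> in simp)
qed

text \<open>\<open>a s\<close> and \<open>b s\<close> are the roots of \<open>x^2 = p x + 1\<close>,
  so \<open>(T - b) / (a - b)\<close> and \<open>(a - T) / (a - b)\<close> add up to 1 and project
  to the eigenspaces. The generators are treated one at a time; commutation preserves the eigenvalue
  equations already obtained.\<close>

lemma spectral_decomposition:
  assumes F: "finite F" "F \<subseteq> S"
    and ab: "\<And>s. s \<in> S \<Longrightarrow> a s \<noteq> b s" "\<And>s. s \<in> S \<Longrightarrow> a s + b s = p s" "\<And>s. s \<in> S \<Longrightarrow> a s * b s = -1"
    and lin: "\<And>g s \<alpha> \<beta>. g \<in> V \<Longrightarrow> s \<in> S \<Longrightarrow> (\<lambda>w. \<alpha> * lmul s g w + \<beta> * g w) \<in> V"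
    and out: "\<And>g w. g \<in> V \<Longrightarrow> w \<notin> carrier G \<Longrightarrow> g w = 0"
    and comm: "\<And>g s t. g \<in> V \<Longrightarrow> s \<in> S \<Longrightarrow> t \<in> S \<Longrightarrow> lmul s (lmul t g) = lmul t (lmul s g)"
    and f: "f \<in> V"
  shows "f \<in> sums_of {g \<in> V. \<forall>s\<in>F. lmul s g = (\<lambda>w. a s * g w) \<or> lmul s g = (\<lambda>w. b s * g w)}"
  using F
proof (induction F)
  case empty
  then show ?case using sums_of.add[OF _ sums_of.zero, of f "{g \<in> V. \<forall>s\<in>{}. lmul s g = (\<lambda>w. a s * g w) \<or> lmul s g = (\<lambda>w. b s * g w)}"] f
    by simp
next
  case (insert x F)
  define J where "J = (\<lambda>F. {g \<in> V. \<forall>s\<in>F. lmul s g = (\<lambda>w. a s * g w) \<or> lmul s g = (\<lambda>w. b s * g w)})"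
  have x: "x \<in> S" using insert by simp
  define d where "d = 1 / (a x - b x)"
  have d: "d * (a x - b x) = 1" using ab(1)[OF x] by (simp add: d_def)
  have sq: "lmul x (lmul x g) w = g w + p x * lmul x g w" if "g \<in> V" for g w
    using lmul_square[OF x, of g] out[OF that] by simp
  \<comment> \<open>Up to the scalar \<alpha> this applies \<open>T - b\<close> or
    \<open>T - a\<close>, whose image is the eigenspace of the other root.\<close>
  have key: "(\<lambda>w. \<alpha> * lmul x g w + \<beta> * g w) \<in> J (insert x F)"
    if g: "g \<in> J F" and \<alpha>\<beta>: "(\<beta> = - \<alpha> * b x) \<or> (\<beta> = - \<alpha> * a x)" for g \<alpha> \<beta>
  proof -
    define h where "h = (\<lambda>w. \<alpha> * lmul x g w + \<beta> * g w)"
    have gV: "g \<in> V" using g by (simp add: J_def)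
    then have hV: "h \<in> V" unfolding h_def using x by (rule lin)
    have lh: "lmul s h = (\<lambda>w. \<alpha> * lmul s (lmul x g) w + \<beta> * lmul s g w)" for s
      unfolding h_def by (simp add: lmul_add lmul_scale)
    have "lmul s h = (\<lambda>w. c * h w)" if s: "s \<in> F" and c: "lmul s g = (\<lambda>w. c * g w)" for s c
    proof -
      have "lmul s (lmul x g) = lmul x (lmul s g)"
        using comm[OF gV, of s x] s x insert by auto
      also have "\<dots> = (\<lambda>w. c * lmul x g w)" by (simp add: c lmul_scale)
      finally have "lmul s (lmul x g) = (\<lambda>w. c * lmul x g w)" .
      then show ?thesis unfolding lh c by (simp add: h_def algebra_simps)
    qed
    then have "\<forall>s\<in>F. lmul s h = (\<lambda>w. a s * h w) \<or> lmul s h = (\<lambda>w. b s * h w)"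
      using g unfolding J_def by blast
    moreover have "lmul x h = (\<lambda>w. a x * h w) \<or> lmul x h = (\<lambda>w. b x * h w)"
    proof -
      \<comment> \<open>Both elementary symmetric functions of the roots are substituted: the sum
        for the coefficient, the product for the constant term 1.\<close>
      have p: "p x = a x + b x" and one: "g w = - (a x * b x) * g w" for w
        using ab[OF x] by simp_all
      have lxh: "lmul x h w = \<alpha> * (g w + (a x + b x) * lmul x g w) + \<beta> * lmul x g w" for w
        by (simp add: lh sq[OF gV] p)
      from \<alpha>\<beta> show ?thesis
      proof
        assume \<beta>: "\<beta> = - \<alpha> * b x"
        have "lmul x h w = a x * h w" for w
          unfolding lxh by (subst one) (simp add: h_def \<beta> algebra_simps)
        then show ?thesis by auto
      next
        assume \<beta>: "\<beta> = - \<alpha> * a x"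
        have "lmul x h w = b x * h w" for w
          unfolding lxh by (subst one) (simp add: h_def \<beta> algebra_simps)
        then show ?thesis by auto
      qed
    qed
    ultimately show ?thesis using hV by (simp add: J_def flip: h_def)
  qed
  have "h \<in> sums_of (J (insert x F))" if "h \<in> sums_of (J F)" for h
    using that
  proof induction
    case (add g h)
    define g1 g2 where "g1 = (\<lambda>w. d * lmul x g w + (- d * b x) * g w)"
      and "g2 = (\<lambda>w. (- d) * lmul x g w + (- (- d) * a x) * g w)"
    have "g1 \<in> J (insert x F)" "g2 \<in> J (insert x F)"
      unfolding g1_def g2_def by (rule key[OF add.hyps(1)], simp)+
    moreover have "g w = g1 w + g2 w" for w
    proof -
      have "g1 w + g2 w = d * (a x - b x) * g w" by (simp add: g1_def g2_def algebra_simps)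
      then show ?thesis using d by simp
    qed
    then have "(\<lambda>w. g w + h w) = (\<lambda>w. g1 w + (g2 w + h w))" by auto
    ultimately show ?case using add by (auto intro!: sums_of.add)
  qed (rule sums_of.zero)
  then show ?case using insert by (simp add: J_def)
qed

end

subsection \<open>Operator algebras and commutants\<close>

lemma op_zero_apply [simp]: "op_zero f x = 0"
  by (simp add: op_zero_def)

lemma op_one_left: "T \<in> bounded_ops r X \<Longrightarrow> op_one r X \<circ> T = T"
  using bounded_ops_range[of T r X] by (auto simp: op_one_def on_lspace_def fun_eq_iff)

lemma op_one_right: "T \<in> bounded_ops r X \<Longrightarrow> T \<circ> op_one r X = T"
  using bounded_ops_outside[of T r X] bounded_ops_zero[of T r X]
  by (auto simp: op_one_def on_lspace_def fun_eq_iff)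

lemma op_zero_comp [simp]: "op_zero \<circ> T = op_zero"
  by (auto simp: op_zero_def)

lemma comp_op_zero: "T \<in> bounded_ops r X \<Longrightarrow> T \<circ> op_zero = op_zero"
  using bounded_ops_zero[of T r X] by (auto simp: op_zero_def)

lemma op_add_comp: "op_add A B \<circ> T = op_add (A \<circ> T) (B \<circ> T)"
  by (auto simp: op_add_def)

lemma op_scale_comp: "op_scale c A \<circ> T = op_scale c (A \<circ> T)"
  by (auto simp: op_scale_def)

lemma comp_op_add:
  assumes "T \<in> bounded_ops r X" "A \<in> bounded_ops r X" "B \<in> bounded_ops r X"
  shows "T \<circ> op_add A B = op_add (T \<circ> A) (T \<circ> B)"
  using bounded_ops_add[OF assms(1) bounded_ops_range[OF assms(2)] bounded_ops_range[OF assms(3)]]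
  by (auto simp: op_add_def fun_eq_iff)

lemma comp_op_scale:
  assumes "T \<in> bounded_ops r X" "A \<in> bounded_ops r X"
  shows "T \<circ> op_scale c A = op_scale c (T \<circ> A)"
  using bounded_ops_scale[OF assms(1) bounded_ops_range[OF assms(2)]]
  by (auto simp: op_scale_def fun_eq_iff)

lemma on_lspace_bounded:
  assumes r: "r > 0"
    and T: "\<And>f. f \<in> lspace r X \<Longrightarrow> T f \<in> lspace r X"
    and add: "\<And>f g. f \<in> lspace r X \<Longrightarrow> g \<in> lspace r X \<Longrightarrow> T (\<lambda>x. f x + g x) = (\<lambda>x. T f x + T g x)"
    and scale: "\<And>c f. f \<in> lspace r X \<Longrightarrow> T (\<lambda>x. c * f x) = (\<lambda>x. c * T f x)"
    and K: "\<And>f. f \<in> lspace r X \<Longrightarrow> energy r X (T f) \<le> K * energy r X f"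
  shows "on_lspace r X T \<in> bounded_ops r X"
proof (rule bounded_opsI[where K = K, OF r])
  fix f g assume fg: "f \<in> lspace r X" "g \<in> lspace r X"
  then have "(\<lambda>x. f x + g x) \<in> lspace r X" using r by (intro lspace_add(1))
  then show "on_lspace r X T (\<lambda>x. f x + g x) = (\<lambda>x. on_lspace r X T f x + on_lspace r X T g x)"
    using add[OF fg] fg by (simp add: on_lspace_def)
next
  fix c f assume f: "f \<in> lspace r X"
  then have "(\<lambda>x. c * f x) \<in> lspace r X" using r by (intro lspace_scale)
  then show "on_lspace r X T (\<lambda>x. c * f x) = (\<lambda>x. c * on_lspace r X T f x)"
    using scale[OF f] f by (simp add: on_lspace_def)
qed (use T K in \<open>simp_all add: on_lspace_def\<close>)

lemma commutant_algebra:
  assumes r: "r > 0" and A: "A \<subseteq> bounded_ops r X"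
  shows "operator_algebra r X (commutant r X A)" "op_one r X \<in> commutant r X A"
proof -
  have A': "R \<in> bounded_ops r X" if "R \<in> A" for R using that A by blast
  show "op_one r X \<in> commutant r X A"
    using r A' by (simp add: commutant_def op_one_left op_one_right)
  show "operator_algebra r X (commutant r X A)"
    unfolding operator_algebra_def
  proof (intro conjI ballI allI)
    show "commutant r X A \<subseteq> bounded_ops r X" by (auto simp: commutant_def)
    show "op_zero \<in> commutant r X A"
      using r by (simp add: commutant_def comp_op_zero[OF A'])
    fix S T assume "S \<in> commutant r X A" "T \<in> commutant r X A"
    then have S: "S \<in> bounded_ops r X" "\<And>R. R \<in> A \<Longrightarrow> S \<circ> R = R \<circ> S"
      and T: "T \<in> bounded_ops r X" "\<And>R. R \<in> A \<Longrightarrow> T \<circ> R = R \<circ> T"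
      by (auto simp: commutant_def)
    show "op_add S T \<in> commutant r X A"
      using r S T A' op_add_bounded[OF r S(1) T(1)]
      by (simp add: commutant_def op_add_comp comp_op_add[OF A' S(1) T(1)])
    have "(S \<circ> T) \<circ> R = R \<circ> (S \<circ> T)" if "R \<in> A" for R
      using S(2)[OF that] T(2)[OF that] by (metis comp_assoc)
    then show "S \<circ> T \<in> commutant r X A"
      using op_comp_bounded[OF r S(1) T(1)] by (simp add: commutant_def)
  next
    fix c S assume "S \<in> commutant r X A"
    then have S: "S \<in> bounded_ops r X" "\<And>R. R \<in> A \<Longrightarrow> S \<circ> R = R \<circ> S"
      by (auto simp: commutant_def)
    show "op_scale c S \<in> commutant r X A"
      using S op_scale_bounded[OF r S(1)]
      by (simp add: commutant_def op_scale_comp comp_op_scale[OF A' S(1)])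
  qed
qed

lemma operator_algebraD:
  assumes "operator_algebra r X M"
  shows "M \<subseteq> bounded_ops r X" "op_zero \<in> M" "A \<in> M \<Longrightarrow> B \<in> M \<Longrightarrow> op_add A B \<in> M"
    "A \<in> M \<Longrightarrow> B \<in> M \<Longrightarrow> A \<circ> B \<in> M" "A \<in> M \<Longrightarrow> op_scale c A \<in> M"
  using assms by (auto simp: operator_algebra_def)

lemma operator_algebra_sum:
  assumes M: "operator_algebra r X M" and "finite I" "\<And>i. i \<in> I \<Longrightarrow> A i \<in> M"
  shows "(\<lambda>f x. \<Sum>i\<in>I. k i * A i f x) \<in> M"
  using assms(2,3)
proof (induction I)
  case empty
  then show ?case using operator_algebraD(2)[OF M] by (simp add: op_zero_def)
next
  case (insert i I)
  then have "op_add (op_scale (k i) (A i)) (\<lambda>f x. \<Sum>i\<in>I. k i * A i f x) \<in> M"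
    by (intro operator_algebraD[OF M]) auto
  then show ?case using insert by (simp add: op_add_def op_scale_def)
qed

lemma bounded_ops_finite_support:
  assumes r: "r > 0" and T: "T \<in> bounded_ops r X"
    and F: "finite F" "F \<subseteq> X" "\<And>x. x \<notin> F \<Longrightarrow> \<theta> x = 0"
  shows "T \<theta> v = (\<Sum>w\<in>F. \<theta> w * T (delta w) v)"
  using F
proof (induction F arbitrary: \<theta>)
  case empty
  then have "\<theta> = (\<lambda>x. 0)" by auto
  then show ?case using T by simp
next
  case (insert w F)
  define \<theta>' where "\<theta>' = (\<lambda>x. if x = w then 0 else \<theta> x)"
  have split: "\<theta> = (\<lambda>x. \<theta>' x + \<theta> w * delta w x)"
    by (auto simp: \<theta>'_def delta_def)
  have m: "\<theta>' \<in> lspace r X" "delta w \<in> lspace r X" "(\<lambda>x. \<theta> w * delta w x) \<in> lspace r X"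
    using insert.prems insert.hyps r
    by (auto intro!: finite_support_lspace(1)[of r F] delta_in_lspace lspace_scale simp: \<theta>'_def)
  have "T \<theta> v = T \<theta>' v + \<theta> w * T (delta w) v"
    using bounded_ops_add[OF T m(1,3)] bounded_ops_scale[OF T m(2), of "\<theta> w"] by (simp flip: split)
  also have "T \<theta>' v = (\<Sum>x\<in>F. \<theta>' x * T (delta x) v)"
    using insert.prems by (intro insert.IH) (auto simp: \<theta>'_def)
  also have "\<dots> = (\<Sum>x\<in>F. \<theta> x * T (delta x) v)"
    using insert.hyps by (intro sum.cong) (auto simp: \<theta>'_def)
  finally show ?case using insert.hyps by simp
qed

subsection \<open>The Hecke algebra on sequence spaces\<close>

locale hecke_parameters = irreducible_racg G S m for G :: "('a, 'b) monoid_scheme" (structure) and S m +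
  fixes q :: "'a \<Rightarrow> real" and r r' :: real
  assumes q: "s \<in> S \<Longrightarrow> 0 < q s \<and> q s \<le> 1"
    and r: "1 < r" and conjugate: "1 / r + 1 / r' = 1"

definition hecke_coeff :: "('a \<Rightarrow> real) \<Rightarrow> 'a \<Rightarrow> complex" where
  "hecke_coeff q s = complex_of_real ((q s - 1) / sqrt (q s))"

sublocale hecke_parameters \<subseteq> hecke G S m "hecke_coeff q"
  by unfold_locales

context hecke_parameters
begin

lemma r': "1 < r'"
proof -
  have "1 / r' = 1 - 1 / r" using conjugate by simp
  then have "0 < 1 / r'" "1 / r' < 1" using r by simp_all
  then show ?thesis by (simp add: field_simps split: if_splits)
qed

lemma r_pos: "0 < r" and r'_pos: "0 < r'"
  using r r' by simp_all

abbreviation X :: "'a set" where "X \<equiv> carrier G"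
abbreviation T :: "'a \<Rightarrow> 'a operator" where "T \<equiv> hecke_op G S q r"

lemma translation_bij:
  assumes "s \<in> S"
  shows "bij_betw (\<lambda>w. s \<otimes> w) X X" "bij_betw (\<lambda>w. w \<otimes> s) X X"
  by (rule bij_betwI[where g = "\<lambda>w. s \<otimes> w"], use assms in auto)
    (rule bij_betwI[where g = "\<lambda>w. w \<otimes> s"], use assms in auto)

text \<open>A translation plus a bounded diagonal operator. The exponent is left free because traces
  have to be followed in the spaces for \<open>r\<close> and for \<open>r'\<close>.\<close>

lemma lmul_lspace:
  assumes s: "s \<in> S" and a: "a > 0"
  shows "f \<in> lspace a X \<Longrightarrow> lmul s f \<in> lspace a X"
    and "\<exists>K. \<forall>f\<in>lspace a X. energy a X (lmul s f) \<le> K * energy a X f"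
proof -
  define p where "p = hecke_coeff q s"
  define c where "c = (\<lambda>w. if w \<in> X \<and> ldesc s w then p else 0)"
  have eq: "lmul s f = (\<lambda>w. (if w \<in> X then f (s \<otimes> w) else 0) + c w * f w)" for f
    by (auto simp: lmul_def c_def p_def)
  have c: "cmod (c w) \<le> cmod p" for w by (simp add: c_def)
  show "lmul s f \<in> lspace a X" if "f \<in> lspace a X" for f
    unfolding eq using a lspace_reindex(1)[OF translation_bij(1)[OF s] that] lspace_mult(1)[OF a that c]
    by (intro lspace_add(1))
  have "energy a X (lmul s f) \<le> (2 powr a * (1 + cmod p powr a)) * energy a X f" if f: "f \<in> lspace a X" for f
  proof -
    have "energy a X (lmul s f) \<le> 2 powr a * (energy a X (\<lambda>w. if w \<in> X then f (s \<otimes> w) else 0) + energy a X (\<lambda>w. c w * f w))"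
      unfolding eq using a lspace_reindex(1)[OF translation_bij(1)[OF s] f] lspace_mult(1)[OF a f c]
      by (intro lspace_add(2))
    also have "\<dots> \<le> 2 powr a * (energy a X f + cmod p powr a * energy a X f)"
      using lspace_reindex(2)[OF translation_bij(1)[OF s] f] lspace_mult(2)[OF a f c]
      by (intro mult_left_mono add_mono) auto
    finally show ?thesis by (simp add: algebra_simps)
  qed
  then show "\<exists>K. \<forall>f\<in>lspace a X. energy a X (lmul s f) \<le> K * energy a X f" by blast
qed

lemma rmul_lspace:
  assumes s: "s \<in> S" and a: "a > 0"
  shows "f \<in> lspace a X \<Longrightarrow> rmul s f \<in> lspace a X"
    and "\<exists>K. \<forall>f\<in>lspace a X. energy a X (rmul s f) \<le> K * energy a X f"
proof -
  define p where "p = hecke_coeff q s"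
  define c where "c = (\<lambda>w. if w \<in> X \<and> rdesc s w then p else 0)"
  have eq: "rmul s f = (\<lambda>w. (if w \<in> X then f (w \<otimes> s) else 0) + c w * f w)" for f
    by (auto simp: rmul_def c_def p_def)
  have c: "cmod (c w) \<le> cmod p" for w by (simp add: c_def)
  show "rmul s f \<in> lspace a X" if "f \<in> lspace a X" for f
    unfolding eq using a lspace_reindex(1)[OF translation_bij(2)[OF s] that] lspace_mult(1)[OF a that c]
    by (intro lspace_add(1))
  have "energy a X (rmul s f) \<le> (2 powr a * (1 + cmod p powr a)) * energy a X f" if f: "f \<in> lspace a X" for f
  proof -
    have "energy a X (rmul s f) \<le> 2 powr a * (energy a X (\<lambda>w. if w \<in> X then f (w \<otimes> s) else 0) + energy a X (\<lambda>w. c w * f w))"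
      unfolding eq using a lspace_reindex(1)[OF translation_bij(2)[OF s] f] lspace_mult(1)[OF a f c]
      by (intro lspace_add(2))
    also have "\<dots> \<le> 2 powr a * (energy a X f + cmod p powr a * energy a X f)"
      using lspace_reindex(2)[OF translation_bij(2)[OF s] f] lspace_mult(2)[OF a f c]
      by (intro mult_left_mono add_mono) auto
    finally show ?thesis by (simp add: algebra_simps)
  qed
  then show "\<exists>K. \<forall>f\<in>lspace a X. energy a X (rmul s f) \<le> K * energy a X f" by blast
qed

lemma hecke_basis_eq:
  assumes "s \<in> S" "w \<in> X"
  shows "hecke_basis G S q s w v = (if v = s \<otimes> w then 1 else 0)
    + (if ldesc s w then hecke_coeff q s * (if v = w then 1 else 0) else 0)"
proof -
  have "word_length G S (s \<otimes> w) > word_length G S w \<longleftrightarrow> \<not> ldesc s w"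
    using len_ldesc[OF assms] len_not_ldesc[OF assms] by (auto simp: len_def)
  then show ?thesis by (simp add: hecke_basis_def delta_def hecke_coeff_def)
qed

lemma hecke_op_eq:
  assumes s: "s \<in> S" and f: "f \<in> lspace r X"
  shows "T s f = lmul s f"
proof
  fix v
  have "T s f v = (\<Sum>\<^sub>\<infinity>w\<in>X. f w * hecke_basis G S q s w v)"
    using f by (simp add: hecke_op_def on_lspace_def)
  also have "\<dots> = lmul s f v"
  proof (cases "v \<in> X")
    case True
    have ne: "v \<noteq> s \<otimes> v"
      using len_ldesc[OF s True] len_not_ldesc[OF s True] by (metis n_not_Suc_n)
    have "(\<Sum>\<^sub>\<infinity>w\<in>X. f w * hecke_basis G S q s w v) = (\<Sum>\<^sub>\<infinity>w\<in>{s \<otimes> v, v}. f w * hecke_basis G S q s w v)"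
    proof (rule infsum_cong_neutral)
      fix w assume w: "w \<in> X - {s \<otimes> v, v}"
      then have "v \<noteq> s \<otimes> w" using s by auto
      then show "f w * hecke_basis G S q s w v = 0" using w s by (auto simp: hecke_basis_eq)
    qed (use True s in auto)
    also have "\<dots> = lmul s f v"
      using True s ne ne[symmetric] by (simp add: hecke_basis_eq lmul_apply)
    finally show ?thesis .
  next
    case False
    then have "f w * hecke_basis G S q s w v = 0" if "w \<in> X" for w
      using that s by (auto simp: hecke_basis_eq)
    then show ?thesis using False by (simp add: infsum_0)
  qed
  finally show "T s f v = lmul s f v" .
qed

lemma hecke_op_lmul: "s \<in> S \<Longrightarrow> T s = on_lspace r X (lmul s)"
proof
  fix f assume "s \<in> S"
  then show "T s f = on_lspace r X (lmul s) f"
    using hecke_op_eq[of s f] by (cases "f \<in> lspace r X") (simp_all add: on_lspace_def hecke_op_def)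
qed

text \<open>The supply of operators in the commutant: elements of \<open>N\<close> commute with
  them.\<close>

definition right_op :: "'a \<Rightarrow> 'a operator" where
  "right_op s = on_lspace r X (rmul s)"

lemma hecke_op_bounded:
  assumes "s \<in> S"
  shows "T s \<in> bounded_ops r X"
proof -
  obtain K where "\<forall>f\<in>lspace r X. energy r X (lmul s f) \<le> K * energy r X f"
    using lmul_lspace(2)[OF assms r_pos] ..
  then show ?thesis
    unfolding hecke_op_lmul[OF assms] using r_pos lmul_lspace(1)[OF assms r_pos]
    by (intro on_lspace_bounded[where K = K]) (simp_all add: lmul_add lmul_scale)
qed

lemma right_op_bounded:
  assumes "s \<in> S"
  shows "right_op s \<in> bounded_ops r X"
proof -
  obtain K where "\<forall>f\<in>lspace r X. energy r X (rmul s f) \<le> K * energy r X f"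
    using rmul_lspace(2)[OF assms r_pos] ..
  then show ?thesis
    unfolding right_op_def using r_pos rmul_lspace(1)[OF assms r_pos]
    by (intro on_lspace_bounded[where K = K]) (simp_all add: rmul_add rmul_scale)
qed

lemma hecke_op_right_op:
  assumes "s \<in> S" "t \<in> S"
  shows "right_op t \<circ> T s = T s \<circ> right_op t"
proof
  fix f
  show "(right_op t \<circ> T s) f = (T s \<circ> right_op t) f"
  proof (cases "f \<in> lspace r X")
    case True
    then show ?thesis
      using lmul_lspace(1)[OF assms(1) r_pos True] rmul_lspace(1)[OF assms(2) r_pos True]
        lmul_rmul_commute[OF assms, of f]
      by (simp add: hecke_op_eq[OF assms(1)] right_op_def on_lspace_def)
  next
    case False
    then show ?thesis
      using bounded_ops_outside[OF hecke_op_bounded[OF assms(1)] False]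
        bounded_ops_outside[OF right_op_bounded[OF assms(2)] False]
        bounded_ops_zero[OF hecke_op_bounded[OF assms(1)]] bounded_ops_zero[OF right_op_bounded[OF assms(2)]]
      by simp
  qed
qed

abbreviation H :: "'a operator set" where "H \<equiv> hecke_image G S q r"
abbreviation N :: "'a operator set" where "N \<equiv> hecke_double_commutant G S q r"

lemma hecke_image_bounded: "A \<in> H \<Longrightarrow> A \<in> bounded_ops r X"
proof (induction rule: hecke_image.induct)
  case one
  show ?case by (rule op_one_bounded[OF r_pos])
next
  case (gen s)
  then show ?case by (rule hecke_op_bounded)
next
  case (add A B)
  show ?case by (rule op_add_bounded[OF r_pos add.IH])
next
  case (scale A c)
  show ?case by (rule op_scale_bounded[OF r_pos scale.IH])
next
  case (mult A B)
  show ?case by (rule op_comp_bounded[OF r_pos mult.IH])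
qed

lemma commutes_with_hecke_image:
  assumes R: "R \<in> bounded_ops r X" and comm: "\<And>s. s \<in> S \<Longrightarrow> R \<circ> T s = T s \<circ> R"
  shows "R \<in> commutant r X H"
proof -
  have "R \<circ> A = A \<circ> R" if "A \<in> H" for A
    using that
  proof induction
    case one
    show ?case using op_one_left[OF R] op_one_right[OF R] by simp
  next
    case (gen s)
    then show ?case by (rule comm)
  next
    case (add A B)
    then show ?case
      by (simp only: comp_op_add[OF R hecke_image_bounded hecke_image_bounded] op_add_comp)
  next
    case (scale A c)
    then show ?case
      by (simp only: comp_op_scale[OF R hecke_image_bounded] op_scale_comp)
  next
    case (mult A B)
    then show ?case by (metis comp_assoc)
  qed
  then show ?thesis using R by (simp add: commutant_def)
qed

lemma commutant_hecke:
  assumes "R \<in> commutant r X H"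
  shows "R \<in> bounded_ops r X" "s \<in> S \<Longrightarrow> R \<circ> T s = T s \<circ> R"
  using assms hecke_image.gen[of s S G q r] by (auto simp: commutant_def)

lemma commutant_hecke_algebra:
  "operator_algebra r X (commutant r X H)" "op_one r X \<in> commutant r X H"
  using commutant_algebra[OF r_pos, of H X] hecke_image_bounded by auto

lemma N_algebra: "operator_algebra r X N" "op_one r X \<in> N"
  unfolding hecke_double_commutant_def
  using commutant_algebra[OF r_pos, of "commutant r X H" X] by (auto simp: commutant_def)

lemma N_bounded: "Z \<in> N \<Longrightarrow> Z \<in> bounded_ops r X"
  using operator_algebraD(1)[OF N_algebra(1)] by blast

lemma N_commute: "Z \<in> N \<Longrightarrow> R \<in> commutant r X H \<Longrightarrow> Z \<circ> R = R \<circ> Z"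
  by (simp add: hecke_double_commutant_def commutant_def)

lemma hecke_op_in_N: "s \<in> S \<Longrightarrow> T s \<in> N"
  using commutant_hecke(2)[of _ s] hecke_op_bounded[of s]
  by (simp add: hecke_double_commutant_def commutant_def[of r X "commutant r X H"])

lemma right_op_in_commutant: "s \<in> S \<Longrightarrow> right_op s \<in> commutant r X H"
  by (rule commutes_with_hecke_image[OF right_op_bounded]) (simp_all add: hecke_op_right_op)

lemma delta_mult_left:
  assumes "s \<in> S" "w \<in> X" "\<not> ldesc s w"
  shows "T s (delta w) = delta (s \<otimes> w)"
proof
  fix v
  have "v \<in> X \<Longrightarrow> s \<otimes> v = w \<longleftrightarrow> v = s \<otimes> w" using assms by auto
  then show "T s (delta w) v = delta (s \<otimes> w) v"
    using assms r_pos hecke_op_eq[OF assms(1) delta_in_lspace[OF r_pos assms(2)]]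
    by (cases "v \<in> X") (auto simp: lmul_apply delta_def)
qed

text \<open>\<open>N\<close> commutes with the right multiplications.\<close>

lemma N_eqI:
  assumes A: "A \<in> N" and B: "B \<in> N" and eq: "A (delta \<one>) = B (delta \<one>)"
  shows "A = B"
proof (rule bounded_ops_eqI[OF r_pos N_bounded[OF A] N_bounded[OF B]])
  fix w assume w: "w \<in> X"
  \<comment> \<open>Inverses are used because the induction adds letters on the left, whereas the
    operators of the commutant multiply on the right.\<close>
  have "A (delta (inv u)) = B (delta (inv u))" if "u \<in> X" for u
    using that
  proof (induction rule: word_induct)
    case one
    show ?case using eq by simp
  next
    case (step s u)
    define v where "v = inv u"
    have v: "v \<in> X" using step by (simp add: v_def)
    \<comment> \<open>\<open>delta (v s)\<close> equals \<open>(right_op s - c) (delta v)\<close>;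
      the subtracted term is present only if \<open>s\<close> is a right descent.\<close>
    define c where "c = (if rdesc s v then hecke_coeff q s else 0)"
    define g where "g = (\<lambda>x. (- c) * delta v x)"
    have dv: "delta v \<in> lspace r X" by (rule delta_in_lspace[OF r_pos v])
    have g: "g \<in> lspace r X" unfolding g_def by (rule lspace_scale[OF r_pos dv])
    have h: "right_op s (delta v) \<in> lspace r X"
      by (rule bounded_ops_range[OF right_op_bounded[OF step(1)]])
    have "delta (v \<otimes> s) = (\<lambda>x. right_op s (delta v) x + g x)"
    proof
      fix x
      have "x \<otimes> s = v \<longleftrightarrow> x = v \<otimes> s" if "x \<in> X" using that v step(1) by auto
      then show "delta (v \<otimes> s) x = right_op s (delta v) x + g x"
        using dv v step(1)
        by (cases "x \<in> X") (auto simp: right_op_def on_lspace_def rmul_apply delta_def g_def c_def)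
    qed
    then have expand: "Z (delta (v \<otimes> s)) = (\<lambda>x. right_op s (Z (delta v)) x + (- c) * Z (delta v) x)" if Z: "Z \<in> N" for Z
    proof -
      have "Z (right_op s (delta v)) = right_op s (Z (delta v))"
        using fun_cong[OF N_commute[OF Z right_op_in_commutant[OF step(1)]], of "delta v"] by simp
      then show ?thesis
        using bounded_ops_add[OF N_bounded[OF Z] h g] bounded_ops_scale[OF N_bounded[OF Z] dv, of "- c"]
          \<open>delta (v \<otimes> s) = _\<close> by (simp add: g_def)
    qed
    have "inv (s \<otimes> u) = v \<otimes> s" using step by (simp add: v_def inv_mult_group)
    then show ?case
      using expand[OF A] expand[OF B] step(3) by (simp add: v_def)
  qed
  from this[of "inv w"] show "A (delta w) = B (delta w)" using w by simp
qed

end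

context hecke_parameters
begin

subsection \<open>The natural projections\<close>

abbreviation signs :: "('a \<Rightarrow> int) set" where "signs \<equiv> S \<rightarrow>\<^sub>E {-1, 1}"
abbreviation C :: "('a \<Rightarrow> int) set" where "C \<equiv> convergent_signs G S q (min r r')"
abbreviation P :: "('a \<Rightarrow> int) \<Rightarrow> 'a operator" where "P \<equiv> natural_projection G S q r"
abbreviation \<eta> :: "('a \<Rightarrow> int) \<Rightarrow> 'a \<Rightarrow> complex" where "\<eta> \<equiv> eta G S q"

text \<open>The space with the smaller exponent is contained in the other one. A bounded projection
  onto \<open>\<eta> \<epsilon>\<close> needs the vector in one space and the functional in the
  dual.\<close>

lemma C_iff: "\<epsilon> \<in> C \<longleftrightarrow> \<epsilon> \<in> signs \<and> \<eta> \<epsilon> \<in> lspace r X \<and> \<eta> \<epsilon> \<in> lspace r' X"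
proof
  assume "\<epsilon> \<in> C"
  then have e: "\<epsilon> \<in> signs" "\<eta> \<epsilon> \<in> lspace (min r r') X"
    by (auto simp: convergent_signs_iff)
  then show "\<epsilon> \<in> signs \<and> \<eta> \<epsilon> \<in> lspace r X \<and> \<eta> \<epsilon> \<in> lspace r' X"
    using lspace_mono_exponent[OF _ _ e(2)] r_pos r'_pos by simp
next
  assume "\<epsilon> \<in> signs \<and> \<eta> \<epsilon> \<in> lspace r X \<and> \<eta> \<epsilon> \<in> lspace r' X"
  then show "\<epsilon> \<in> C"
    by (simp add: convergent_signs_iff min_def)
qed

lemma finite_S: "finite S"
  using card_S by (metis card.infinite not_numeral_le_zero)

lemma finite_C: "finite C"
proof (rule finite_subset)
  show "C \<subseteq> signs" by (auto simp: convergent_signs_def)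
  show "finite signs" using finite_S by (intro finite_PiE) auto
qed

lemma sign_cases:
  assumes "\<epsilon> \<in> signs" "s \<in> S"
  shows "\<epsilon> s = 1 \<or> \<epsilon> s = -1"
  using PiE_mem[OF assms] by auto

lemma weight_square:
  assumes "\<epsilon> \<in> signs" "s \<in> S"
  shows "weight q \<epsilon> s * weight q \<epsilon> s = 1 + hecke_coeff q s * weight q \<epsilon> s"
proof -
  have qs: "q s > 0" "sqrt (q s) > 0" using q[OF assms(2)] by auto
  have sq: "sqrt (q s) * sqrt (q s) = q s" using qs by simp
  have 1: "sqrt (q s) * sqrt (q s) = 1 + (q s - 1) / sqrt (q s) * sqrt (q s)" using qs by simp
  have 2: "1 / sqrt (q s) * (1 / sqrt (q s)) = 1 + (q s - 1) / sqrt (q s) * (- (1 / sqrt (q s)))"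
    using qs by (simp add: field_simps sq)
  from sign_cases[OF assms] show ?thesis
  proof
    assume "\<epsilon> s = 1"
    then have w: "weight q \<epsilon> s = complex_of_real (sqrt (q s))" using weight_values(1)[of q s \<epsilon>] qs(1) by simp
    show ?thesis
      unfolding w hecke_coeff_def of_real_mult[symmetric] 1 by simp
  next
    assume "\<epsilon> s = -1"
    then have w: "weight q \<epsilon> s = complex_of_real (- (1 / sqrt (q s)))"
      using weight_values(2)[of q s \<epsilon>] qs(1) by simp
    have "- (1 / sqrt (q s)) * - (1 / sqrt (q s)) = 1 + (q s - 1) / sqrt (q s) * (- (1 / sqrt (q s)))"
      using 2 by simp
    then have "complex_of_real (- (1 / sqrt (q s)) * - (1 / sqrt (q s))) =
        complex_of_real (1 + (q s - 1) / sqrt (q s) * (- (1 / sqrt (q s))))"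
      by (rule arg_cong)
    then show ?thesis
      unfolding w hecke_coeff_def by (simp only: of_real_mult of_real_add of_real_1)
  qed
qed

lemma weight_nonzero:
  assumes "\<epsilon> \<in> signs" "s \<in> S"
  shows "weight q \<epsilon> s \<noteq> 0"
  using weight_square[OF assms] by auto

lemma lmul_eta:
  assumes "\<epsilon> \<in> signs" "s \<in> S"
  shows "lmul s (\<eta> \<epsilon>) = (\<lambda>w. weight q \<epsilon> s * \<eta> \<epsilon> w)"
  by (rule eigenfunction) (use assms weight_square eta_step in auto)

lemma eta_unique:
  assumes "\<And>w. w \<notin> X \<Longrightarrow> g w = 0" "\<And>s. s \<in> S \<Longrightarrow> lmul s g = (\<lambda>w. weight q \<epsilon> s * g w)"
  shows "g = (\<lambda>w. g \<one> * \<eta> \<epsilon> w)"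
  by (rule eigenfunction_unique[where c = "weight q \<epsilon>"]) (use assms eta_step in auto)

lemma pairing_add:
  assumes "h \<in> lspace r' X" "f \<in> lspace r X" "g \<in> lspace r X"
  shows "pairing X h (\<lambda>x. f x + g x) = pairing X h f + pairing X h g"
  unfolding pairing_def distrib_left
  by (rule infsum_add; rule abs_summable_summable; rule holder_pairing(1)[OF r r' conjugate]; fact assms)

lemma pairing_scale: "pairing X h (\<lambda>x. c * f x) = c * pairing X h f"
  by (simp add: pairing_def infsum_cmult_right' mult.left_commute)

definition eta_norm :: "('a \<Rightarrow> int) \<Rightarrow> complex" where
  "eta_norm \<epsilon> = pairing X (\<eta> \<epsilon>) (\<eta> \<epsilon>)"

text \<open>\<open>\<eta> \<epsilon>\<close> is real and has the value 1 at the identity, so the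
  bilinear pairing with itself is a sum of squares that is at least 1.\<close>

lemma eta_norm_nonzero:
  assumes "\<epsilon> \<in> C"
  shows "eta_norm \<epsilon> \<noteq> 0"
proof -
  have eta: "\<eta> \<epsilon> \<in> lspace r X" "\<eta> \<epsilon> \<in> lspace r' X" using assms by (auto simp: C_iff)
  have summ: "(\<lambda>x. \<eta> \<epsilon> x * \<eta> \<epsilon> x) summable_on X"
    by (rule abs_summable_summable, rule holder_pairing(1)[OF r r' conjugate]) (use eta in auto)
  have re: "Re (\<eta> \<epsilon> x * \<eta> \<epsilon> x) \<ge> 0" for x
    by (simp add: eta_def)
  have "Re (eta_norm \<epsilon>) = (\<Sum>\<^sub>\<infinity>x\<in>X. Re (\<eta> \<epsilon> x * \<eta> \<epsilon> x))"
    unfolding eta_norm_def pairing_def using infsum_Re[OF summ] by simp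
  also have "\<dots> \<ge> (\<Sum>x\<in>{\<one>}. Re (\<eta> \<epsilon> x * \<eta> \<epsilon> x))"
    by (rule finite_sum_le_infsum) (use summable_on_Re[OF summ] re in auto)
  finally have "Re (eta_norm \<epsilon>) \<ge> 1" by simp
  then show ?thesis by auto
qed

lemma P_eq: "f \<in> lspace r X \<Longrightarrow> P \<epsilon> f = (\<lambda>w. pairing X (\<eta> \<epsilon>) f / eta_norm \<epsilon> * \<eta> \<epsilon> w)"
  by (simp add: natural_projection_def on_lspace_def eta_norm_def)

lemma P_bounded:
  assumes "\<epsilon> \<in> C"
  shows "P \<epsilon> \<in> bounded_ops r X"
proof -
  have eta: "\<eta> \<epsilon> \<in> lspace r X" "\<eta> \<epsilon> \<in> lspace r' X" using assms by (auto simp: C_iff)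
  define K where "K = energy r' X (\<eta> \<epsilon>) / r' + 1 / r"
  have "on_lspace r X (\<lambda>f w. pairing X (\<eta> \<epsilon>) f / eta_norm \<epsilon> * \<eta> \<epsilon> w) \<in> bounded_ops r X"
  proof (rule on_lspace_bounded[OF r_pos, where K = "(K / cmod (eta_norm \<epsilon>)) powr r * energy r X (\<eta> \<epsilon>)"])
    fix f assume f: "f \<in> lspace r X"
    show "(\<lambda>w. pairing X (\<eta> \<epsilon>) f / eta_norm \<epsilon> * \<eta> \<epsilon> w) \<in> lspace r X"
      by (rule lspace_scale[OF r_pos eta(1)])
    have "cmod (pairing X (\<eta> \<epsilon>) f / eta_norm \<epsilon>) \<le> K / cmod (eta_norm \<epsilon>) * lnorm r X f"
      using holder_pairing(2)[OF r r' conjugate eta(2) f]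
      by (simp add: norm_divide divide_right_mono K_def)
    then have "cmod (pairing X (\<eta> \<epsilon>) f / eta_norm \<epsilon>) powr r \<le> (K / cmod (eta_norm \<epsilon>) * lnorm r X f) powr r"
      using r_pos by (intro powr_mono2) auto
    also have "\<dots> = (K / cmod (eta_norm \<epsilon>)) powr r * energy r X f"
      by (simp only: powr_mult energy_lnorm[OF r_pos])
    finally have b: "cmod (pairing X (\<eta> \<epsilon>) f / eta_norm \<epsilon>) powr r \<le> (K / cmod (eta_norm \<epsilon>)) powr r * energy r X f" .
    show "energy r X (\<lambda>w. pairing X (\<eta> \<epsilon>) f / eta_norm \<epsilon> * \<eta> \<epsilon> w)
        \<le> (K / cmod (eta_norm \<epsilon>)) powr r * energy r X (\<eta> \<epsilon>) * energy r X f"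
      unfolding energy_scale
      using mult_right_mono[OF b, of "energy r X (\<eta> \<epsilon>)"] by (simp add: mult_ac)
  next
    fix f g assume "f \<in> lspace r X" "g \<in> lspace r X"
    then show "(\<lambda>w. pairing X (\<eta> \<epsilon>) (\<lambda>x. f x + g x) / eta_norm \<epsilon> * \<eta> \<epsilon> w) =
        (\<lambda>x. pairing X (\<eta> \<epsilon>) f / eta_norm \<epsilon> * \<eta> \<epsilon> x + pairing X (\<eta> \<epsilon>) g / eta_norm \<epsilon> * \<eta> \<epsilon> x)"
      using eta by (simp add: pairing_add add_divide_distrib distrib_right)
  qed (simp add: pairing_scale mult.assoc)
  then show ?thesis by (simp add: natural_projection_def eta_norm_def)
qed

lemma P_outside: "f \<notin> lspace r X \<Longrightarrow> P \<epsilon> f = (\<lambda>x. 0)"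
  by (simp add: natural_projection_def on_lspace_def)

lemma P_form: "\<exists>c. P \<epsilon> f = (\<lambda>w. c * \<eta> \<epsilon> w)"
proof (cases "f \<in> lspace r X")
  case True
  then show ?thesis using P_eq by blast
next
  case False
  then show ?thesis by (intro exI[of _ 0]) (simp add: P_outside)
qed

lemma P_eta:
  assumes "\<epsilon> \<in> C"
  shows "P \<epsilon> (\<lambda>w. c * \<eta> \<epsilon> w) = (\<lambda>w. c * \<eta> \<epsilon> w)"
proof -
  have eta: "\<eta> \<epsilon> \<in> lspace r X" using assms by (auto simp: C_iff)
  show ?thesis
    using P_eq[OF lspace_scale[OF r_pos eta]] eta_norm_nonzero[OF assms]
    by (simp add: pairing_scale flip: eta_norm_def)
qed

lemma P_P: "\<epsilon> \<in> C \<Longrightarrow> P \<epsilon> (P \<epsilon> f) = P \<epsilon> f"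
  using P_form[of \<epsilon> f] P_eta[of \<epsilon>] by auto

lemma P_delta:
  assumes "w \<in> X"
  shows "P \<epsilon> (delta w) = (\<lambda>x. \<eta> \<epsilon> w / eta_norm \<epsilon> * \<eta> \<epsilon> x)"
proof -
  have "pairing X (\<eta> \<epsilon>) (delta w) = (\<Sum>\<^sub>\<infinity>x\<in>{w}. \<eta> \<epsilon> x * delta w x)"
    unfolding pairing_def by (rule infsum_cong_neutral) (use assms in \<open>auto simp: delta_def\<close>)
  then show ?thesis
    using P_eq[OF delta_in_lspace[OF r_pos assms]] by (simp add: delta_def)
qed

lemma T_eta:
  assumes "\<epsilon> \<in> C" "s \<in> S"
  shows "T s (\<lambda>w. c * \<eta> \<epsilon> w) = (\<lambda>w. weight q \<epsilon> s * (c * \<eta> \<epsilon> w))"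
proof -
  have eta: "\<eta> \<epsilon> \<in> lspace r X" and "\<epsilon> \<in> signs" using assms by (auto simp: C_iff)
  then show ?thesis
    using hecke_op_eq[OF assms(2) lspace_scale[OF r_pos eta]] assms(2)
    by (simp add: lmul_scale lmul_eta mult.left_commute)
qed

lemma T_P:
  assumes "\<epsilon> \<in> C" "s \<in> S"
  shows "T s (P \<epsilon> f) = (\<lambda>w. weight q \<epsilon> s * P \<epsilon> f w)"
  using P_form[of \<epsilon> f] T_eta[OF assms] by auto

lemma T_delta:
  assumes "s \<in> S" "w \<in> X"
  shows "T s (delta w) = (\<lambda>v. delta (s \<otimes> w) v + (if ldesc s w then hecke_coeff q s else 0) * delta w v)"
  using hecke_op_delta[OF assms(2)] hecke_basis_eq[OF assms] by (simp add: fun_eq_iff delta_def)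

text \<open>\<open>T s\<close> is symmetric for the pairing. On \<open>delta w\<close> the pairing
  with \<open>\<eta> \<epsilon>\<close> reads off a value, and the two terms combine to
  \<open>lmul s (\<eta> \<epsilon>) w\<close>.\<close>

lemma P_T:
  assumes "\<epsilon> \<in> C" "s \<in> S"
  shows "P \<epsilon> (T s f) = (\<lambda>w. weight q \<epsilon> s * P \<epsilon> f w)"
proof -
  have "P \<epsilon> \<circ> T s = op_scale (weight q \<epsilon> s) (P \<epsilon>)"
  proof (rule bounded_ops_eqI[OF r_pos])
    show "P \<epsilon> \<circ> T s \<in> bounded_ops r X"
      by (rule op_comp_bounded[OF r_pos P_bounded[OF assms(1)] hecke_op_bounded[OF assms(2)]])
    show "op_scale (weight q \<epsilon> s) (P \<epsilon>) \<in> bounded_ops r X"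
      by (rule op_scale_bounded[OF r_pos P_bounded[OF assms(1)]])
    fix w assume w: "w \<in> X"
    define c where "c = (if ldesc s w then hecke_coeff q s else 0)"
    have sw: "s \<otimes> w \<in> X" using w assms by simp
    note d = delta_in_lspace[OF r_pos w] delta_in_lspace[OF r_pos sw]
    have "P \<epsilon> (T s (delta w)) = (\<lambda>x. P \<epsilon> (delta (s \<otimes> w)) x + c * P \<epsilon> (delta w) x)"
      unfolding T_delta[OF assms(2) w] c_def[symmetric]
      using bounded_ops_add[OF P_bounded[OF assms(1)] d(2) lspace_scale[OF r_pos d(1)], of c]
        bounded_ops_scale[OF P_bounded[OF assms(1)] d(1), of c] by simp
    also have "\<dots> = (\<lambda>x. (\<eta> \<epsilon> (s \<otimes> w) + c * \<eta> \<epsilon> w) / eta_norm \<epsilon> * \<eta> \<epsilon> x)"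
      using P_delta[OF w] P_delta[OF sw] by (simp add: add_divide_distrib distrib_right mult.assoc)
    also have "\<eta> \<epsilon> (s \<otimes> w) + c * \<eta> \<epsilon> w = lmul s (\<eta> \<epsilon>) w"
      using w by (simp add: lmul_apply c_def)
    also have "\<dots> = weight q \<epsilon> s * \<eta> \<epsilon> w"
      using lmul_eta[of \<epsilon> s] assms by (simp add: C_iff)
    finally show "(P \<epsilon> \<circ> T s) (delta w) = op_scale (weight q \<epsilon> s) (P \<epsilon>) (delta w)"
      using P_delta[OF w] by (simp add: op_scale_def mult.assoc)
  qed
  from fun_cong[OF this, of f] show ?thesis by (simp add: op_scale_def)
qed

lemma P_in_commutant: "\<epsilon> \<in> C \<Longrightarrow> P \<epsilon> \<in> commutant r X H"
  by (rule commutes_with_hecke_image[OF P_bounded]) (auto simp: P_T T_P fun_eq_iff)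

text \<open>Where the signs differ, \<open>T s\<close> between the two projections acts by two
  different scalars.\<close>

lemma P_orthogonal:
  assumes e: "\<epsilon> \<in> C" "\<epsilon>' \<in> C" "\<epsilon> \<noteq> \<epsilon>'"
  shows "P \<epsilon> (P \<epsilon>' f) = (\<lambda>x. 0)"
proof -
  have "\<exists>s\<in>S. \<epsilon> s \<noteq> \<epsilon>' s"
    using e PiE_ext[of \<epsilon> S "\<lambda>_. {-1, 1}" \<epsilon>'] by (auto simp: C_iff)
  then obtain s where s: "s \<in> S" "\<epsilon> s \<noteq> \<epsilon>' s" by auto
  have qs: "q s > 0" using q s by auto
  then have "sqrt (q s) > 0" "1 / sqrt (q s) > 0" by simp_all
  then have sq: "sqrt (q s) \<noteq> - (1 / sqrt (q s))" by linarith
  have "(\<epsilon> s = 1 \<and> \<epsilon>' s = -1) \<or> (\<epsilon> s = -1 \<and> \<epsilon>' s = 1)"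
    using sign_cases[of \<epsilon> s] sign_cases[of \<epsilon>' s] e s by (auto simp: C_iff)
  then have "Re (weight q \<epsilon> s) \<noteq> Re (weight q \<epsilon>' s)"
    using weight_values[of q s \<epsilon>] weight_values[of q s \<epsilon>'] qs sq sq[symmetric] by auto
  then have ne: "weight q \<epsilon> s \<noteq> weight q \<epsilon>' s" by auto
  define g where "g = P \<epsilon>' f"
  have g: "g \<in> lspace r X" unfolding g_def by (rule bounded_ops_range[OF P_bounded[OF e(2)]])
  have "(\<lambda>x. weight q \<epsilon> s * P \<epsilon> g x) = P \<epsilon> (T s g)"
    using P_T[OF e(1) s(1)] by simp
  also have "T s g = (\<lambda>x. weight q \<epsilon>' s * g x)" unfolding g_def by (rule T_P[OF e(2) s(1)])
  also have "P \<epsilon> \<dots> = (\<lambda>x. weight q \<epsilon>' s * P \<epsilon> g x)"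
    by (rule bounded_ops_scale[OF P_bounded[OF e(1)] g])
  finally have "weight q \<epsilon> s * P \<epsilon> g x = weight q \<epsilon>' s * P \<epsilon> g x" for x by (rule fun_cong)
  then show ?thesis using ne by (auto simp: g_def)
qed

text \<open>An operator commuting with the Hecke algebra maps Hecke eigenvectors to Hecke eigenvectors
  of the same weight, both in the image and, by duality, in the functional of the projection.\<close>

lemma P_in_N:
  assumes e: "\<epsilon> \<in> C"
  shows "P \<epsilon> \<in> N"
proof -
  have eta: "\<eta> \<epsilon> \<in> lspace r X" using e by (auto simp: C_iff)
  have "P \<epsilon> \<circ> R = R \<circ> P \<epsilon>" if RC: "R \<in> commutant r X H" for R
  proof -
    have RT: "R (T s f) = T s (R f)" if "s \<in> S" for s f
      using fun_cong[OF commutant_hecke(2)[OF RC that], of f] by simp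
    have Rb: "R \<in> bounded_ops r X" by (rule commutant_hecke(1)[OF RC])
    define \<nu> where "\<nu> = R (\<eta> \<epsilon>) \<one>"
    have Reta: "R (\<eta> \<epsilon>) = (\<lambda>w. \<nu> * \<eta> \<epsilon> w)"
      unfolding \<nu>_def
    proof (rule eta_unique)
      show "R (\<eta> \<epsilon>) w = 0" if "w \<notin> X" for w
        by (rule lspace_outside[OF bounded_ops_range[OF Rb] that])
      fix s assume s: "s \<in> S"
      have "lmul s (R (\<eta> \<epsilon>)) = T s (R (\<eta> \<epsilon>))"
        by (rule hecke_op_eq[OF s bounded_ops_range[OF Rb], symmetric])
      also have "\<dots> = R (T s (\<eta> \<epsilon>))" using RT[OF s] by simp
      also have "T s (\<eta> \<epsilon>) = (\<lambda>w. weight q \<epsilon> s * \<eta> \<epsilon> w)" using T_eta[OF e s, of 1] by simp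
      also have "R \<dots> = (\<lambda>w. weight q \<epsilon> s * R (\<eta> \<epsilon>) w)" by (rule bounded_ops_scale[OF Rb eta])
      finally show "lmul s (R (\<eta> \<epsilon>)) = (\<lambda>w. weight q \<epsilon> s * R (\<eta> \<epsilon>) w)" .
    qed
    obtain \<mu> where \<mu>: "P \<epsilon> (R (delta \<one>)) = (\<lambda>w. \<mu> * \<eta> \<epsilon> w)" using P_form by blast
    \<comment> \<open>The pairing of \<open>\<eta> \<epsilon>\<close> with \<open>R \<theta>\<close>
      transforms under each \<open>T l\<close> with the weight of \<epsilon>, so it is determined by
      its value at \<open>delta \<one>\<close>.\<close>
    have PR: "P \<epsilon> (R (delta w)) = (\<lambda>x. \<eta> \<epsilon> w * (\<mu> * \<eta> \<epsilon> x))" if "w \<in> X" for w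
      using that
    proof (induction "len w" arbitrary: w rule: less_induct)
      case less
      show ?case
      proof (cases "w = \<one>")
        case True
        then show ?thesis using \<mu> by simp
      next
        case False
        obtain l v where l: "l \<in> S" "v \<in> X" "w = l \<otimes> v" "\<not> ldesc l v" "len v < len w"
          using exists_ldesc[OF less.prems False] by blast
        have "P \<epsilon> (R (delta w)) = P \<epsilon> (T l (R (delta v)))"
          using RT[OF l(1), of "delta v"] delta_mult_left[OF l(1,2,4)] l(3) by simp
        also have "\<dots> = (\<lambda>x. weight q \<epsilon> l * P \<epsilon> (R (delta v)) x)" by (rule P_T[OF e l(1)])
        also have "P \<epsilon> (R (delta v)) = (\<lambda>x. \<eta> \<epsilon> v * (\<mu> * \<eta> \<epsilon> x))" by (rule less.hyps[OF l(5,2)])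
        finally show ?thesis using eta_step[OF l(1,2,4), of q \<epsilon>] l(3) by (simp add: mult.assoc)
      qed
    qed
    have op: "P \<epsilon> \<circ> R = op_scale (\<mu> * eta_norm \<epsilon>) (P \<epsilon>)"
    proof (rule bounded_ops_eqI[OF r_pos op_comp_bounded[OF r_pos P_bounded[OF e] Rb] op_scale_bounded[OF r_pos P_bounded[OF e]]])
      fix w assume w: "w \<in> X"
      show "(P \<epsilon> \<circ> R) (delta w) = op_scale (\<mu> * eta_norm \<epsilon>) (P \<epsilon>) (delta w)"
        using PR[OF w] P_delta[OF w, of \<epsilon>] eta_norm_nonzero[OF e] by (simp add: op_scale_def fun_eq_iff)
    qed
    \<comment> \<open>Both \<open>R P\<close> and \<open>P R\<close> are multiples of
      \<open>P\<close>; comparing them on \<open>\<eta> \<epsilon>\<close>, which \<open>P\<close>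
      fixes, identifies the scalars.\<close>
    have "P \<epsilon> (R (\<eta> \<epsilon>)) \<one> = \<mu> * eta_norm \<epsilon> * P \<epsilon> (\<eta> \<epsilon>) \<one>"
      using fun_cong[OF op, of "\<eta> \<epsilon>"] by (simp add: op_scale_def fun_eq_iff)
    then have lam: "\<nu> = \<mu> * eta_norm \<epsilon>"
      using P_eta[OF e, of 1] P_eta[OF e, of \<nu>] by (simp add: Reta)
    show ?thesis
    proof
      fix f
      obtain c where c: "P \<epsilon> f = (\<lambda>w. c * \<eta> \<epsilon> w)" using P_form by blast
      have "R (P \<epsilon> f) = (\<lambda>w. c * (\<nu> * \<eta> \<epsilon> w))"
        unfolding c using bounded_ops_scale[OF Rb eta, of c] by (simp add: Reta)
      then show "(P \<epsilon> \<circ> R) f = (R \<circ> P \<epsilon>) f"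
        using fun_cong[OF op, of f] by (simp add: op_scale_def c lam mult_ac)
    qed
  qed
  then show ?thesis
    using P_bounded[OF e] by (simp add: hecke_double_commutant_def commutant_def[of r X "commutant r X H"])
qed

lemma N_P:
  assumes Z: "Z \<in> N" and e: "\<epsilon> \<in> C"
  shows "Z (P \<epsilon> f) = P \<epsilon> (Z f)" "\<exists>\<nu>. \<forall>f. Z (P \<epsilon> f) = (\<lambda>x. \<nu> * P \<epsilon> f x)"
proof -
  have eta: "\<eta> \<epsilon> \<in> lspace r X" using e by (auto simp: C_iff)
  have comm: "Z (P \<epsilon> f) = P \<epsilon> (Z f)" for f
    using fun_cong[OF N_commute[OF Z P_in_commutant[OF e]], of f] by simp
  then show "Z (P \<epsilon> f) = P \<epsilon> (Z f)" .
  obtain \<nu> where l: "Z (\<eta> \<epsilon>) = (\<lambda>w. \<nu> * \<eta> \<epsilon> w)"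
  proof -
    have "P \<epsilon> (\<eta> \<epsilon>) = \<eta> \<epsilon>" using P_eta[OF e, of 1] by simp
    then have "Z (\<eta> \<epsilon>) = P \<epsilon> (Z (\<eta> \<epsilon>))"
      using comm[of "\<eta> \<epsilon>"] by (simp only:)
    moreover obtain c where "P \<epsilon> (Z (\<eta> \<epsilon>)) = (\<lambda>w. c * \<eta> \<epsilon> w)" using P_form by blast
    ultimately show thesis by (intro that[of c]) (rule trans)
  qed
  have "Z (P \<epsilon> f) = (\<lambda>x. \<nu> * P \<epsilon> f x)" for f
  proof -
    obtain c where c: "P \<epsilon> f = (\<lambda>w. c * \<eta> \<epsilon> w)" using P_form by blast
    show ?thesis
      unfolding c bounded_ops_scale[OF N_bounded[OF Z] eta] l by (simp add: mult.left_commute)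
  qed
  then show "\<exists>\<nu>. \<forall>f. Z (P \<epsilon> f) = (\<lambda>x. \<nu> * P \<epsilon> f x)" by blast
qed

lemma hecke_eigenvectors:
  assumes e: "\<epsilon> \<in> C"
  shows "{f. hecke_eigenvector G S q r (weight q \<epsilon>) f} = {\<lambda>w. z * \<eta> \<epsilon> w | z. z \<noteq> 0}"
proof (intro equalityI subsetI)
  fix f assume "f \<in> {f. hecke_eigenvector G S q r (weight q \<epsilon>) f}"
  then have f: "f \<in> lspace r X" "f \<noteq> (\<lambda>w. 0)" "\<And>s. s \<in> S \<Longrightarrow> T s f = (\<lambda>w. weight q \<epsilon> s * f w)"
    by (auto simp: hecke_eigenvector_def)
  have "f = (\<lambda>w. f \<one> * \<eta> \<epsilon> w)"
    by (rule eta_unique) (use f hecke_op_eq[OF _ f(1)] lspace_outside[OF f(1)] in auto)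
  moreover from this have "f \<one> \<noteq> 0" using f(2) by auto
  ultimately show "f \<in> {\<lambda>w. z * \<eta> \<epsilon> w | z. z \<noteq> 0}" by blast
next
  fix f assume "f \<in> {\<lambda>w. z * \<eta> \<epsilon> w | z. z \<noteq> 0}"
  then obtain z where z: "f = (\<lambda>w. z * \<eta> \<epsilon> w)" "z \<noteq> 0" by blast
  have eta: "\<eta> \<epsilon> \<in> lspace r X" using e by (auto simp: C_iff)
  have "f \<one> \<noteq> 0" using z by simp
  then have "f \<noteq> (\<lambda>w. 0)" by auto
  then show "f \<in> {f. hecke_eigenvector G S q r (weight q \<epsilon>) f}"
    using T_eta[OF e] lspace_scale[OF r_pos eta] z by (simp add: hecke_eigenvector_def)
qed

lemma range_P:
  assumes e: "\<epsilon> \<in> C"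
  shows "range (P \<epsilon>) = insert (\<lambda>w. 0) {\<lambda>w. z * \<eta> \<epsilon> w | z. z \<noteq> 0}"
proof (intro equalityI subsetI)
  fix g assume "g \<in> range (P \<epsilon>)"
  then obtain c where "g = (\<lambda>w. c * \<eta> \<epsilon> w)" using P_form by blast
  then show "g \<in> insert (\<lambda>w. 0) {\<lambda>w. z * \<eta> \<epsilon> w | z. z \<noteq> 0}"
    by (cases "c = 0") auto
next
  fix g assume "g \<in> insert (\<lambda>w. 0) {\<lambda>w. z * \<eta> \<epsilon> w | z. z \<noteq> 0}"
  then obtain z where "g = (\<lambda>w. z * \<eta> \<epsilon> w)"
  proof
    assume "g = (\<lambda>w. 0)"
    then have "g = (\<lambda>w. 0 * \<eta> \<epsilon> w)" by simp
    then show thesis by (rule that)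
  qed (use that in blast)
  then have "g = P \<epsilon> g" using P_eta[OF e] by simp
  then show "g \<in> range (P \<epsilon>)" by (metis rangeI)
qed

subsection \<open>The centre\<close>

text \<open>Both \<open>T s\<close> and \<open>right_op s\<close> send \<open>delta \<one>\<close>
  to \<open>delta s\<close>, and \<open>Z\<close> commutes with both: this is the trace property.
  Membership in the dual space follows from the functional that evaluates \<open>Z \<theta>\<close>
  at the identity.\<close>

lemma centre_coefficients:
  assumes Z: "Z \<in> centre N"
  defines "\<zeta> \<equiv> Z (delta \<one>)"
  shows "\<zeta> \<in> lspace r X" "\<zeta> \<in> lspace r' X" "\<And>s. s \<in> S \<Longrightarrow> lmul s \<zeta> = rmul s \<zeta>"
proof -
  have ZN: "Z \<in> N" using Z by (simp add: centre_def)
  have Zb: "Z \<in> bounded_ops r X" by (rule N_bounded[OF ZN])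
  have ZT: "Z (T s f) = T s (Z f)" if "s \<in> S" for s f
  proof -
    have "Z \<circ> T s = T s \<circ> Z"
      using Z hecke_op_in_N[OF that] unfolding centre_def by blast
    from fun_cong[OF this, of f] show ?thesis by simp
  qed
  have d1: "delta \<one> \<in> lspace r X" by (rule delta_in_lspace[OF r_pos]) simp
  show \<zeta>: "\<zeta> \<in> lspace r X" unfolding \<zeta>_def by (rule bounded_ops_range[OF Zb])
  show "lmul s \<zeta> = rmul s \<zeta>" if s: "s \<in> S" for s
  proof -
    have "lmul s \<zeta> = Z (T s (delta \<one>))"
      using hecke_op_eq[OF s \<zeta>] ZT[OF s] by (simp add: \<zeta>_def)
    also have "T s (delta \<one>) = delta s"
      using hecke_op_eq[OF s d1] lmul_delta_one[OF s] by simp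
    also have "delta s = right_op s (delta \<one>)"
      using rmul_delta_one[OF s] d1 by (simp add: right_op_def on_lspace_def)
    also have "Z (right_op s (delta \<one>)) = right_op s \<zeta>"
      using fun_cong[OF N_commute[OF ZN right_op_in_commutant[OF s]], of "delta \<one>"] by (simp add: \<zeta>_def)
    also have "\<dots> = rmul s \<zeta>" using \<zeta> by (simp add: right_op_def on_lspace_def)
    finally show ?thesis .
  qed
  \<comment> \<open>Used for \<open>u = \<one>\<close>, but the induction moves letters of
    \<open>w\<close> over to \<open>u\<close>. Additivity of lengths keeps every such step free of
    p-terms.\<close>
  have coeff: "Z (delta w) u = \<zeta> (inv w \<otimes> u)"
    if "w \<in> X" "u \<in> X" "len (inv w \<otimes> u) = len w + len u" for w u
    using that
  proof (induction "len w" arbitrary: w u rule: less_induct)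
    case less
    show ?case
    proof (cases "w = \<one>")
      case True
      then show ?thesis using less.prems by (simp add: \<zeta>_def)
    next
      case False
      obtain l v where l: "l \<in> S" "v \<in> X" "w = l \<otimes> v" "\<not> ldesc l v" "len v < len w"
        using exists_ldesc[OF less.prems(1) False] by blast
      have lenw: "len w = Suc (len v)" using len_not_ldesc[OF l(1,2,4)] l(3) by simp
      have iw: "inv w \<otimes> u = inv v \<otimes> (l \<otimes> u)"
        using l less.prems by (simp add: inv_mult_group m_assoc)
      have lu: "l \<otimes> u \<in> X" using l less.prems by simp
      have "len (inv v \<otimes> (l \<otimes> u)) \<le> len v + len (l \<otimes> u)"
        using len_mult_le[of "inv v" "l \<otimes> u"] l lu len_inv by simp
      then have nd: "\<not> ldesc l u" and len_lu: "len (l \<otimes> u) = Suc (len u)"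
        using less.prems(3) iw lenw len_not_ldesc[OF l(1) less.prems(2)] by (auto simp: ldesc_def)
      have "Z (delta w) u = T l (Z (delta v)) u"
        using ZT[OF l(1), of "delta v"] delta_mult_left[OF l(1,2,4)] l(3) by simp
      also have "\<dots> = Z (delta v) (l \<otimes> u)"
        using hecke_op_eq[OF l(1) bounded_ops_range[OF Zb]] nd less.prems(2) by (simp add: lmul_apply)
      also have "\<dots> = \<zeta> (inv v \<otimes> (l \<otimes> u))"
        using less.prems(3) iw lenw len_lu by (intro less.hyps[OF l(5,2) lu]) simp
      finally show ?thesis using iw by simp
    qed
  qed
  \<comment> \<open>The row of \<open>Z\<close> at the identity.\<close>
  define a where "a = (\<lambda>w. if w \<in> X then \<zeta> (inv w) else 0)"
  obtain K where K: "\<forall>f\<in>lspace r X. lnorm r X (Z f) \<le> K * lnorm r X f"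
    using bounded_ops_bound[OF Zb] by (elim exE conjE)
  have "a \<in> lspace r' X"
  proof (rule lspace_of_bounded_functional[OF r r' conjugate])
    show "a x = 0" if "x \<notin> X" for x using that by (simp add: a_def)
    fix F \<theta> assume F: "finite F" "F \<subseteq> X" "\<And>x. x \<notin> F \<Longrightarrow> \<theta> x = (0::complex)"
    have "Z \<theta> \<one> = (\<Sum>w\<in>F. \<theta> w * Z (delta w) \<one>)"
      by (rule bounded_ops_finite_support[OF r_pos Zb F])
    also have "\<dots> = (\<Sum>w\<in>F. a w * \<theta> w)"
    proof (rule sum.cong)
      fix w assume "w \<in> F"
      then have w: "w \<in> X" using F by auto
      then show "\<theta> w * Z (delta w) \<one> = a w * \<theta> w"
        using coeff[OF w, of \<one>] len_inv[OF w] by (simp add: a_def)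
    qed simp
    finally have "cmod (\<Sum>w\<in>F. a w * \<theta> w) = cmod (Z \<theta> \<one>)" by simp
    also have "\<dots> \<le> lnorm r X (Z \<theta>)"
      by (rule cmod_le_lnorm[OF r_pos bounded_ops_range[OF Zb]]) simp
    also have "\<dots> \<le> K * lnorm r X \<theta>"
      by (rule bspec[OF K finite_support_lspace(1)[OF r_pos F]])
    finally show "cmod (\<Sum>w\<in>F. a w * \<theta> w) \<le> K * lnorm r X \<theta>" .
  qed
  moreover have "bij_betw (\<lambda>w. inv w) X X"
    by (rule bij_betwI[where g = "\<lambda>w. inv w"]) auto
  ultimately have "(\<lambda>w. if w \<in> X then a (inv w) else 0) \<in> lspace r' X"
    by (intro lspace_reindex(1))
  moreover have "(\<lambda>w. if w \<in> X then a (inv w) else 0) = \<zeta>"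
    using lspace_outside[OF \<zeta>] by (auto simp: a_def fun_eq_iff)
  ultimately show "\<zeta> \<in> lspace r' X" by simp
qed

end

context hecke_parameters
begin

text \<open>The traces that factor through the commutative quotient of the Hecke algebra. Both
  exponents are kept so that the eigenfunctions found in it belong to signs in
  \<open>C\<close>.\<close>

definition trace_space :: "('a \<Rightarrow> complex) set" where
  "trace_space = {g \<in> lspace r X \<inter> lspace r' X. (\<forall>s\<in>S. lmul s g = rmul s g) \<and>
     (\<forall>s\<in>S. \<forall>t\<in>S. lmul s (lmul t g) = lmul t (lmul s g))}"

text \<open>Commuting left multiplications make \<open>lmul s g\<close> a trace again, so the
  spectral projections stay inside.\<close>

lemma trace_space_linear:
  assumes g: "g \<in> trace_space" and s: "s \<in> S"
  shows "(\<lambda>w. \<alpha> * lmul s g w + \<beta> * g w) \<in> trace_space"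
proof -
  define h where "h = (\<lambda>w. \<alpha> * lmul s g w + \<beta> * g w)"
  have gl: "g \<in> lspace r X" "g \<in> lspace r' X"
    and tr: "\<And>t. t \<in> S \<Longrightarrow> lmul t g = rmul t g"
    and comm: "\<And>t u. t \<in> S \<Longrightarrow> u \<in> S \<Longrightarrow> lmul t (lmul u g) = lmul u (lmul t g)"
    using g by (auto simp: trace_space_def)
  have "h \<in> lspace r X"
    unfolding h_def
    by (rule lspace_add(1)[OF r_pos lspace_scale[OF r_pos lmul_lspace(1)[OF s r_pos gl(1)]] lspace_scale[OF r_pos gl(1)]])
  moreover have "h \<in> lspace r' X"
    unfolding h_def
    by (rule lspace_add(1)[OF r'_pos lspace_scale[OF r'_pos lmul_lspace(1)[OF s r'_pos gl(2)]] lspace_scale[OF r'_pos gl(2)]])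
  moreover have "lmul t h = rmul t h" if t: "t \<in> S" for t
  proof -
    have "rmul t (lmul s g) = lmul t (lmul s g)"
      using lmul_rmul_commute[OF s t, of g] comm[OF s t] by (simp flip: tr[OF t])
    then show ?thesis
      unfolding h_def by (simp only: lmul_add lmul_scale rmul_add rmul_scale tr[OF t])
  qed
  moreover have "lmul t (lmul u h) = lmul u (lmul t h)" if t: "t \<in> S" and u: "u \<in> S" for t u
  proof -
    have "lmul t (lmul u (lmul s g)) = rmul s (lmul t (lmul u g))"
      using t u s by (simp only: tr[OF s] lmul_rmul_commute)
    also have "\<dots> = rmul s (lmul u (lmul t g))" by (simp only: comm[OF t u])
    also have "\<dots> = lmul u (lmul t (lmul s g))"
      using t u s by (simp only: tr[OF s] lmul_rmul_commute)
    finally show ?thesis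
      unfolding h_def by (simp only: lmul_add lmul_scale comm[OF t u])
  qed
  ultimately show ?thesis by (simp add: trace_space_def flip: h_def)
qed

text \<open>The eigenvalues determine signs, hence \<open>g\<close> up to a scalar. If
  \<open>g\<close> is non-zero, \<open>\<eta> \<epsilon>\<close> inherits membership in both
  spaces.\<close>

lemma joint_eigenfunction:
  assumes g: "g \<in> trace_space"
    and eigen: "\<And>s. s \<in> S \<Longrightarrow> lmul s g = (\<lambda>w. complex_of_real (sqrt (q s)) * g w) \<or>
      lmul s g = (\<lambda>w. - complex_of_real (1 / sqrt (q s)) * g w)"
  shows "\<exists>k. g = (\<lambda>w. \<Sum>\<epsilon>\<in>C. k \<epsilon> * \<eta> \<epsilon> w)"
proof -
  have gl: "g \<in> lspace r X" "g \<in> lspace r' X" using g by (auto simp: trace_space_def)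
  \<comment> \<open>For \<open>g = 0\<close> both equations hold and either sign is correct.\<close>
  define \<epsilon> :: "'a \<Rightarrow> int" where
    "\<epsilon> = (\<lambda>s\<in>S. if lmul s g = (\<lambda>w. complex_of_real (sqrt (q s)) * g w) then 1 else -1)"
  have signs: "\<epsilon> \<in> signs" by (auto simp: \<epsilon>_def)
  have "g = (\<lambda>w. g \<one> * \<eta> \<epsilon> w)"
  proof (rule eta_unique)
    show "g w = 0" if "w \<notin> X" for w by (rule lspace_outside[OF gl(1) that])
    fix s assume s: "s \<in> S"
    have qs: "q s > 0" using q[OF s] by simp
    show "lmul s g = (\<lambda>w. weight q \<epsilon> s * g w)"
    proof (cases "lmul s g = (\<lambda>w. complex_of_real (sqrt (q s)) * g w)")
      case True
      then have "\<epsilon> s = 1" using s by (simp add: \<epsilon>_def)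
      then show ?thesis using weight_values(1)[of q s \<epsilon>] qs True by simp
    next
      case False
      then have "\<epsilon> s = -1" using s by (simp add: \<epsilon>_def)
      then have "weight q \<epsilon> s = - complex_of_real (1 / sqrt (q s))"
        using weight_values(2)[of q s \<epsilon>] qs by simp
      then show ?thesis using eigen[OF s] False by simp
    qed
  qed
  then obtain c where g_eq: "g = (\<lambda>w. c * \<eta> \<epsilon> w)" by blast
  show ?thesis
  proof (cases "c = 0")
    case True
    then have "g = (\<lambda>w. \<Sum>\<epsilon>\<in>C. 0 * \<eta> \<epsilon> w)" using g_eq by simp
    then show ?thesis by (rule exI[of _ "\<lambda>_. 0"])
  next
    case False
    then have "\<eta> \<epsilon> = (\<lambda>w. (1 / c) * g w)"
      by (simp add: g_eq)
    then have "\<epsilon> \<in> C"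
      using lspace_scale[OF r_pos gl(1), of "1 / c"] lspace_scale[OF r'_pos gl(2), of "1 / c"] signs
      by (simp add: C_iff)
    then have "(\<Sum>\<epsilon>'\<in>C. (if \<epsilon>' = \<epsilon> then c else 0) * \<eta> \<epsilon>' w) = g w" for w
      using finite_C by (simp add: g_eq if_distrib[of "\<lambda>x. x * _"] sum.delta cong: if_cong)
    then have "g = (\<lambda>w. \<Sum>\<epsilon>'\<in>C. (if \<epsilon>' = \<epsilon> then c else 0) * \<eta> \<epsilon>' w)" by simp
    then show ?thesis by (rule exI[of _ "\<lambda>\<epsilon>'. if \<epsilon>' = \<epsilon> then c else 0"])
  qed
qed

lemma sums_of_eigenfunctions:
  assumes "h \<in> sums_of J" "\<And>g. g \<in> J \<Longrightarrow> \<exists>k. g = (\<lambda>w. \<Sum>\<epsilon>\<in>C. k \<epsilon> * \<eta> \<epsilon> w)"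
  shows "\<exists>k. h = (\<lambda>w. \<Sum>\<epsilon>\<in>C. k \<epsilon> * \<eta> \<epsilon> w)"
  using assms(1)
proof induction
  case zero
  have "(\<lambda>w. 0) = (\<lambda>w. \<Sum>\<epsilon>\<in>C. 0 * \<eta> \<epsilon> w)" by simp
  then show ?case by (rule exI[of _ "\<lambda>_. 0"])
next
  case (add g h)
  obtain k where k: "g = (\<lambda>w. \<Sum>\<epsilon>\<in>C. k \<epsilon> * \<eta> \<epsilon> w)" using assms(2)[OF add(1)] ..
  obtain l where l: "h = (\<lambda>w. \<Sum>\<epsilon>\<in>C. l \<epsilon> * \<eta> \<epsilon> w)" using add.IH ..
  have "(\<lambda>w. g w + h w) = (\<lambda>w. \<Sum>\<epsilon>\<in>C. (k \<epsilon> + l \<epsilon>) * \<eta> \<epsilon> w)"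
    by (simp add: k l distrib_right sum.distrib)
  then show ?case by (rule exI[of _ "\<lambda>\<epsilon>. k \<epsilon> + l \<epsilon>"])
qed

text \<open>Once the multiple of \<open>delta \<one>\<close> is removed, \<zeta> lies in
  \<open>trace_space\<close> and is a combination of the \<open>\<eta> \<epsilon>\<close>. The
  corresponding operator belongs to \<open>N\<close> and agrees with \<open>Z\<close> at
  \<open>delta \<one>\<close>, which is enough.\<close>

lemma centre_form:
  assumes Z: "Z \<in> centre N"
  shows "\<exists>c k. Z = op_add (op_scale c (op_one r X)) (\<lambda>f x. \<Sum>\<epsilon>\<in>C. k \<epsilon> * P \<epsilon> f x)"
proof -
  define \<zeta> where "\<zeta> = Z (delta \<one>)"
  have \<zeta>: "\<zeta> \<in> lspace r X" "\<zeta> \<in> lspace r' X" "\<And>s. s \<in> S \<Longrightarrow> lmul s \<zeta> = rmul s \<zeta>"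
    unfolding \<zeta>_def by (rule centre_coefficients[OF Z])+
  interpret hecke_trace G S m "hecke_coeff q" \<zeta>
    by unfold_locales (use \<zeta> lspace_outside[OF \<zeta>(1)] lspace_decay[OF r_pos \<zeta>(1)] in auto)
  from trace_structure obtain c where c: "\<forall>s\<in>S. \<forall>t\<in>S.
      lmul t (lmul s (\<lambda>w. \<zeta> w - c * delta \<one> w)) = lmul s (lmul t (\<lambda>w. \<zeta> w - c * delta \<one> w))" ..
  define z where "z = (\<lambda>w. \<zeta> w - c * delta \<one> w)"
  have d1: "delta \<one> \<in> lspace a X" if "a > 0" for a by (rule delta_in_lspace[OF that]) simp
  have "z \<in> lspace r X" "z \<in> lspace r' X"
    unfolding z_def
    by (rule lspace_diff[OF r_pos \<zeta>(1) lspace_scale[OF r_pos d1[OF r_pos]]],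
        rule lspace_diff[OF r'_pos \<zeta>(2) lspace_scale[OF r'_pos d1[OF r'_pos]]])
  moreover have "lmul s z = rmul s z" if "s \<in> S" for s
    unfolding z_def lmul_diff rmul_diff lmul_scale rmul_scale \<zeta>(3)[OF that] lmul_delta_one[OF that] rmul_delta_one[OF that] ..
  moreover have "lmul s (lmul t z) = lmul t (lmul s z)" if "s \<in> S" "t \<in> S" for s t
    using c that unfolding z_def by blast
  ultimately have zV: "z \<in> trace_space" by (simp add: trace_space_def)
  have "z \<in> sums_of {g \<in> trace_space. \<forall>s\<in>S. lmul s g = (\<lambda>w. complex_of_real (sqrt (q s)) * g w) \<or>
      lmul s g = (\<lambda>w. - complex_of_real (1 / sqrt (q s)) * g w)}"
  proof (rule spectral_decomposition[OF finite_S order_refl _ _ _ trace_space_linear _ _ zV])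
    fix s assume s: "s \<in> S"
    then have qs: "sqrt (q s) > 0" "sqrt (q s) * sqrt (q s) = q s" using q[OF s] by simp_all
    have "sqrt (q s) \<noteq> - (1 / sqrt (q s))"
      using qs(1) by (smt (verit) divide_pos_pos)
    then show "complex_of_real (sqrt (q s)) \<noteq> - complex_of_real (1 / sqrt (q s))"
      by (metis of_real_eq_iff of_real_minus)
    have "sqrt (q s) + - (1 / sqrt (q s)) = (q s - 1) / sqrt (q s)"
      using qs by (simp add: field_simps)
    then show "complex_of_real (sqrt (q s)) + - complex_of_real (1 / sqrt (q s)) = hecke_coeff q s"
      unfolding hecke_coeff_def by (metis of_real_add of_real_minus)
    show "complex_of_real (sqrt (q s)) * - complex_of_real (1 / sqrt (q s)) = -1"
      using qs(1) by simp
  next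
    fix g w assume "g \<in> trace_space" "w \<notin> X"
    then show "g w = 0" unfolding trace_space_def using lspace_outside[of g r X w] by blast
  next
    fix g s t assume "g \<in> trace_space" "s \<in> S" "t \<in> S"
    then show "lmul s (lmul t g) = lmul t (lmul s g)" unfolding trace_space_def by blast
  qed
  then have "\<exists>k. z = (\<lambda>w. \<Sum>\<epsilon>\<in>C. k \<epsilon> * \<eta> \<epsilon> w)"
    by (rule sums_of_eigenfunctions) (use joint_eigenfunction in blast)
  then obtain k where k: "z = (\<lambda>w. \<Sum>\<epsilon>\<in>C. k \<epsilon> * \<eta> \<epsilon> w)" ..
  \<comment> \<open>\<open>P \<epsilon>\<close> maps \<open>delta \<one>\<close> to
    \<open>\<eta> \<epsilon>\<close> divided by \<open>eta_norm \<epsilon>\<close>; this factor is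
    compensated.\<close>
  define k' where "k' = (\<lambda>\<epsilon>. k \<epsilon> * eta_norm \<epsilon>)"
  define Y where "Y = op_add (op_scale c (op_one r X)) (\<lambda>f x. \<Sum>\<epsilon>\<in>C. k' \<epsilon> * P \<epsilon> f x)"
  have YN: "Y \<in> N"
    unfolding Y_def
    using N_algebra operator_algebra_sum[OF N_algebra(1) finite_C P_in_N, where k = k']
    by (intro operator_algebraD[OF N_algebra(1)]) auto
  have "Y (delta \<one>) x = \<zeta> x" for x
  proof -
    have "(\<Sum>\<epsilon>\<in>C. k' \<epsilon> * P \<epsilon> (delta \<one>) x) = (\<Sum>\<epsilon>\<in>C. k \<epsilon> * \<eta> \<epsilon> x)"
      by (rule sum.cong) (auto simp: P_delta k'_def eta_norm_nonzero)
    also have "\<dots> = \<zeta> x - c * delta \<one> x"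
      using fun_cong[OF k, of x] by (simp add: z_def)
    finally show ?thesis
      using d1[OF r_pos] by (simp add: Y_def op_add_def op_scale_def op_one_def on_lspace_def)
  qed
  then have "Z = Y"
    using Z YN by (intro N_eqI) (auto simp: centre_def \<zeta>_def)
  then show ?thesis unfolding Y_def by blast
qed

subsection \<open>The direct sum decomposition\<close>

definition complement_unit :: "'a operator" where
  "complement_unit = (\<lambda>f x. op_one r X f x - (\<Sum>\<epsilon>\<in>C. P \<epsilon> f x))"

text \<open>The factor M. Described by annihilation of the projections, it is an algebra at once; it
  has \<open>complement_unit\<close> as its unit.\<close>

definition complement :: "'a operator set" where
  "complement = {Z \<in> N. \<forall>\<epsilon>\<in>C. Z \<circ> P \<epsilon> = op_zero}"

lemma complement_unit_alt:
  "complement_unit = op_add (op_one r X) (\<lambda>f x. \<Sum>\<epsilon>\<in>C. (- 1) * P \<epsilon> f x)"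
  by (simp add: complement_unit_def op_add_def sum_negf fun_eq_iff)

lemma complement_unit_in_N: "complement_unit \<in> N"
  unfolding complement_unit_alt
  using N_algebra operator_algebra_sum[OF N_algebra(1) finite_C P_in_N, where k = "\<lambda>_. - 1"]
  by (intro operator_algebraD[OF N_algebra(1)]) auto

lemma complement_unit_in_commutant: "complement_unit \<in> commutant r X H"
  unfolding complement_unit_alt
  using commutant_hecke_algebra operator_algebra_sum[OF commutant_hecke_algebra(1) finite_C P_in_commutant, where k = "\<lambda>_. - 1"]
  by (intro operator_algebraD[OF commutant_hecke_algebra(1)]) auto

lemma complement_unit_apply:
  "f \<in> lspace r X \<Longrightarrow> complement_unit f x = f x - (\<Sum>\<epsilon>\<in>C. P \<epsilon> f x)"
  by (simp add: complement_unit_def op_one_def on_lspace_def)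

lemma sum_P_P:
  assumes "\<epsilon> \<in> C"
  shows "(\<Sum>\<epsilon>'\<in>C. P \<epsilon>' (P \<epsilon> f) x) = P \<epsilon> f x"
proof -
  have "(\<Sum>\<epsilon>'\<in>C. P \<epsilon>' (P \<epsilon> f) x) = (\<Sum>\<epsilon>'\<in>C. if \<epsilon>' = \<epsilon> then P \<epsilon> f x else 0)"
    by (rule sum.cong) (use assms P_P P_orthogonal in auto)
  then show ?thesis using assms finite_C by simp
qed

lemma complement_unit_P:
  assumes "\<epsilon> \<in> C"
  shows "complement_unit (P \<epsilon> f) = (\<lambda>x. 0)" "P \<epsilon> (complement_unit f) = (\<lambda>x. 0)"
proof -
  show *: "complement_unit (P \<epsilon> f) = (\<lambda>x. 0)"
    using sum_P_P[OF assms] complement_unit_apply[OF bounded_ops_range[OF P_bounded[OF assms]]]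
    by (simp add: fun_eq_iff)
  show "P \<epsilon> (complement_unit f) = (\<lambda>x. 0)"
    using N_P(1)[OF complement_unit_in_N assms, of f] * by simp
qed

lemma complement_apply_P:
  assumes "Z \<in> complement" "\<epsilon> \<in> C"
  shows "Z (P \<epsilon> f) = (\<lambda>x. 0)"
proof -
  have "Z \<circ> P \<epsilon> = op_zero" using assms unfolding complement_def by blast
  from fun_cong[OF this, of f] show ?thesis by (simp add: op_zero_def)
qed

lemma complementI:
  assumes "Z \<in> N" "\<And>\<epsilon> f. \<epsilon> \<in> C \<Longrightarrow> Z (P \<epsilon> f) = (\<lambda>x. 0)"
  shows "Z \<in> complement"
  unfolding complement_def
proof (intro CollectI conjI ballI ext assms(1))
  show "(Z \<circ> P \<epsilon>) f x = op_zero f x" if "\<epsilon> \<in> C" for \<epsilon> f x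
    using assms(2)[OF that, of f] by simp
qed

lemma complement_N: "Z \<in> complement \<Longrightarrow> Z \<in> N"
  by (simp add: complement_def)

lemma complement_algebra: "operator_algebra r X complement"
  unfolding operator_algebra_def
proof (intro conjI ballI allI)
  show "complement \<subseteq> bounded_ops r X" using complement_N N_bounded by blast
  show "op_zero \<in> complement"
    by (rule complementI[OF operator_algebraD(2)[OF N_algebra(1)]]) (simp add: op_zero_def)
  fix A B assume A: "A \<in> complement" and B: "B \<in> complement"
  show "op_add A B \<in> complement"
    by (rule complementI[OF operator_algebraD(3)[OF N_algebra(1) complement_N[OF A] complement_N[OF B]]])
      (simp add: op_add_def complement_apply_P[OF A] complement_apply_P[OF B])
  show "A \<circ> B \<in> complement"
    by (rule complementI[OF operator_algebraD(4)[OF N_algebra(1) complement_N[OF A] complement_N[OF B]]])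
      (simp add: complement_apply_P[OF B] bounded_ops_zero[OF N_bounded[OF complement_N[OF A]]])
next
  fix c A assume A: "A \<in> complement"
  show "op_scale c A \<in> complement"
    by (rule complementI[OF operator_algebraD(5)[OF N_algebra(1) complement_N[OF A]]])
      (simp add: op_scale_def complement_apply_P[OF A])
qed

lemma complement_unit_in_complement: "complement_unit \<in> complement"
  by (rule complementI[OF complement_unit_in_N]) (rule complement_unit_P)

lemma N_complement_unit:
  assumes "Z \<in> N"
  shows "complement_unit (Z f) = Z (complement_unit f)"
  using fun_cong[OF N_commute[OF assms complement_unit_in_commutant], of f] by simp

lemma complement_unit_left:
  assumes "Z \<in> complement"
  shows "complement_unit (Z f) = Z f"
proof -
  have ZN: "Z \<in> N" by (rule complement_N[OF assms])
  have "P \<epsilon> (Z f) = (\<lambda>x. 0)" if "\<epsilon> \<in> C" for \<epsilon>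
    using N_P(1)[OF ZN that, of f] complement_apply_P[OF assms that] by simp
  then show ?thesis
    using complement_unit_apply[OF bounded_ops_range[OF N_bounded[OF ZN]]] by (simp add: fun_eq_iff)
qed

lemma complement_unit_comp:
  assumes Y: "Y \<in> N"
  shows "complement_unit \<circ> Y \<in> complement"
proof (rule complementI)
  show "complement_unit \<circ> Y \<in> N"
    by (rule operator_algebraD(4)[OF N_algebra(1) complement_unit_in_N Y])
  show "(complement_unit \<circ> Y) (P \<epsilon> f) = (\<lambda>x. 0)" if "\<epsilon> \<in> C" for \<epsilon> f
    using N_P(1)[OF Y that, of f] complement_unit_P[OF that] by simp
qed

lemma exists_not_commuting: "\<exists>s\<in>S. \<exists>t\<in>S. s \<otimes> t \<noteq> t \<otimes> s"
proof (rule ccontr)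
  assume neg: "\<not> ?thesis"
  obtain s where s: "s \<in> S" using card_S by fastforce
  have "{s} = S"
    by (rule connected) (use s neg in auto)
  then have "card S = 1" by (metis card.empty card_insert_disjoint empty_iff finite.emptyI One_nat_def)
  then show False using card_S by simp
qed

text \<open>Otherwise \<open>delta \<one>\<close> would be a combination of the
  \<open>\<eta> \<epsilon>\<close>, on which left multiplications commute, contrary to the existence
  of non-commuting generators.\<close>

lemma complement_unit_nonzero: "complement_unit \<noteq> op_zero"
proof
  assume zero: "complement_unit = op_zero"
  obtain s t where st: "s \<in> S" "t \<in> S" "s \<otimes> t \<noteq> t \<otimes> s" using exists_not_commuting by blast
  have d1: "delta \<one> \<in> lspace r X" by (rule delta_in_lspace[OF r_pos]) simp
  define k where "k = (\<lambda>\<epsilon>. 1 / eta_norm \<epsilon>)"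
  have "delta \<one> x = (\<Sum>\<epsilon>\<in>C. P \<epsilon> (delta \<one>) x)" for x
    using complement_unit_apply[OF d1, of x] by (simp add: zero)
  then have d: "delta \<one> = (\<lambda>x. \<Sum>\<epsilon>\<in>C. k \<epsilon> * \<eta> \<epsilon> x)"
    by (simp add: P_delta k_def fun_eq_iff)
  have ll: "lmul a (\<lambda>x. \<Sum>\<epsilon>\<in>C. k \<epsilon> * \<eta> \<epsilon> x) = (\<lambda>x. \<Sum>\<epsilon>\<in>C. k \<epsilon> * weight q \<epsilon> a * \<eta> \<epsilon> x)"
    if a: "a \<in> S" for a k
  proof
    fix x
    have "lmul a (\<lambda>x. \<Sum>\<epsilon>\<in>C. k \<epsilon> * \<eta> \<epsilon> x) x = (\<Sum>\<epsilon>\<in>C. k \<epsilon> * lmul a (\<eta> \<epsilon>) x)"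
      by (simp add: lmul_def sum.distrib sum_distrib_left distrib_left mult.left_commute)
    also have "\<dots> = (\<Sum>\<epsilon>\<in>C. k \<epsilon> * weight q \<epsilon> a * \<eta> \<epsilon> x)"
      by (rule sum.cong) (use a lmul_eta in \<open>auto simp: C_iff\<close>)
    finally show "lmul a (\<lambda>x. \<Sum>\<epsilon>\<in>C. k \<epsilon> * \<eta> \<epsilon> x) x = (\<Sum>\<epsilon>\<in>C. k \<epsilon> * weight q \<epsilon> a * \<eta> \<epsilon> x)" .
  qed
  have "lmul t (lmul s (delta \<one>)) = lmul s (lmul t (delta \<one>))"
    unfolding d ll[OF st(1)] ll[OF st(2)] by (simp add: mult_ac)
  then have "delta (t \<otimes> s) (t \<otimes> s) = delta (s \<otimes> t) (t \<otimes> s)"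
    unfolding lmul_lmul_delta_one[OF st] lmul_lmul_delta_one[OF st(2,1) st(3)[symmetric]] by (rule fun_cong)
  then show False using st by (simp add: delta_def split: if_splits)
qed

text \<open>A central element of \<open>complement\<close> is central in \<open>N\<close>, hence of
  the form given by \<open>centre_form\<close>; composing with \<open>complement_unit\<close>
  removes the projections and leaves a scalar.\<close>

lemma complement_factor: "is_factor r X complement"
  unfolding is_factor_def
proof (intro conjI bexI[of _ complement_unit] ballI)
  show "operator_algebra r X complement" by (rule complement_algebra)
  show "complement_unit \<noteq> op_zero" by (rule complement_unit_nonzero)
  show "complement_unit \<in> complement" by (rule complement_unit_in_complement)
  fix Z assume Z: "Z \<in> complement"
  show "complement_unit \<circ> Z = Z" using complement_unit_left[OF Z] by (simp add: fun_eq_iff)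
  show "Z \<circ> complement_unit = Z"
    using complement_unit_left[OF Z] N_complement_unit[OF complement_N[OF Z]] by (simp add: fun_eq_iff)
next
  show "centre complement = range (\<lambda>c. op_scale c complement_unit)"
  proof (intro equalityI subsetI)
    fix Z assume Zc: "Z \<in> centre complement"
    then have Z: "Z \<in> complement" by (simp add: centre_def)
    have ZN: "Z \<in> N" by (rule complement_N[OF Z])
    have Zu: "Z (complement_unit f) = Z f" for f
      using complement_unit_left[OF Z] N_complement_unit[OF ZN] by simp
    \<comment> \<open>For \<open>Y\<close> in \<open>N\<close>, the cut-down
      \<open>complement_unit \<circ> Y\<close> lies in \<open>complement\<close>, and
      \<open>Z\<close> does not see the rest of \<open>Y\<close>.\<close>
    have "Z \<in> centre N"
      unfolding centre_def
    proof (intro CollectI conjI ballI ZN ext)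
      fix Y f x assume Y: "Y \<in> N"
      define Y' where "Y' = complement_unit \<circ> Y"
      have "Y' \<in> complement" unfolding Y'_def by (rule complement_unit_comp[OF Y])
      then have "Z \<circ> Y' = Y' \<circ> Z" using Zc unfolding centre_def by blast
      from fun_cong[OF this, of f] have "Z (complement_unit (Y f)) = complement_unit (Y (Z f))"
        by (simp add: Y'_def)
      then have "Z (Y f) = complement_unit (Y (Z f))" by (simp add: Zu)
      also have "\<dots> = Y (Z f)"
        using N_complement_unit[OF Y, of "Z f"] complement_unit_left[OF Z] by simp
      finally show "(Z \<circ> Y) f x = (Y \<circ> Z) f x" by simp
    qed
    from centre_form[OF this] obtain c k
      where ck: "Z = op_add (op_scale c (op_one r X)) (\<lambda>f x. \<Sum>\<epsilon>\<in>C. k \<epsilon> * P \<epsilon> f x)" by blast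
    have "Z f x = c * complement_unit f x" for f x
    proof -
      have u: "complement_unit f \<in> lspace r X"
        by (rule bounded_ops_range[OF N_bounded[OF complement_unit_in_N]])
      have "Z f x = Z (complement_unit f) x" by (simp add: Zu)
      also have "\<dots> = c * complement_unit f x + (\<Sum>\<epsilon>\<in>C. k \<epsilon> * P \<epsilon> (complement_unit f) x)"
        unfolding ck using u by (simp add: op_add_def op_scale_def op_one_def on_lspace_def)
      also have "(\<Sum>\<epsilon>\<in>C. k \<epsilon> * P \<epsilon> (complement_unit f) x) = 0"
        by (rule sum.neutral) (simp add: complement_unit_P)
      finally show ?thesis by simp
    qed
    then have "Z = op_scale c complement_unit" by (simp add: op_scale_def fun_eq_iff)
    then show "Z \<in> range (\<lambda>c. op_scale c complement_unit)" by blast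
  next
    fix Z assume "Z \<in> range (\<lambda>c. op_scale c complement_unit)"
    then obtain c where c: "Z = op_scale c complement_unit" by blast
    have "op_scale c complement_unit \<circ> Y = Y \<circ> op_scale c complement_unit" if Y: "Y \<in> complement" for Y
    proof
      fix f
      have u: "complement_unit f \<in> lspace r X"
        by (rule bounded_ops_range[OF N_bounded[OF complement_unit_in_N]])
      show "(op_scale c complement_unit \<circ> Y) f = (Y \<circ> op_scale c complement_unit) f"
        using bounded_ops_scale[OF N_bounded[OF complement_N[OF Y]] u, of c]
          N_complement_unit[OF complement_N[OF Y], of f] by (simp add: op_scale_def)
    qed
    then show "Z \<in> centre complement"
      unfolding c centre_def
      using operator_algebraD(5)[OF complement_algebra complement_unit_in_complement] by blast
  qed
qed

lemma line_algebra:
  assumes e: "\<epsilon> \<in> C"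
  shows "operator_algebra r X (range (\<lambda>z. op_scale z (P \<epsilon>)))"
  unfolding operator_algebra_def
proof (intro conjI ballI allI)
  show "range (\<lambda>z. op_scale z (P \<epsilon>)) \<subseteq> bounded_ops r X"
    using op_scale_bounded[OF r_pos P_bounded[OF e]] by blast
  have "op_zero = op_scale 0 (P \<epsilon>)" by (simp add: op_zero_def op_scale_def)
  then show "op_zero \<in> range (\<lambda>z. op_scale z (P \<epsilon>))" by blast
  fix A B assume "A \<in> range (\<lambda>z. op_scale z (P \<epsilon>))" "B \<in> range (\<lambda>z. op_scale z (P \<epsilon>))"
  then obtain a b where ab: "A = op_scale a (P \<epsilon>)" "B = op_scale b (P \<epsilon>)" by blast
  have "op_add A B = op_scale (a + b) (P \<epsilon>)" by (simp add: ab op_add_def op_scale_def distrib_right)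
  then show "op_add A B \<in> range (\<lambda>z. op_scale z (P \<epsilon>))" by blast
  have "A \<circ> B = op_scale (a * b) (P \<epsilon>)"
  proof
    fix f
    show "(A \<circ> B) f = op_scale (a * b) (P \<epsilon>) f"
      using bounded_ops_scale[OF P_bounded[OF e] bounded_ops_range[OF P_bounded[OF e]], of b f]
      by (simp add: ab op_scale_def P_P[OF e] mult.assoc)
  qed
  then show "A \<circ> B \<in> range (\<lambda>z. op_scale z (P \<epsilon>))" by blast
next
  fix c A assume "A \<in> range (\<lambda>z. op_scale z (P \<epsilon>))"
  then obtain a where "A = op_scale a (P \<epsilon>)" by blast
  then have "op_scale c A = op_scale (c * a) (P \<epsilon>)" by (simp add: op_scale_def mult.assoc)
  then show "op_scale c A \<in> range (\<lambda>z. op_scale z (P \<epsilon>))" by blast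
qed

end

context hecke_parameters
begin

abbreviation summand_index :: "('a \<Rightarrow> int) option set" where
  "summand_index \<equiv> insert None (Some ` C)"

abbreviation summand :: "('a \<Rightarrow> int) option \<Rightarrow> 'a operator set" where
  "summand \<equiv> case_option complement (\<lambda>\<epsilon>. range (\<lambda>z. op_scale z (P \<epsilon>)))"

lemma sum_summands: "(\<Sum>i\<in>summand_index. g i) = g None + (\<Sum>\<epsilon>\<in>C. g (Some \<epsilon>))"
  using finite_C by (subst sum.insert) (auto simp: sum.reindex)

lemma summand_components:
  assumes b: "b \<in> (\<Pi>\<^sub>E i\<in>summand_index. summand i)"
  shows "b None \<in> complement" "\<epsilon> \<in> C \<Longrightarrow> \<exists>z. b (Some \<epsilon>) = op_scale z (P \<epsilon>)"
  using PiE_mem[OF b, of None] PiE_mem[OF b, of "Some \<epsilon>"] by auto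

text \<open>Evaluation on the range of \<open>P \<epsilon>\<close> isolates one component of a sum;
  this yields the uniqueness of the decomposition.\<close>

lemma summand_sum_P:
  assumes b: "b \<in> (\<Pi>\<^sub>E i\<in>summand_index. summand i)" and e: "\<epsilon> \<in> C"
  shows "(\<Sum>i\<in>summand_index. b i (P \<epsilon> f) x) = b (Some \<epsilon>) f x"
proof -
  have "b (Some \<epsilon>') (P \<epsilon> f) x = (if \<epsilon>' = \<epsilon> then b (Some \<epsilon>) f x else 0)" if e': "\<epsilon>' \<in> C" for \<epsilon>'
  proof -
    obtain z where z: "b (Some \<epsilon>') = op_scale z (P \<epsilon>')" using summand_components(2)[OF b e'] ..
    show ?thesis
    proof (cases "\<epsilon>' = \<epsilon>")
      case True
      then show ?thesis using z P_P[OF e, of f] by (simp add: op_scale_def)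
    next
      case False
      then show ?thesis using z P_orthogonal[OF e' e, of f] by (simp add: op_scale_def)
    qed
  qed
  then have "(\<Sum>\<epsilon>'\<in>C. b (Some \<epsilon>') (P \<epsilon> f) x) = (\<Sum>\<epsilon>'\<in>C. if \<epsilon>' = \<epsilon> then b (Some \<epsilon>) f x else 0)"
    by (intro sum.cong) auto
  then show ?thesis
    using complement_apply_P[OF summand_components(1)[OF b] e, of f] e finite_C by (simp add: sum_summands)
qed

lemma summands_orthogonal:
  assumes "i \<in> summand_index" "j \<in> summand_index" "i \<noteq> j" "A \<in> summand i" "B \<in> summand j"
  shows "A \<circ> B = op_zero"
proof
  fix f
  have left: "Z (op_scale z (P \<epsilon>) f) = (\<lambda>x. 0)" if Z: "Z \<in> complement" and e: "\<epsilon> \<in> C" for Z \<epsilon> z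
    using bounded_ops_scale[OF N_bounded[OF complement_N[OF Z]] bounded_ops_range[OF P_bounded[OF e]], of z f]
      complement_apply_P[OF Z e] by (simp add: op_scale_def)
  have right: "op_scale z (P \<epsilon>) (Z f) = (\<lambda>x. 0)" if Z: "Z \<in> complement" and e: "\<epsilon> \<in> C" for Z \<epsilon> z
  proof -
    have "P \<epsilon> (Z f) = (\<lambda>x. 0)"
      using N_P(1)[OF complement_N[OF Z] e, of f] complement_apply_P[OF Z e, of f] by simp
    then show ?thesis by (simp add: op_scale_def)
  qed
  have both: "op_scale z (P \<epsilon>) (op_scale y (P \<delta>) f) = (\<lambda>x. 0)" if e: "\<epsilon> \<in> C" "\<delta> \<in> C" "\<epsilon> \<noteq> \<delta>" for \<epsilon> \<delta> z y
    using bounded_ops_scale[OF P_bounded[OF e(1)] bounded_ops_range[OF P_bounded[OF e(2)]], of y f]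
      P_orthogonal[OF e, of f] by (simp add: op_scale_def)
  show "(A \<circ> B) f = op_zero f"
    using assms left right by (auto simp: op_zero_def) (use both in blast)
qed

lemma direct_sum: "algebra_direct_sum r X N summand_index summand"
  unfolding algebra_direct_sum_def
proof (intro conjI ballI impI)
  show "finite summand_index" using finite_C by simp
  show "operator_algebra r X (summand i)" if "i \<in> summand_index" for i
    using that complement_algebra line_algebra by auto
  show "A \<circ> A' = op_zero" if "i \<in> summand_index" "j \<in> summand_index" "i \<noteq> j" "A \<in> summand i" "A' \<in> summand j"
    for i j A A'
    using that by (rule summands_orthogonal)
  show "bij_betw (\<lambda>b f x. \<Sum>i\<in>summand_index. b i f x) (\<Pi>\<^sub>E i\<in>summand_index. summand i) N"
    unfolding bij_betw_def
  proof
    show "inj_on (\<lambda>b f x. \<Sum>i\<in>summand_index. b i f x) (\<Pi>\<^sub>E i\<in>summand_index. summand i)"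
    proof (rule inj_onI)
      fix b c
      assume b: "b \<in> (\<Pi>\<^sub>E i\<in>summand_index. summand i)" and c: "c \<in> (\<Pi>\<^sub>E i\<in>summand_index. summand i)"
        and eq: "(\<lambda>f x. \<Sum>i\<in>summand_index. b i f x) = (\<lambda>f x. \<Sum>i\<in>summand_index. c i f x)"
      have eq': "(\<Sum>i\<in>summand_index. b i f x) = (\<Sum>i\<in>summand_index. c i f x)" for f x
        by (rule fun_cong[OF fun_cong[OF eq]])
      have some: "b (Some \<epsilon>) f x = c (Some \<epsilon>) f x" if e: "\<epsilon> \<in> C" for \<epsilon> f x
        using eq'[of "P \<epsilon> f" x] summand_sum_P[OF b e] summand_sum_P[OF c e] by simp
      have none: "b None f x = c None f x" for f x
      proof -
        have "(\<Sum>\<epsilon>\<in>C. b (Some \<epsilon>) f x) = (\<Sum>\<epsilon>\<in>C. c (Some \<epsilon>) f x)"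
          using some by (intro sum.cong) auto
        then show ?thesis using eq'[of f x] by (simp add: sum_summands)
      qed
      show "b = c"
      proof (rule PiE_ext[OF b c])
        fix i assume "i \<in> summand_index"
        then show "b i = c i" using some none by (auto simp: fun_eq_iff)
      qed
    qed
    show "(\<lambda>b f x. \<Sum>i\<in>summand_index. b i f x) ` (\<Pi>\<^sub>E i\<in>summand_index. summand i) = N"
    proof (intro equalityI subsetI)
      fix Y assume "Y \<in> (\<lambda>b f x. \<Sum>i\<in>summand_index. b i f x) ` (\<Pi>\<^sub>E i\<in>summand_index. summand i)"
      then obtain b where b: "b \<in> (\<Pi>\<^sub>E i\<in>summand_index. summand i)" and Y: "Y = (\<lambda>f x. \<Sum>i\<in>summand_index. b i f x)"
        by blast
      have "b (Some \<epsilon>) \<in> N" if e: "\<epsilon> \<in> C" for \<epsilon>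
        using summand_components(2)[OF b e] operator_algebraD(5)[OF N_algebra(1) P_in_N[OF e]] by auto
      then have "(\<lambda>f x. \<Sum>\<epsilon>\<in>C. 1 * b (Some \<epsilon>) f x) \<in> N"
        by (rule operator_algebra_sum[OF N_algebra(1) finite_C])
      then have "op_add (b None) (\<lambda>f x. \<Sum>\<epsilon>\<in>C. 1 * b (Some \<epsilon>) f x) \<in> N"
        by (rule operator_algebraD(3)[OF N_algebra(1) complement_N[OF summand_components(1)[OF b]]])
      then show "Y \<in> N" by (simp add: Y sum_summands op_add_def)
    next
      fix Y assume Y: "Y \<in> N"
      \<comment> \<open>The components are the products of \<open>Y\<close> with
        \<open>complement_unit\<close> and with the projections; the latter are scalar multiples of
        \<open>P \<epsilon>\<close> by \<open>N_P\<close>.\<close>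
      define b where "b = (\<lambda>i\<in>summand_index. case i of None \<Rightarrow> complement_unit \<circ> Y | Some \<epsilon> \<Rightarrow> (\<lambda>f. P \<epsilon> (Y f)))"
      have "(\<lambda>f. P \<epsilon> (Y f)) \<in> range (\<lambda>z. op_scale z (P \<epsilon>))" if e: "\<epsilon> \<in> C" for \<epsilon>
      proof -
        obtain \<nu> where "\<forall>f. Y (P \<epsilon> f) = (\<lambda>x. \<nu> * P \<epsilon> f x)" using N_P(2)[OF Y e] ..
        then have "(\<lambda>f. P \<epsilon> (Y f)) = op_scale \<nu> (P \<epsilon>)"
          using N_P(1)[OF Y e] by (simp add: op_scale_def fun_eq_iff)
        then show ?thesis by blast
      qed
      then have bB: "b \<in> (\<Pi>\<^sub>E i\<in>summand_index. summand i)"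
        using complement_unit_comp[OF Y] by (auto simp: b_def)
      have "Y = (\<lambda>f x. \<Sum>i\<in>summand_index. b i f x)"
        using complement_unit_apply[OF bounded_ops_range[OF N_bounded[OF Y]]]
        by (simp add: sum_summands b_def)
      then show "Y \<in> (\<lambda>b f x. \<Sum>i\<in>summand_index. b i f x) ` (\<Pi>\<^sub>E i\<in>summand_index. summand i)"
        using bB by (rule image_eqI)
    qed
  qed
qed

text \<open>Every \<open>P \<epsilon>\<close> is central in \<open>N\<close>. It is no multiple of
  the identity, because \<open>P \<epsilon> (delta \<one>)\<close> is non-zero at any
  generator.\<close>

lemma N_factor_iff: "is_factor r X N \<longleftrightarrow> C = {}"
proof
  assume "is_factor r X N"
  then obtain e where e: "e \<in> N" "\<forall>A\<in>N. e \<circ> A = A \<and> A \<circ> e = A" "centre N = range (\<lambda>c. op_scale c e)"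
    unfolding is_factor_def by blast
  have "e = e \<circ> op_one r X" by (rule op_one_right[OF N_bounded[OF e(1)], symmetric])
  then have e1: "e = op_one r X" using e(2) N_algebra(2) by simp
  show "C = {}"
  proof (rule ccontr)
    assume "C \<noteq> {}"
    then obtain \<epsilon> where eps: "\<epsilon> \<in> C" by blast
    have "P \<epsilon> \<circ> A = A \<circ> P \<epsilon>" if "A \<in> N" for A
      using N_commute[OF that P_in_commutant[OF eps]] by (rule sym)
    then have "P \<epsilon> \<in> centre N" using P_in_N[OF eps] unfolding centre_def by blast
    then obtain c where c: "P \<epsilon> = op_scale c (op_one r X)" unfolding e(3) e1 by blast
    obtain s where s: "s \<in> S" using exists_not_commuting by blast
    have s1: "s \<noteq> \<one>" using ldesc_mult_self[of s \<one>] not_ldesc_one[of s] s by auto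
    have "P \<epsilon> (delta \<one>) s = 0"
      using s1 by (simp add: c op_scale_def op_one_def on_lspace_def delta_def)
    moreover have "P \<epsilon> (delta \<one>) s = 1 / eta_norm \<epsilon> * \<eta> \<epsilon> s" by (simp add: P_delta)
    moreover have "\<eta> \<epsilon> s = weight q \<epsilon> s" using eta_step[of s \<one> q \<epsilon>] s by simp
    ultimately show False
      using eta_norm_nonzero[OF eps] weight_nonzero[of \<epsilon> s] eps s by (simp add: C_iff)
  qed
next
  assume C: "C = {}"
  have "complement = N" by (auto simp: complement_def C)
  then show "is_factor r X N" using complement_factor by simp
qed

text \<open>As \<open>q s \<le> 1\<close>, the constant sign 1 gives the weight of smaller modulus
  at each generator, so its series converges absolutely whenever any of them does.\<close>

lemma C_empty_iff: "C = {} \<longleftrightarrow> (\<lambda>s\<in>S. 1) \<notin> C"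
proof
  define \<iota> :: "'a \<Rightarrow> int" where "\<iota> = (\<lambda>s\<in>S. 1)"
  have \<iota>: "\<iota> \<in> signs" by (auto simp: \<iota>_def)
  assume not: "(\<lambda>s\<in>S. 1) \<notin> C"
  show "C = {}"
  proof (rule ccontr)
    assume "C \<noteq> {}"
    then obtain \<epsilon> where e: "\<epsilon> \<in> C" by blast
    have es: "\<epsilon> \<in> signs" and eta: "\<eta> \<epsilon> \<in> lspace (min r r') X"
      using e by (auto simp: convergent_signs_iff)
    have wt: "cmod (weight q \<iota> s) \<le> cmod (weight q \<epsilon> s)" if s: "s \<in> S" for s
    proof -
      have qs: "0 < q s" "q s \<le> 1" using q[OF s] by auto
      have "cmod (weight q \<iota> s) = sqrt (q s)"
        using weight_values(1)[of q s \<iota>] qs s by (simp add: \<iota>_def)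
      moreover have "cmod (weight q \<epsilon> s) = sqrt (q s) \<or> cmod (weight q \<epsilon> s) = 1 / sqrt (q s)"
        using sign_cases[OF es s] weight_values[of q s \<epsilon>] qs by (auto simp: norm_divide)
      moreover have "sqrt (q s) \<le> 1 / sqrt (q s)"
        using qs by (simp add: field_simps)
      ultimately show ?thesis by auto
    qed
    have le: "cmod (\<eta> \<iota> w) \<le> cmod (\<eta> \<epsilon> w)" if "w \<in> X" for w
      using that
    proof (induction "len w" arbitrary: w rule: less_induct)
      case less
      show ?case
      proof (cases "w = \<one>")
        case False
        obtain l v where l: "l \<in> S" "v \<in> X" "w = l \<otimes> v" "\<not> ldesc l v" "len v < len w"
          using exists_ldesc[OF less.prems False] by blast
        have "cmod (weight q \<iota> l) * cmod (\<eta> \<iota> v) \<le> cmod (weight q \<epsilon> l) * cmod (\<eta> \<epsilon> v)"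
          using wt[OF l(1)] less.hyps[OF l(5,2)] by (intro mult_mono) auto
        then show ?thesis
          using eta_step[OF l(1,2,4), of q \<iota>] eta_step[OF l(1,2,4), of q \<epsilon>] l(3) by (simp add: norm_mult)
      qed simp
    qed
    have "\<eta> \<iota> \<in> lspace (min r r') X"
      by (rule lspace_comparison(1)[OF eta, where c = 1])
        (use le r_pos r'_pos in \<open>auto intro!: powr_mono2\<close>)
    then have "\<iota> \<in> C" using \<iota> by (simp add: convergent_signs_iff)
    with not show False unfolding \<iota>_def by (rule notE)
  qed
qed blast

lemma one_in_C_iff:
  "(\<lambda>s\<in>S. 1) \<in> C \<longleftrightarrow>
     (\<lambda>w. signed_powr (q_elem G S q (\<lambda>s\<in>S. 1) w) (min r r' / 2)) summable_on X"
proof -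
  have "(\<lambda>s\<in>S. 1) \<in> signs" by auto
  then show ?thesis
    by (subst summable_on_iff_abs_summable_on_real) (simp add: convergent_signs_def)
qed

end

section \<open>From the Coxeter presentation to the decomposition of the double commutant\<close>

theorem theoremA:
  fixes G :: "('a, 'b) monoid_scheme" and S :: "'a set" and m :: "'a \<Rightarrow> 'a \<Rightarrow> enat"
    and q :: "'a \<Rightarrow> real" and r r' :: real
  assumes "right_angled_coxeter_system G S m"
    and "irreducible_system G S"
    and "finite S" and "card S \<ge> 3"
    and "\<forall>s\<in>S. 0 < q s \<and> q s \<le> 1"
    and "1 < r" and "1 / r + 1 / r' = 1"
  defines "N \<equiv> hecke_double_commutant G S q r"
    and "C \<equiv> convergent_signs G S q (min r r')"
    and "p \<equiv> natural_projection G S q r"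
  shows "(\<forall>\<epsilon>\<in>C.
            {\<eta>. hecke_eigenvector G S q r (weight q \<epsilon>) \<eta>}
              = {\<lambda>w. z * eta G S q \<epsilon> w | z. z \<noteq> 0} \<and>
            p \<epsilon> \<in> bounded_ops r (carrier G) \<and> p \<epsilon> \<circ> p \<epsilon> = p \<epsilon> \<and>
            range (p \<epsilon>) = insert (\<lambda>w. 0) {\<eta>. hecke_eigenvector G S q r (weight q \<epsilon>) \<eta>})
       \<and> (\<exists>M. is_factor r (carrier G) M \<and>
            algebra_direct_sum r (carrier G) N (insert None (Some ` C))
              (case_option M (\<lambda>\<epsilon>. range (\<lambda>z. op_scale z (p \<epsilon>)))))
       \<and> (is_factor r (carrier G) N \<longleftrightarrow>
            \<not> (\<lambda>w. signed_powr (q_elem G S q (\<lambda>s\<in>S. 1) w) (min r r' / 2)) summable_on carrier G)"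
proof -
  interpret group G
    using assms(1) by (simp add: right_angled_coxeter_system_def group_presentation_def)
  interpret racg G S m
    by unfold_locales (rule assms(1))
  interpret irreducible_racg G S m
  proof
    fix A assume "A \<subseteq> S" "A \<noteq> {}"
      "\<And>a x. a \<in> A \<Longrightarrow> x \<in> S \<Longrightarrow> a \<otimes>\<^bsub>G\<^esub> x \<noteq> x \<otimes>\<^bsub>G\<^esub> a \<Longrightarrow> x \<in> A"
    then show "A = S" by (rule irreducible_connected[OF assms(2)])
  qed (rule assms(4))
  interpret hecke_parameters G S m q r r'
    by unfold_locales (use assms in auto)
  show ?thesis
    unfolding N_def C_def p_def
  proof (intro conjI ballI exI)
    fix \<epsilon> assume e: "\<epsilon> \<in> convergent_signs G S q (min r r')"
    show ev: "{\<eta>. hecke_eigenvector G S q r (weight q \<epsilon>) \<eta>} = {\<lambda>w. z * eta G S q \<epsilon> w | z. z \<noteq> 0}"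
      by (rule hecke_eigenvectors[OF e])
    show "natural_projection G S q r \<epsilon> \<in> bounded_ops r (carrier G)"
      by (rule P_bounded[OF e])
    show "natural_projection G S q r \<epsilon> \<circ> natural_projection G S q r \<epsilon> = natural_projection G S q r \<epsilon>"
      using P_P[OF e] by (simp add: fun_eq_iff)
    show "range (natural_projection G S q r \<epsilon>) =
        insert (\<lambda>w. 0) {\<eta>. hecke_eigenvector G S q r (weight q \<epsilon>) \<eta>}"
      unfolding ev by (rule range_P[OF e])
  next
    show "is_factor r (carrier G) complement" by (rule complement_factor)
    show "algebra_direct_sum r (carrier G) (hecke_double_commutant G S q r)
        (insert None (Some ` convergent_signs G S q (min r r')))
        (case_option complement (\<lambda>\<epsilon>. range (\<lambda>z. op_scale z (natural_projection G S q r \<epsilon>))))"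
      by (rule direct_sum)
  next
    show "is_factor r (carrier G) (hecke_double_commutant G S q r) \<longleftrightarrow>
        \<not> (\<lambda>w. signed_powr (q_elem G S q (\<lambda>s\<in>S. 1) w) (min r r' / 2)) summable_on carrier G"
      unfolding N_factor_iff C_empty_iff one_in_C_iff ..
  qed
qed

end
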